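(* Let $r,c\in S_N(1)$, let $C\in\mathbb{R}_+^{N\times N}$ be a cost matrix, let $X^*$ be a solution of the (non-regularized) optimal transport problem $\min_{X\in\mathcal{U}(r,c)}\langle C,X\rangle$, and let $\varepsilon>0$. The Accelerated Sinkhorn algorithm (described in the context, with $\gamma=\frac{\varepsilon}{3\ln N}$, $\varepsilon'=\frac{\varepsilon}{8\|C\|_\infty}$ and stopping tolerances $\frac{\varepsilon}{6}$) finds a matrix $\widehat X\in\mathcal{U}(r,c)$ with $$\langle C,\widehat X\rangle-\langle C,X^*\rangle\le\varepsilon$$ with total complexity $$O\left(\frac{N^{5/2}\sqrt{\ln N}\,\|C\|_\infty}{\varepsilon}\right)$$ arithmetic operations, namely in $O\left(\frac{N^{1/2}\sqrt{\ln N}\,\|C\|_\infty}{\varepsilon}\right)$ iterations, each requiring $O(N^2)$ arithmetic operations.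
   Context: $\mathbf{1}\in\mathbb{R}^N$ is the vector of all ones; $S_N(1)=\{s\in\mathbb{R}^N_+:\langle s,\mathbf{1}\rangle=1\}$; $\mathcal{U}(r,c)=\{X\in\mathbb{R}_+^{N\times N}:X\mathbf{1}=r,\ X^T\mathbf{1}=c\}$; $\langle A,B\rangle=\sum_{i,j}A_{ij}B_{ij}$; $\|C\|_\infty=\max_{i,j}|C^{ij}|$; $\ln X$ is taken elementwise. Accelerated Sinkhorn algorithm (input: accuracy $\varepsilon$). Set $\gamma=\frac{\varepsilon}{3\ln N}$, $\varepsilon'=\frac{\varepsilon}{8\|C\|_\infty}$, and $$(\tilde r,\tilde c)=\left(1-\frac{\varepsilon'}{8}\right)\left((r,c)+\frac{\varepsilon'}{8N}(\mathbf 1,\mathbf 1)\right).$$ Consider the entropy-regularized problem of minimizing $f(X)=\langle C,X\rangle+\gamma\langle X,\ln X\rangle$ over $X\in Q=\{X\in\mathbb{R}_+^{N\times N}:\mathbf{1}^TX\mathbf{1}=1\}$ subject to $X\mathbf{1}=\tilde r$, $X^T\mathbf{1}=\tilde c$, whose dual is the minimization over $\lambda=(y,z)\in\mathbb{R}^N\times\mathbb{R}^N$ of $$\phi(y,z)=\gamma\ln\Big(\sum_{i,j=1}^N\exp\big(-(y^i+z^j+C^{ij})/\gamma\big)\Big)+\langle y,\tilde r\rangle+\langle z,\tilde c\rangle .$$ Let $X(\lambda)$ be the matrix with entries proportional to $\exp(-(y^i+z^j+C^{ij})/\gamma)$, normalized to total sum $1$. Starting from $A_0=a_0=0$, $\eta^0=\zeta^0=0$,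 for $k=0,1,2,\dots$ perform the iteration: $\beta_k\in\arg\min_{\beta\in[0,1]}\phi(\eta^k+\beta(\zeta^k-\eta^k))$; $\lambda^k=\beta_k\zeta^k+(1-\beta_k)\eta^k$; choose the block ($y$ or $z$) with the larger partial gradient norm $\|\nabla_i\phi(\lambda^k)\|_2$ and let $\eta^{k+1}$ be obtained from $\lambda^k$ by exact minimization of $\phi$ over this block; find $a_{k+1}$, $A_{k+1}=A_k+a_{k+1}$ from $\phi(\lambda^k)-\frac{a_{k+1}^2}{2A_{k+1}}\|\nabla\phi(\lambda^k)\|_2^2=\phi(\eta^{k+1})$; $\zeta^{k+1}=\zeta^k-a_{k+1}\nabla\phi(\lambda^k)$; $\widehat X_{k+1}=(a_{k+1}X(\lambda^k)+A_k\widehat X_k)/A_{k+1}$. After each iteration the current $\widehat X_k$ is projected (rounded) to a point $\widehat X\in\mathcal{U}(r,c)$ by the rounding procedure of Altschuler, Weed and Rigollet, which for a nonnegative matrix $F$ returns $G\in\mathcal{U}(r,c)$ with $\|G-F\|_1\le2(\|F\mathbf{1}-r\|_1+\|F^T\mathbf{1}-c\|_1)$ ($\|\cdot\|_1$ the entrywise $\ell_1$ norm). The algorithm stops and returns $\widehat X$ once $$\langle C,\widehat X-\widehat X_k\rangle\le\frac{\varepsilon}{6}\quad\text{and}\quad f(\widehat X_k)+\phi(\eta^k)\le\frac{\varepsilon}{6}.$$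
   Formalization: Marginal shift is ε'/(N(8-ε')), as the printed one makes φ unbounded below in each block; N≥2, ‖C‖∞>0, ε<64‖C‖∞; exact line search is an oracle charged as q evaluations of φ (constant depends on q); if the gradient vanishes, X(λ^k) itself becomes the next average. *)

theory Defs
  imports
    "HOL-Analysis.Derivative"
    "HOL-Library.Monad_Syntax"
    "Jordan_Normal_Form.Matrix"
begin

unbundle no vec_syntax
hide_type (open) Finite_Cartesian_Product.vec
hide_const (open) Finite_Cartesian_Product.vec Finite_Cartesian_Product.mat
no_notation inner (infix "\<bullet>" 70)

section \<open>Optimal transport\<close>

definition ones :: "nat \<Rightarrow> real vec" where
  "ones N = vec N (\<lambda>_. 1)"

definition prob_simplex :: "nat \<Rightarrow> real vec set" where
  "prob_simplex N = {s \<in> carrier_vec N. (\<forall>i<N. 0 \<le> s $ i) \<and> s \<bullet> ones N = 1}"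

definition transport_polytope :: "nat \<Rightarrow> real vec \<Rightarrow> real vec \<Rightarrow> real mat set" where
  "transport_polytope N r c =
     {X \<in> carrier_mat N N. (\<forall>i<N. \<forall>j<N. 0 \<le> X $$ (i, j)) \<and>
        X *\<^sub>v ones N = r \<and> transpose_mat X *\<^sub>v ones N = c}"

definition mat_inner :: "real mat \<Rightarrow> real mat \<Rightarrow> real" where
  "mat_inner A B = (\<Sum>i<dim_row A. \<Sum>j<dim_col A. A $$ (i, j) * B $$ (i, j))"

definition max_norm :: "real mat \<Rightarrow> real" where
  "max_norm C = Max {\<bar>C $$ (i, j)\<bar> | i j. i < dim_row C \<and> j < dim_col C}"

definition vnorm :: "real vec \<Rightarrow> real" where
  "vnorm v = sqrt (v \<bullet> v)"

definition vnorm1 :: "real vec \<Rightarrow> real" where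
  "vnorm1 v = (\<Sum>i<dim_vec v. \<bar>v $ i\<bar>)"


section \<open>The regularized problem and its dual\<close>

definition reg_gamma :: "nat \<Rightarrow> real \<Rightarrow> real" where
  "reg_gamma N \<epsilon> = \<epsilon> / (3 * ln (real N))"

definition eps_prime :: "real mat \<Rightarrow> real \<Rightarrow> real" where
  "eps_prime C \<epsilon> = \<epsilon> / (8 * max_norm C)"

text \<open>
  The shift added to each coordinate is \<open>\<epsilon>' / (N * (8 - \<epsilon>'))\<close>, so that the perturbed marginals
  lie in the simplex again. With a shift of \<open>\<epsilon>' / (8 * N)\<close>, as it is sometimes printed, the
  coordinates would sum to \<open>1 - \<epsilon>'\<^sup>2 / 64\<close>; then no matrix of total mass \<open>1\<close> has these marginals,
  the dual objective is unbounded below in each block, and the exact block minimization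
  of the algorithm has no solution.
\<close>

definition smooth_marginal :: "nat \<Rightarrow> real \<Rightarrow> real vec \<Rightarrow> real vec" where
  "smooth_marginal N \<epsilon>' v =
     (1 - \<epsilon>' / 8) \<cdot>\<^sub>v (v + (\<epsilon>' / (real N * (8 - \<epsilon>'))) \<cdot>\<^sub>v ones N)"

definition reg_obj :: "real \<Rightarrow> real mat \<Rightarrow> real mat \<Rightarrow> real" where
  "reg_obj \<gamma> C X = mat_inner C X + \<gamma> * mat_inner X (map_mat ln X)"

type_synonym point = "real vec \<times> real vec"

definition kernel :: "real \<Rightarrow> real mat \<Rightarrow> point \<Rightarrow> nat \<Rightarrow> nat \<Rightarrow> real" where
  "kernel \<gamma> C p i j = exp (- (fst p $ i + snd p $ j + C $$ (i, j)) / \<gamma>)"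

definition dual_obj :: "real \<Rightarrow> real mat \<Rightarrow> real vec \<Rightarrow> real vec \<Rightarrow> point \<Rightarrow> real" where
  "dual_obj \<gamma> C r' c' p =
     \<gamma> * ln (\<Sum>i<dim_row C. \<Sum>j<dim_col C. kernel \<gamma> C p i j) + fst p \<bullet> r' + snd p \<bullet> c'"

definition gibbs :: "real \<Rightarrow> real mat \<Rightarrow> point \<Rightarrow> real mat" where
  "gibbs \<gamma> C p = mat (dim_row C) (dim_col C)
     (\<lambda>(i, j). kernel \<gamma> C p i j / (\<Sum>k<dim_row C. \<Sum>l<dim_col C. kernel \<gamma> C p k l))"

definition grad_y :: "(point \<Rightarrow> real) \<Rightarrow> point \<Rightarrow> real vec" where
  "grad_y F p = (let n = dim_vec (fst p) in
     vec n (\<lambda>i. deriv (\<lambda>t. F (fst p + t \<cdot>\<^sub>v unit_vec n i, snd p)) 0))"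

definition grad_z :: "(point \<Rightarrow> real) \<Rightarrow> point \<Rightarrow> real vec" where
  "grad_z F p = (let n = dim_vec (snd p) in
     vec n (\<lambda>i. deriv (\<lambda>t. F (fst p, snd p + t \<cdot>\<^sub>v unit_vec n i)) 0))"


section \<open>The rounding procedure of Altschuler, Weed and Rigollet\<close>

text \<open>
  \<open>x / 0 = 0\<close> is harmless here: a row or column with sum \<open>0\<close> is itself zero, and if the residual
  \<open>er\<close> vanishes then no correction is needed.
\<close>

definition awr_round :: "nat \<Rightarrow> real vec \<Rightarrow> real vec \<Rightarrow> real mat \<Rightarrow> real mat" where
  "awr_round N r c F =
    (let F1 = mat_diag N (\<lambda>i. min (r $ i / (F *\<^sub>v ones N) $ i) 1) * F;
         F2 = F1 * mat_diag N (\<lambda>j. min (c $ j / (transpose_mat F1 *\<^sub>v ones N) $ j) 1);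
         er = r - F2 *\<^sub>v ones N;
         ec = c - transpose_mat F2 *\<^sub>v ones N
     in F2 + mat N N (\<lambda>(i, j). er $ i * ec $ j / vnorm1 er))"


section \<open>Accelerated Sinkhorn algorithm\<close>

record acc_state =
  eta :: point
  zeta :: point
  weight :: real
  Xhat :: "real mat"
  rounded :: "real mat"

definition acc_init :: "nat \<Rightarrow> acc_state" where
  "acc_init N = \<lparr> eta = (0\<^sub>v N, 0\<^sub>v N), zeta = (0\<^sub>v N, 0\<^sub>v N), weight = 0,
                 Xhat = 0\<^sub>m N N, rounded = 0\<^sub>m N N \<rparr>"

definition ot_phi :: "nat \<Rightarrow> real vec \<Rightarrow> real vec \<Rightarrow> real mat \<Rightarrow> real \<Rightarrow> point \<Rightarrow> real" where
  "ot_phi N r c C \<epsilon> = dual_obj (reg_gamma N \<epsilon>) C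
     (smooth_marginal N (eps_prime C \<epsilon>) r) (smooth_marginal N (eps_prime C \<epsilon>) c)"

definition segment :: "point \<Rightarrow> point \<Rightarrow> real \<Rightarrow> point" where
  "segment p q \<beta> = (\<beta> \<cdot>\<^sub>v fst q + (1 - \<beta>) \<cdot>\<^sub>v fst p, \<beta> \<cdot>\<^sub>v snd q + (1 - \<beta>) \<cdot>\<^sub>v snd p)"

definition is_line_min :: "(point \<Rightarrow> real) \<Rightarrow> point \<Rightarrow> point \<Rightarrow> real \<Rightarrow> bool" where
  "is_line_min F p q \<beta> \<longleftrightarrow> is_arg_min (\<lambda>b. F (segment p q b)) (\<lambda>b. 0 \<le> b \<and> b \<le> 1) \<beta>"

text \<open>
  One iteration is a relation, since the line search, ties between the blocks and the exact block
  minimization (unique only up to adding a constant to a block) leave choices open.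
  The increment \<open>a\<close> is the positive root of its equation. If the gradient at
  \<open>lam\<close> vanishes, the equation puts no constraint on \<open>a\<close>; the plan \<open>gibbs\<close> at \<open>lam\<close> is then
  the exact solution of the regularized problem, and it receives the whole weight
  (the limit of infinite \<open>a\<close>).
\<close>

definition acc_step ::
  "nat \<Rightarrow> real vec \<Rightarrow> real vec \<Rightarrow> real mat \<Rightarrow> real \<Rightarrow> acc_state \<Rightarrow> acc_state \<Rightarrow> bool" where
  "acc_step N r c C \<epsilon> s s' \<longleftrightarrow>
    (let \<phi> = ot_phi N r c C \<epsilon>; \<gamma> = reg_gamma N \<epsilon> in
     \<exists>\<beta> lam gy gz a.
       is_line_min \<phi> (eta s) (zeta s) \<beta> \<and>
       lam = segment (eta s) (zeta s) \<beta> \<and>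
       gy = grad_y \<phi> lam \<and> gz = grad_z \<phi> lam \<and>
       (vnorm gz \<le> vnorm gy \<and>
          is_arg_min \<phi> (\<lambda>p. fst p \<in> carrier_vec N \<and> snd p = snd lam) (eta s') \<or>
        vnorm gy \<le> vnorm gz \<and>
          is_arg_min \<phi> (\<lambda>p. fst p = fst lam \<and> snd p \<in> carrier_vec N) (eta s')) \<and>
       0 < a \<and> weight s' = weight s + a \<and>
       \<phi> lam - a\<^sup>2 / (2 * weight s') * ((vnorm gy)\<^sup>2 + (vnorm gz)\<^sup>2) = \<phi> (eta s') \<and>
       zeta s' = (fst (zeta s) - a \<cdot>\<^sub>v gy, snd (zeta s) - a \<cdot>\<^sub>v gz) \<and>
       Xhat s' =
         (if gy = 0\<^sub>v N \<and> gz = 0\<^sub>v N then gibbs \<gamma> C lam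
          else (1 / weight s') \<cdot>\<^sub>m (a \<cdot>\<^sub>m gibbs \<gamma> C lam + weight s \<cdot>\<^sub>m Xhat s)) \<and>
       rounded s' = awr_round N r c (Xhat s'))"

definition acc_stops ::
  "nat \<Rightarrow> real vec \<Rightarrow> real vec \<Rightarrow> real mat \<Rightarrow> real \<Rightarrow> acc_state \<Rightarrow> bool" where
  "acc_stops N r c C \<epsilon> s \<longleftrightarrow>
     mat_inner C (rounded s - Xhat s) \<le> \<epsilon> / 6 \<and>
     reg_obj (reg_gamma N \<epsilon>) C (Xhat s) + ot_phi N r c C \<epsilon> (eta s) \<le> \<epsilon> / 6"

text \<open>\<open>acc_run N r c C \<epsilon> k s\<close>: some execution performs \<open>k\<close> iterations and is then in state \<open>s\<close>.\<close>

inductive acc_run ::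
  "nat \<Rightarrow> real vec \<Rightarrow> real vec \<Rightarrow> real mat \<Rightarrow> real \<Rightarrow> nat \<Rightarrow> acc_state \<Rightarrow> bool"
  for N r c C \<epsilon> where
  start: "acc_run N r c C \<epsilon> 0 (acc_init N)"
| iterate: "acc_run N r c C \<epsilon> k s \<Longrightarrow> k = 0 \<or> \<not> acc_stops N r c C \<epsilon> s \<Longrightarrow>
    acc_step N r c C \<epsilon> s s' \<Longrightarrow> acc_run N r c C \<epsilon> (Suc k) s'"

definition acc_returns ::
  "nat \<Rightarrow> real vec \<Rightarrow> real vec \<Rightarrow> real mat \<Rightarrow> real \<Rightarrow> nat \<Rightarrow> real mat \<Rightarrow> bool" where
  "acc_returns N r c C \<epsilon> k G \<longleftrightarrow>
     (\<exists>s. acc_run N r c C \<epsilon> k s \<and> 0 < k \<and> acc_stops N r c C \<epsilon> s \<and> G = rounded s)"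


section \<open>Counting arithmetic operations\<close>

text \<open>
  Programs are built from arithmetic expressions over stored real numbers. Every operation,
  including \<open>exp\<close>, \<open>ln\<close>, \<open>sqrt\<close> and a comparison, counts as one; reading a stored number is free.
\<close>

datatype aexp =
    Val real
  | AAdd aexp aexp (infixl "\<^bold>+" 65)
  | ASub aexp aexp (infixl "\<^bold>-" 65)
  | AMul aexp aexp (infixl "\<^bold>*" 70)
  | ADiv aexp aexp (infixl "\<^bold>'/" 70)
  | AMin aexp aexp
  | AAbs aexp
  | AExp aexp
  | ALn aexp
  | ASqrt aexp
  | ASum nat "nat \<Rightarrow> aexp"
  | AMax nat "nat \<Rightarrow> aexp"

primrec aval :: "aexp \<Rightarrow> real" where
  "aval (Val x) = x"
| "aval (a \<^bold>+ b) = aval a + aval b"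
| "aval (a \<^bold>- b) = aval a - aval b"
| "aval (a \<^bold>* b) = aval a * aval b"
| "aval (a \<^bold>/ b) = aval a / aval b"
| "aval (AMin a b) = min (aval a) (aval b)"
| "aval (AAbs a) = \<bar>aval a\<bar>"
| "aval (AExp a) = exp (aval a)"
| "aval (ALn a) = ln (aval a)"
| "aval (ASqrt a) = sqrt (aval a)"
| "aval (ASum n f) = (\<Sum>i<n. aval (f i))"
| "aval (AMax n f) = Max ((\<lambda>i. aval (f i)) ` {..<n})"

primrec aops :: "aexp \<Rightarrow> nat" where
  "aops (Val x) = 0"
| "aops (a \<^bold>+ b) = aops a + aops b + 1"
| "aops (a \<^bold>- b) = aops a + aops b + 1"
| "aops (a \<^bold>* b) = aops a + aops b + 1"
| "aops (a \<^bold>/ b) = aops a + aops b + 1"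
| "aops (AMin a b) = aops a + aops b + 1"
| "aops (AAbs a) = aops a + 1"
| "aops (AExp a) = aops a + 1"
| "aops (ALn a) = aops a + 1"
| "aops (ASqrt a) = aops a + 1"
| "aops (ASum n f) = (\<Sum>i<n. aops (f i)) + n"
| "aops (AMax n f) = (\<Sum>i<n. aops (f i)) + n"

text \<open>A result together with the number of operations spent on it.\<close>

type_synonym 'a counted = "'a \<times> nat"

definition counted_bind :: "'a counted \<Rightarrow> ('a \<Rightarrow> 'b counted) \<Rightarrow> 'b counted" where
  "counted_bind m f = (fst (f (fst m)), snd m + snd (f (fst m)))"

adhoc_overloading Monad_Syntax.bind \<rightleftharpoons> counted_bind

definition ret :: "'a \<Rightarrow> 'a counted" where
  "ret x = (x, 0)"

definition cscal :: "aexp \<Rightarrow> real counted" where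
  "cscal e = (aval e, aops e)"

definition cvec :: "nat \<Rightarrow> (nat \<Rightarrow> aexp) \<Rightarrow> real vec counted" where
  "cvec n e = (vec n (\<lambda>i. aval (e i)), \<Sum>i<n. aops (e i))"

definition cmat :: "nat \<Rightarrow> (nat \<Rightarrow> nat \<Rightarrow> aexp) \<Rightarrow> real mat counted" where
  "cmat n e = (mat n n (\<lambda>(i, j). aval (e i j)), \<Sum>i<n. \<Sum>j<n. aops (e i j))"

definition cle :: "aexp \<Rightarrow> aexp \<Rightarrow> bool counted" where
  "cle a b = (aval a \<le> aval b, aops a + aops b + 1)"


section \<open>The algorithm as a program\<close>

text \<open>Regularization parameter and perturbed marginals, computed once.\<close>

type_synonym params = "real \<times> real vec \<times> real vec"

definition setup_prog :: "nat \<Rightarrow> real vec \<Rightarrow> real vec \<Rightarrow> real mat \<Rightarrow> real \<Rightarrow> params counted" where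
  "setup_prog N r c C \<epsilon> = do {
     \<gamma> \<leftarrow> cscal (Val \<epsilon> \<^bold>/ (Val 3 \<^bold>* ALn (Val (real N))));
     e \<leftarrow> cscal (Val \<epsilon> \<^bold>/ (Val 8 \<^bold>* AMax N (\<lambda>i. AMax N (\<lambda>j. AAbs (Val (C $$ (i, j)))))));
     w \<leftarrow> cscal (Val 1 \<^bold>- Val e \<^bold>/ Val 8);
     u \<leftarrow> cscal (Val e \<^bold>/ (Val (real N) \<^bold>* (Val 8 \<^bold>- Val e)));
     rt \<leftarrow> cvec N (\<lambda>i. Val w \<^bold>* (Val (r $ i) \<^bold>+ Val u));
     ct \<leftarrow> cvec N (\<lambda>i. Val w \<^bold>* (Val (c $ i) \<^bold>+ Val u));
     ret (\<gamma>, rt, ct)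
   }"

definition kernel_prog :: "nat \<Rightarrow> real mat \<Rightarrow> real \<Rightarrow> point \<Rightarrow> real mat counted" where
  "kernel_prog N C \<gamma> p = cmat N (\<lambda>i j.
     AExp ((Val 0 \<^bold>- (Val (fst p $ i) \<^bold>+ Val (snd p $ j) \<^bold>+ Val (C $$ (i, j)))) \<^bold>/ Val \<gamma>))"

definition gibbs_prog :: "nat \<Rightarrow> real mat \<Rightarrow> real \<Rightarrow> point \<Rightarrow> real mat counted" where
  "gibbs_prog N C \<gamma> p = do {
     M \<leftarrow> kernel_prog N C \<gamma> p;
     S \<leftarrow> cscal (ASum N (\<lambda>i. ASum N (\<lambda>j. Val (M $$ (i, j)))));
     cmat N (\<lambda>i j. Val (M $$ (i, j)) \<^bold>/ Val S)
   }"

definition dual_prog :: "nat \<Rightarrow> real mat \<Rightarrow> params \<Rightarrow> point \<Rightarrow> real counted" where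
  "dual_prog N C = (\<lambda>(\<gamma>, rt, ct) p. do {
     M \<leftarrow> kernel_prog N C \<gamma> p;
     cscal (Val \<gamma> \<^bold>* ALn (ASum N (\<lambda>i. ASum N (\<lambda>j. Val (M $$ (i, j)))))
            \<^bold>+ ASum N (\<lambda>i. Val (fst p $ i) \<^bold>* Val (rt $ i))
            \<^bold>+ ASum N (\<lambda>i. Val (snd p $ i) \<^bold>* Val (ct $ i)))
   })"

definition segment_prog :: "nat \<Rightarrow> point \<Rightarrow> point \<Rightarrow> real \<Rightarrow> point counted" where
  "segment_prog N p q \<beta> = do {
     y \<leftarrow> cvec N (\<lambda>i. Val \<beta> \<^bold>* Val (fst q $ i) \<^bold>+ (Val 1 \<^bold>- Val \<beta>) \<^bold>* Val (fst p $ i));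
     z \<leftarrow> cvec N (\<lambda>i. Val \<beta> \<^bold>* Val (snd q $ i) \<^bold>+ (Val 1 \<^bold>- Val \<beta>) \<^bold>* Val (snd p $ i));
     ret (y, z)
   }"

text \<open>
  An exact minimizer over \<open>[0, 1]\<close> cannot be computed by finitely many arithmetic operations. It is
  supplied by \<open>ls\<close>, and the search is charged the price of \<open>q\<close> evaluations of the dual objective
  on the segment.
\<close>

definition line_search_prog ::
  "nat \<Rightarrow> (point \<Rightarrow> point \<Rightarrow> real) \<Rightarrow> nat \<Rightarrow> real mat \<Rightarrow> params \<Rightarrow> point \<Rightarrow> point \<Rightarrow> real counted" where
  "line_search_prog q ls N C prm p p' =
     (ls p p', q * snd (do { x \<leftarrow> segment_prog N p p' (ls p p'); dual_prog N C prm x }))"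

definition block_y_prog :: "nat \<Rightarrow> real mat \<Rightarrow> params \<Rightarrow> point \<Rightarrow> point counted" where
  "block_y_prog N C = (\<lambda>(\<gamma>, rt, ct) p. do {
     y \<leftarrow> cvec N (\<lambda>i. Val \<gamma> \<^bold>*
       (ALn (ASum N (\<lambda>j. AExp ((Val 0 \<^bold>- (Val (snd p $ j) \<^bold>+ Val (C $$ (i, j)))) \<^bold>/ Val \<gamma>)))
        \<^bold>- ALn (Val (rt $ i))));
     ret (y, snd p)
   })"

definition block_z_prog :: "nat \<Rightarrow> real mat \<Rightarrow> params \<Rightarrow> point \<Rightarrow> point counted" where
  "block_z_prog N C = (\<lambda>(\<gamma>, rt, ct) p. do {
     z \<leftarrow> cvec N (\<lambda>j. Val \<gamma> \<^bold>*
       (ALn (ASum N (\<lambda>i. AExp ((Val 0 \<^bold>- (Val (fst p $ i) \<^bold>+ Val (C $$ (i, j)))) \<^bold>/ Val \<gamma>)))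
        \<^bold>- ALn (Val (ct $ j))));
     ret (fst p, z)
   })"

definition round_prog :: "nat \<Rightarrow> real vec \<Rightarrow> real vec \<Rightarrow> real mat \<Rightarrow> real mat counted" where
  "round_prog N r c F = do {
     x \<leftarrow> cvec N (\<lambda>i. AMin (Val (r $ i) \<^bold>/ ASum N (\<lambda>j. Val (F $$ (i, j)))) (Val 1));
     F1 \<leftarrow> cmat N (\<lambda>i j. Val (x $ i) \<^bold>* Val (F $$ (i, j)));
     y \<leftarrow> cvec N (\<lambda>j. AMin (Val (c $ j) \<^bold>/ ASum N (\<lambda>i. Val (F1 $$ (i, j)))) (Val 1));
     F2 \<leftarrow> cmat N (\<lambda>i j. Val (F1 $$ (i, j)) \<^bold>* Val (y $ j));
     er \<leftarrow> cvec N (\<lambda>i. Val (r $ i) \<^bold>- ASum N (\<lambda>j. Val (F2 $$ (i, j))));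
     ec \<leftarrow> cvec N (\<lambda>j. Val (c $ j) \<^bold>- ASum N (\<lambda>i. Val (F2 $$ (i, j))));
     S \<leftarrow> cscal (ASum N (\<lambda>i. AAbs (Val (er $ i))));
     cmat N (\<lambda>i j. Val (F2 $$ (i, j)) \<^bold>+ Val (er $ i) \<^bold>* Val (ec $ j) \<^bold>/ Val S)
   }"

definition stop_prog ::
  "nat \<Rightarrow> real mat \<Rightarrow> real \<Rightarrow> params \<Rightarrow> real mat \<Rightarrow> real mat \<Rightarrow> real \<Rightarrow> bool counted" where
  "stop_prog N C \<epsilon> = (\<lambda>(\<gamma>, rt, ct) X G h. do {
     b1 \<leftarrow> cle (ASum N (\<lambda>i. ASum N (\<lambda>j.
                Val (C $$ (i, j)) \<^bold>* (Val (G $$ (i, j)) \<^bold>- Val (X $$ (i, j))))))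
              (Val \<epsilon> \<^bold>/ Val 6);
     b2 \<leftarrow> cle (ASum N (\<lambda>i. ASum N (\<lambda>j. Val (C $$ (i, j)) \<^bold>* Val (X $$ (i, j))))
               \<^bold>+ Val \<gamma> \<^bold>* ASum N (\<lambda>i. ASum N (\<lambda>j.
                    Val (X $$ (i, j)) \<^bold>* ALn (Val (X $$ (i, j)))))
               \<^bold>+ Val h)
              (Val \<epsilon> \<^bold>/ Val 6);
     ret (b1 \<and> b2)
   })"

text \<open>One iteration, including the rounding and the evaluation of the stopping test.\<close>

definition iter_prog ::
  "nat \<Rightarrow> (point \<Rightarrow> point \<Rightarrow> real) \<Rightarrow> nat \<Rightarrow> real vec \<Rightarrow> real vec \<Rightarrow> real mat \<Rightarrow> real \<Rightarrow> params \<Rightarrow>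
   acc_state \<Rightarrow> (acc_state \<times> bool) counted" where
  "iter_prog q ls N r c C \<epsilon> = (\<lambda>(\<gamma>, rt, ct) s. do {
     \<beta> \<leftarrow> line_search_prog q ls N C (\<gamma>, rt, ct) (eta s) (zeta s);
     lam \<leftarrow> segment_prog N (eta s) (zeta s) \<beta>;
     X \<leftarrow> gibbs_prog N C \<gamma> lam;
     gy \<leftarrow> cvec N (\<lambda>i. Val (rt $ i) \<^bold>- ASum N (\<lambda>j. Val (X $$ (i, j))));
     gz \<leftarrow> cvec N (\<lambda>j. Val (ct $ j) \<^bold>- ASum N (\<lambda>i. Val (X $$ (i, j))));
     ny \<leftarrow> cscal (ASum N (\<lambda>i. Val (gy $ i) \<^bold>* Val (gy $ i)));
     nz \<leftarrow> cscal (ASum N (\<lambda>i. Val (gz $ i) \<^bold>* Val (gz $ i)));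
     upd_y \<leftarrow> cle (Val nz) (Val ny);
     p' \<leftarrow> (if upd_y then block_y_prog N C (\<gamma>, rt, ct) lam else block_z_prog N C (\<gamma>, rt, ct) lam);
     g \<leftarrow> cscal (Val ny \<^bold>+ Val nz);
     h \<leftarrow> dual_prog N C (\<gamma>, rt, ct) lam;
     h' \<leftarrow> dual_prog N C (\<gamma>, rt, ct) p';
     d \<leftarrow> cscal (Val h \<^bold>- Val h');
     flat \<leftarrow> cle (Val g) (Val 0);
     a \<leftarrow> (if flat then ret 1
          else cscal ((Val d \<^bold>+ ASqrt (Val d \<^bold>* Val d
                        \<^bold>+ Val 2 \<^bold>* Val d \<^bold>* Val (weight s) \<^bold>* Val g)) \<^bold>/ Val g));
     w \<leftarrow> cscal (Val (weight s) \<^bold>+ Val a);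
     zy \<leftarrow> cvec N (\<lambda>i. Val (fst (zeta s) $ i) \<^bold>- Val a \<^bold>* Val (gy $ i));
     zz \<leftarrow> cvec N (\<lambda>i. Val (snd (zeta s) $ i) \<^bold>- Val a \<^bold>* Val (gz $ i));
     X' \<leftarrow> (if flat then ret X
           else cmat N (\<lambda>i j. (Val a \<^bold>* Val (X $$ (i, j))
                                \<^bold>+ Val (weight s) \<^bold>* Val (Xhat s $$ (i, j))) \<^bold>/ Val w));
     G \<leftarrow> round_prog N r c X';
     stop \<leftarrow> stop_prog N C \<epsilon> (\<gamma>, rt, ct) X' G h';
     ret (\<lparr> eta = p', zeta = (zy, zz), weight = w, Xhat = X', rounded = G \<rparr>, stop)
   })"

text \<open>
  Parameters, state and stopping flag after setup and \<open>k\<close> iterations, with the total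
  number of operations spent so far.
\<close>

primrec exec_prog ::
  "nat \<Rightarrow> (point \<Rightarrow> point \<Rightarrow> real) \<Rightarrow> nat \<Rightarrow> real vec \<Rightarrow> real vec \<Rightarrow> real mat \<Rightarrow> real \<Rightarrow> nat \<Rightarrow>
   (params \<times> acc_state \<times> bool) counted" where
  "exec_prog q ls N r c C \<epsilon> 0 = do {
     prm \<leftarrow> setup_prog N r c C \<epsilon>;
     ret (prm, acc_init N, False)
   }"
| "exec_prog q ls N r c C \<epsilon> (Suc k) = do {
     (prm, s, b) \<leftarrow> exec_prog q ls N r c C \<epsilon> k;
     (s', b') \<leftarrow> iter_prog q ls N r c C \<epsilon> prm s;
     ret (prm, s', b')
   }"

definition exec_state ::
  "nat \<Rightarrow> (point \<Rightarrow> point \<Rightarrow> real) \<Rightarrow> nat \<Rightarrow> real vec \<Rightarrow> real vec \<Rightarrow> real mat \<Rightarrow> real \<Rightarrow> nat \<Rightarrow> acc_state" where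
  "exec_state q ls N r c C \<epsilon> k = fst (snd (fst (exec_prog q ls N r c C \<epsilon> k)))"

definition exec_stop ::
  "nat \<Rightarrow> (point \<Rightarrow> point \<Rightarrow> real) \<Rightarrow> nat \<Rightarrow> real vec \<Rightarrow> real vec \<Rightarrow> real mat \<Rightarrow> real \<Rightarrow> nat \<Rightarrow> bool" where
  "exec_stop q ls N r c C \<epsilon> k = snd (snd (fst (exec_prog q ls N r c C \<epsilon> k)))"

definition exec_ops ::
  "nat \<Rightarrow> (point \<Rightarrow> point \<Rightarrow> real) \<Rightarrow> nat \<Rightarrow> real vec \<Rightarrow> real vec \<Rightarrow> real mat \<Rightarrow> real \<Rightarrow> nat \<Rightarrow> nat" where
  "exec_ops q ls N r c C \<epsilon> k = snd (exec_prog q ls N r c C \<epsilon> k)"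

end

theory Submission
  imports Defs
begin

text \<open>
  Write \<open>\<phi>\<close> for the dual objective, \<open>f\<close> for the regularized primal objective, and
  \<open>res X = (r~ - X 1, c~ - X\<^sup>T 1)\<close> for the residual of a plan \<open>X\<close> against the perturbed marginals.
  The gradient of \<open>\<phi>\<close> at \<open>\<lambda>\<close> is the residual of the Gibbs plan \<open>X(\<lambda>)\<close>, and
  \<open>f(X) + \<phi>(\<lambda>) - \<langle>\<lambda>, res X\<rangle>\<close> is \<open>\<gamma>\<close> times the relative entropy of \<open>X\<close> with respect to \<open>X(\<lambda>)\<close>
  (\<open>duality_gap\<close>). Weak duality, strong duality at \<open>X(\<lambda>)\<close> and convexity of \<open>\<phi>\<close> all come from the
  nonnegativity of that quantity.

  The analysis of the iteration rests on one invariant (\<open>accel_inv\<close>): with accumulated weight \<open>A\<close>,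
  \<open>\<zeta> = - A res X^\<close> and \<open>A (\<phi>(\<eta>) + f(X^)) + |\<zeta>|\<^sup>2 / 2 \<le> 0\<close>. A step preserves it because the line search
  gives \<open>\<phi>(\<lambda>) \<le> \<phi>(\<eta>)\<close> and \<open>\<langle>\<nabla>\<phi>(\<lambda>), \<zeta> - \<lambda>\<rangle> \<ge> 0\<close>, because \<open>f\<close> is convex, and because the equation that
  defines the increment \<open>a\<close> makes the quadratic terms cancel (\<open>accel_inv_step\<close>). So the duality gap
  \<open>\<phi>(\<eta>) + f(X^)\<close> is never positive after the first iteration, and only the infeasibility of \<open>X^\<close>
  has to be driven down.

  An exact block minimization lowers \<open>\<phi>\<close> by \<open>\<gamma>\<close> times a relative entropy of marginals, hence by at least
  \<open>\<gamma>/4\<close> times the squared gradient of the chosen block (\<open>min_y_decrease\<close>). The chosen block has the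
  larger gradient, so \<open>a\<^sup>2 \<ge> \<gamma> A / 4\<close> for the new weight \<open>A\<close>, and \<open>A \<ge> \<gamma> k\<^sup>2 / 16\<close> follows
  (\<open>weight_growth\<close>). On the other side, at a dual value of at most \<open>\<phi>(\<eta>)\<close> there is a point whose coordinates
  are all at most \<open>D = O(|C|)\<close> in absolute value: two block minimizations and a shift of both blocks
  produce it (\<open>bounded_point_below\<close>). Weak duality at this point bounds the gap from below, and with the
  invariant the \<open>l\<^sub>1\<close> infeasibility of \<open>X^\<close> is at most \<open>4 N D / A\<close>
  (\<open>accel_inv_infeasibility\<close>). Rounding a plan of total mass one changes its cost by at most \<open>|C|\<close> times its
  \<open>l\<^sub>1\<close> distance to the marginals \<open>r\<close>, \<open>c\<close> (\<open>awr_round_correct\<close>), so the stopping test succeeds once \<open>A\<close> reaches the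
  order of \<open>N |C|\<^sup>2 / \<epsilon>\<close>, that is, once \<open>k\<close> reaches the order of \<open>sqrt (N ln N) |C| / \<epsilon>\<close>.

  At termination the cost of \<open>X^\<close> exceeds \<open>f(X^)\<close> by at most \<open>2 \<gamma> ln N = 2\<epsilon>/3\<close>, and
  \<open>f(X^) \<le> - \<phi>(\<eta>) \<le> f(Y)\<close> for the mixture \<open>Y\<close> of the optimal plan with the uniform one that has the
  perturbed marginals. The mixture costs at most \<open>\<epsilon>/64\<close> more than the optimal plan and rounding at most
  \<open>\<epsilon>/6\<close>, which adds up to less than \<open>\<epsilon>\<close> (\<open>acc_returns_accurate\<close>).

  The program realizes the iteration relation with the closed forms of the block minimizers and
  of the increment (\<open>iter_prog_correct\<close>), so it inherits the iteration bound. This also shows that a step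
  always exists.
\<close>

section \<open>Relative entropy, termwise\<close>

text \<open>
  Apply \<open>ln u \<le> u - 1\<close> to \<open>u = sqrt (y / x)\<close>. Summed over a probability vector, the left-hand side
  is the squared Hellinger distance, and the right-hand side is the relative entropy. The value
  \<open>x = 0\<close> is covered because the product with \<open>ln 0 = 0\<close> vanishes.
\<close>

lemma kl_term_ge_hellinger:
  fixes x y :: real
  assumes "0 \<le> x" "0 < y"
  shows "(sqrt x - sqrt y)\<^sup>2 \<le> x * (ln x - ln y) - x + y"
proof (cases "x = 0")
  case True
  then show ?thesis using assms by simp
next
  case False
  with assms have x: "0 < x" by simp
  define u where "u = sqrt y / sqrt x"
  have u: "0 < u" using x assms by (simp add: u_def)
  have "ln u = (ln y - ln x) / 2"
    using x assms by (simp add: u_def ln_div ln_sqrt diff_divide_distrib)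
  moreover have "ln u \<le> u - 1" using u by (rule ln_le_minus_one)
  ultimately have "ln x - ln y \<ge> 2 * (1 - u)" by (simp add: field_simps)
  then have "x * (ln x - ln y) \<ge> x * (2 * (1 - u))"
    using x by (intro mult_left_mono) auto
  moreover have "x * u = sqrt x * sqrt y"
    using x by (simp add: u_def field_simps)
  moreover have "(sqrt x - sqrt y)\<^sup>2 = x + y - 2 * (sqrt x * sqrt y)"
    using x assms by (simp add: power2_eq_square algebra_simps)
  ultimately show ?thesis by (simp add: algebra_simps)
qed

lemma kl_term_nonneg:
  fixes x y :: real
  assumes "0 \<le> x" "0 < y"
  shows "0 \<le> x * (ln x - ln y) - x + y"
  using kl_term_ge_hellinger[OF assms] zero_le_power2[of "sqrt x - sqrt y"] by linarith

text \<open>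
  A substitute for the Pinsker inequality that works coordinate by coordinate and therefore bounds
  the Euclidean distance directly.
\<close>

lemma kl_term_quadratic:
  fixes x y :: real
  assumes "0 \<le> x" "x \<le> 1" "0 < y" "y \<le> 1"
  shows "(x - y)\<^sup>2 / 4 \<le> x * (ln x - ln y) - x + y"
proof -
  have "x - y = (sqrt x - sqrt y) * (sqrt x + sqrt y)"
    using assms by (simp add: algebra_simps)
  then have "(x - y)\<^sup>2 = (sqrt x - sqrt y)\<^sup>2 * (sqrt x + sqrt y)\<^sup>2"
    by (simp add: power_mult_distrib)
  also have "\<dots> \<le> (sqrt x - sqrt y)\<^sup>2 * 2\<^sup>2"
    using real_sqrt_le_1_iff[of x] real_sqrt_le_1_iff[of y] assms add_mono[of "sqrt x" 1 "sqrt y" 1]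
    by (intro mult_left_mono power_mono) auto
  finally show ?thesis using kl_term_ge_hellinger[of x y] assms by simp
qed

section \<open>Rounding to the transport polytope\<close>

definition row_mass :: "nat \<Rightarrow> real mat \<Rightarrow> nat \<Rightarrow> real" where
  "row_mass N X i = (\<Sum>j<N. X $$ (i, j))"

definition col_mass :: "nat \<Rightarrow> real mat \<Rightarrow> nat \<Rightarrow> real" where
  "col_mass N X j = (\<Sum>i<N. X $$ (i, j))"

definition plans :: "nat \<Rightarrow> real mat set" where
  "plans N = {X \<in> carrier_mat N N. (\<forall>i<N. \<forall>j<N. 0 \<le> X $$ (i, j)) \<and>
     (\<Sum>i<N. \<Sum>j<N. X $$ (i, j)) = 1}"

lemma prob_simplex_iff:
  "s \<in> prob_simplex N \<longleftrightarrow> s \<in> carrier_vec N \<and> (\<forall>i<N. 0 \<le> s $ i) \<and> (\<Sum>i<N. s $ i) = 1"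
  by (auto simp: prob_simplex_def ones_def scalar_prod_def atLeast0LessThan)

lemma mult_ones:
  assumes "X \<in> carrier_mat N N"
  shows "X *\<^sub>v ones N = vec N (row_mass N X)" "transpose_mat X *\<^sub>v ones N = vec N (col_mass N X)"
  using assms
  by (auto simp: ones_def row_mass_def col_mass_def scalar_prod_def atLeast0LessThan intro!: eq_vecI sum.cong)

lemma mass_transpose:
  assumes "X \<in> carrier_mat N N" "i < N"
  shows "row_mass N (transpose_mat X) i = col_mass N X i" "col_mass N (transpose_mat X) i = row_mass N X i"
  using assms by (auto simp: row_mass_def col_mass_def intro!: sum.cong)

lemma transport_polytope_iff:
  assumes "r \<in> carrier_vec N" "c \<in> carrier_vec N"
  shows "X \<in> transport_polytope N r c \<longleftrightarrow> X \<in> carrier_mat N N \<and> (\<forall>i<N. \<forall>j<N. 0 \<le> X $$ (i, j)) \<and>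
     (\<forall>i<N. row_mass N X i = r $ i) \<and> (\<forall>j<N. col_mass N X j = c $ j)"
proof -
  have "vec N f = v \<longleftrightarrow> (\<forall>i<N. f i = v $ i)" if "v \<in> carrier_vec N" for f and v :: "real vec"
    using that by (auto intro!: eq_vecI)
  then show ?thesis using assms by (auto simp: transport_polytope_def mult_ones mass_transpose)
qed

lemma sum_row_mass: "(\<Sum>i<N. row_mass N X i) = (\<Sum>i<N. \<Sum>j<N. X $$ (i, j))"
  by (simp add: row_mass_def)

lemma sum_col_mass: "(\<Sum>j<N. col_mass N X j) = (\<Sum>i<N. \<Sum>j<N. X $$ (i, j))"
  unfolding col_mass_def by (rule sum.swap)

lemma sum_excess_le:
  fixes f g :: "nat \<Rightarrow> real"
  assumes "(\<Sum>i<N. f i) = (\<Sum>i<N. g i)"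
  shows "(\<Sum>i<N. f i - min (g i) (f i)) = (\<Sum>i<N. \<bar>f i - g i\<bar>) / 2"
proof -
  have "(\<Sum>i<N. f i - min (g i) (f i)) = (\<Sum>i<N. (\<bar>f i - g i\<bar> + (f i - g i)) / 2)"
    by (intro sum.cong) (auto simp: min_def field_simps)
  also have "\<dots> = ((\<Sum>i<N. \<bar>f i - g i\<bar>) + ((\<Sum>i<N. f i) - (\<Sum>i<N. g i))) / 2"
    by (simp only: sum_divide_distrib[symmetric] sum.distrib sum_subtractf)
  finally show ?thesis using assms by simp
qed

text \<open>
  Scaling rows and then columns only removes mass, and the rank-one correction puts back exactly what
  is missing, \<open>1 - m\<close>, so the \<open>l\<^sub>1\<close> distance is at most \<open>2 (1 - m)\<close>. The mass removed is at most the excess of the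
  row sums over \<open>r\<close> plus the excess of the column sums over \<open>c\<close>; as the total masses agree, each
  excess is half of the \<open>l\<^sub>1\<close> deviation.
\<close>

lemma awr_round_correct:
  assumes r: "r \<in> prob_simplex N" and c: "c \<in> prob_simplex N" and F: "F \<in> plans N"
  shows "awr_round N r c F \<in> transport_polytope N r c"
    and "(\<Sum>i<N. \<Sum>j<N. \<bar>awr_round N r c F $$ (i, j) - F $$ (i, j)\<bar>)
      \<le> (\<Sum>i<N. \<bar>row_mass N F i - r $ i\<bar>) + (\<Sum>j<N. \<bar>col_mass N F j - c $ j\<bar>)"
proof -
  have rc: "r \<in> carrier_vec N" "c \<in> carrier_vec N" "\<And>i. i < N \<Longrightarrow> 0 \<le> r $ i" "\<And>i. i < N \<Longrightarrow> 0 \<le> c $ i"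
    and sums: "(\<Sum>i<N. r $ i) = 1" "(\<Sum>i<N. c $ i) = 1"
    using r c by (auto simp: prob_simplex_iff)
  have Fc: "F \<in> carrier_mat N N" and Fpos: "\<And>i j. i < N \<Longrightarrow> j < N \<Longrightarrow> 0 \<le> F $$ (i, j)"
    and Fsum: "(\<Sum>i<N. \<Sum>j<N. F $$ (i, j)) = 1"
    using F by (auto simp: plans_def)
  define F1 where "F1 = mat_diag N (\<lambda>i. min (r $ i / (F *\<^sub>v ones N) $ i) 1) * F"
  define F2 where "F2 = F1 * mat_diag N (\<lambda>j. min (c $ j / (transpose_mat F1 *\<^sub>v ones N) $ j) 1)"
  define er where "er = r - F2 *\<^sub>v ones N"
  define ec where "ec = c - transpose_mat F2 *\<^sub>v ones N"
  define G where "G = F2 + mat N N (\<lambda>(i, j). er $ i * ec $ j / vnorm1 er)"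
  have G: "awr_round N r c F = G"
    by (simp add: awr_round_def Let_def G_def er_def ec_def F2_def F1_def)
  have F1c: "F1 \<in> carrier_mat N N" unfolding F1_def using Fc by (metis mat_diag_dim mult_carrier_mat)
  have F2c: "F2 \<in> carrier_mat N N" unfolding F2_def using F1c by (metis mat_diag_dim mult_carrier_mat)
  have F1e: "F1 $$ (i, j) = min (r $ i / row_mass N F i) 1 * F $$ (i, j)" if "i < N" "j < N" for i j
    using that Fc by (simp add: F1_def mat_diag_mult_left[OF Fc] mult_ones)
  have F2e: "F2 $$ (i, j) = F1 $$ (i, j) * min (c $ j / col_mass N F1 j) 1" if "i < N" "j < N" for i j
    using that F1c by (simp add: F2_def mat_diag_mult_right[OF F1c] mult_ones mass_transpose)
  have scale: "min (a / m) 1 * m = min a m" if "0 \<le> a" "0 \<le> m" for a m :: real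
    using that by (auto simp: min_def field_simps split: if_splits)
  have rho: "0 \<le> row_mass N F i" if "i < N" for i
    using Fpos that by (auto simp: row_mass_def intro!: sum_nonneg)
  have F1pos: "0 \<le> F1 $$ (i, j)" and F1le: "F1 $$ (i, j) \<le> F $$ (i, j)" if "i < N" "j < N" for i j
  proof -
    have "0 \<le> min (r $ i / row_mass N F i) 1" using rho that rc by simp
    then show "0 \<le> F1 $$ (i, j)" "F1 $$ (i, j) \<le> F $$ (i, j)" unfolding F1e[OF that] using Fpos[OF that]
      by (auto intro: mult_nonneg_nonneg mult_left_le_one_le)
  qed
  have kap: "0 \<le> col_mass N F1 j" if "j < N" for j
    using F1pos that by (auto simp: col_mass_def intro!: sum_nonneg)
  have F2pos: "0 \<le> F2 $$ (i, j)" and F2le: "F2 $$ (i, j) \<le> F1 $$ (i, j)" if "i < N" "j < N" for i j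
  proof -
    have "0 \<le> min (c $ j / col_mass N F1 j) 1" using kap that rc by simp
    then show "0 \<le> F2 $$ (i, j)" "F2 $$ (i, j) \<le> F1 $$ (i, j)" unfolding F2e[OF that] using F1pos[OF that]
      by (auto intro: mult_nonneg_nonneg mult_right_le_one_le)
  qed
  have row1: "row_mass N F1 i = min (r $ i) (row_mass N F i)" if "i < N" for i
  proof -
    have "row_mass N F1 i = min (r $ i / row_mass N F i) 1 * row_mass N F i"
      using that by (subst (1 3) row_mass_def) (simp add: F1e sum_distrib_left)
    then show ?thesis using scale[of "r $ i" "row_mass N F i"] rho rc that by simp
  qed
  have col2: "col_mass N F2 j = min (c $ j) (col_mass N F1 j)" if "j < N" for j
  proof -
    have "col_mass N F2 j = min (c $ j / col_mass N F1 j) 1 * col_mass N F1 j"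
      using that by (subst (1 3) col_mass_def) (simp add: F2e sum_distrib_right mult.commute[of _ "sum _ _"])
    then show ?thesis using scale[of "c $ j" "col_mass N F1 j"] kap rc that by simp
  qed
  have row2: "row_mass N F2 i \<le> row_mass N F1 i" if "i < N" for i
    using that by (auto simp: row_mass_def intro!: sum_mono F2le)
  have col1: "col_mass N F1 j \<le> col_mass N F j" if "j < N" for j
    using that by (auto simp: col_mass_def intro!: sum_mono F1le)
  have er: "er $ i = r $ i - row_mass N F2 i" "0 \<le> er $ i" if "i < N" for i
    using that rc F2c row1[OF that] row2[OF that] by (auto simp: er_def mult_ones)
  have ec: "ec $ j = c $ j - col_mass N F2 j" "0 \<le> ec $ j" if "j < N" for j
    using that rc F2c col2[OF that] by (auto simp: ec_def mult_ones mass_transpose)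
  define m where "m = (\<Sum>i<N. \<Sum>j<N. F2 $$ (i, j))"
  have sum_er: "(\<Sum>i<N. er $ i) = 1 - m"
    using sums by (simp add: er sum_subtractf sum_row_mass m_def)
  have sum_ec: "(\<Sum>j<N. ec $ j) = 1 - m"
    using sums by (simp add: ec sum_subtractf sum_col_mass m_def)
  have "dim_vec er = N" using F2c rc by (simp add: er_def)
  then have norm_er: "vnorm1 er = 1 - m"
    using er by (simp add: vnorm1_def flip: sum_er)
  have m1: "m \<le> 1" using sum_nonneg[of "{..<N}" "\<lambda>i. er $ i"] er sum_er by auto
  \<comment> \<open>If no mass is missing, the correction is a division by zero; both residuals then vanish.\<close>
  have zero: "er $ i = 0 \<and> ec $ i = 0" if "m = 1" "i < N" for i
    using that sum_er sum_ec er ec sum_nonneg_eq_0_iff[of "{..<N}" "\<lambda>i. er $ i"]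
      sum_nonneg_eq_0_iff[of "{..<N}" "\<lambda>i. ec $ i"] by auto
  have Gc: "G \<in> carrier_mat N N" using F2c by (simp add: G_def)
  have Ge: "G $$ (i, j) = F2 $$ (i, j) + er $ i * ec $ j / (1 - m)" if "i < N" "j < N" for i j
    using that F2c by (simp add: G_def norm_er)
  have corr: "0 \<le> er $ i * ec $ j / (1 - m)" if "i < N" "j < N" for i j
    using that er(2) ec(2) m1 by (intro divide_nonneg_nonneg mult_nonneg_nonneg) auto
  have rowc: "(\<Sum>j<N. er $ i * ec $ j / (1 - m)) = er $ i" if "i < N" for i
    using zero[OF _ that] by (cases "m = 1") (simp_all add: sum_ec flip: sum_distrib_left sum_divide_distrib)
  have colc: "(\<Sum>i<N. er $ i * ec $ j / (1 - m)) = ec $ j" if "j < N" for j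
    using zero[OF _ that] by (cases "m = 1") (simp_all add: sum_er flip: sum_distrib_right sum_divide_distrib)
  have "row_mass N G i = r $ i" if "i < N" for i
  proof -
    have "row_mass N G i = row_mass N F2 i + (\<Sum>j<N. er $ i * ec $ j / (1 - m))"
      using that by (subst (1 2) row_mass_def) (simp add: Ge sum.distrib)
    then show ?thesis using rowc er that by simp
  qed
  moreover have "col_mass N G j = c $ j" if "j < N" for j
  proof -
    have "col_mass N G j = col_mass N F2 j + (\<Sum>i<N. er $ i * ec $ j / (1 - m))"
      using that by (subst (1 2) col_mass_def) (simp add: Ge sum.distrib)
    then show ?thesis using colc ec that by simp
  qed
  moreover have "0 \<le> G $$ (i, j)" if "i < N" "j < N" for i j
    using corr[OF that] F2pos[OF that] by (simp add: Ge that)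
  ultimately show "awr_round N r c F \<in> transport_polytope N r c"
    using rc Gc by (simp add: G transport_polytope_iff)
  have "(\<Sum>i<N. \<Sum>j<N. \<bar>G $$ (i, j) - F $$ (i, j)\<bar>)
      \<le> (\<Sum>i<N. \<Sum>j<N. (F $$ (i, j) - F2 $$ (i, j)) + er $ i * ec $ j / (1 - m))"
  proof (intro sum_mono)
    fix i j assume "i \<in> {..<N}" "j \<in> {..<N}"
    then have ij: "i < N" "j < N" by auto
    show "\<bar>G $$ (i, j) - F $$ (i, j)\<bar> \<le> (F $$ (i, j) - F2 $$ (i, j)) + er $ i * ec $ j / (1 - m)"
      unfolding Ge[OF ij] using corr[OF ij] F2le[OF ij] F1le[OF ij] by linarith
  qed
  also have "\<dots> = 2 * (1 - m)"
    by (simp add: sum.distrib sum_subtractf Fsum rowc sum_er flip: m_def)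
  also have "1 - m = (\<Sum>i<N. row_mass N F i - row_mass N F1 i) + (\<Sum>j<N. col_mass N F1 j - col_mass N F2 j)"
    by (simp add: sum_subtractf sum_row_mass sum_col_mass Fsum m_def)
  also have "\<dots> \<le> (\<Sum>i<N. row_mass N F i - min (r $ i) (row_mass N F i))
        + (\<Sum>j<N. col_mass N F j - min (c $ j) (col_mass N F j))"
    using col1 by (intro add_mono sum_mono) (auto simp: row1 col2 min_def, smt (verit))
  also have "\<dots> = ((\<Sum>i<N. \<bar>row_mass N F i - r $ i\<bar>) + (\<Sum>j<N. \<bar>col_mass N F j - c $ j\<bar>)) / 2"
    using sums by (simp add: sum_excess_le sum_row_mass sum_col_mass Fsum)
  finally show "(\<Sum>i<N. \<Sum>j<N. \<bar>awr_round N r c F $$ (i, j) - F $$ (i, j)\<bar>)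
      \<le> (\<Sum>i<N. \<bar>row_mass N F i - r $ i\<bar>) + (\<Sum>j<N. \<bar>col_mass N F j - c $ j\<bar>)"
    by (simp add: G)
qed

section \<open>Pairings and elementary inequalities\<close>

definition points :: "nat \<Rightarrow> point set" where
  "points N = carrier_vec N \<times> carrier_vec N"

definition pair_inner :: "nat \<Rightarrow> point \<Rightarrow> point \<Rightarrow> real" where
  "pair_inner N u v = (\<Sum>i<N. fst u $ i * fst v $ i) + (\<Sum>j<N. snd u $ j * snd v $ j)"

lemma sum_plan_rows:
  "(\<Sum>i<N. \<Sum>j<N. X $$ (i, j) * f i) = (\<Sum>i<N. f i * row_mass N X i)"
  by (simp add: row_mass_def sum_distrib_left mult.commute)

lemma sum_plan_cols:
  "(\<Sum>i<N. \<Sum>j<N. X $$ (i, j) * f j) = (\<Sum>j<N. f j * col_mass N X j)"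
  by (subst sum.swap) (simp add: col_mass_def sum_distrib_left mult.commute)

text \<open>
  Convexity of \<open>x ln x\<close>, from two tangent inequalities at the mixture \<open>v\<close>. It is stated with weights
  \<open>a\<close> and \<open>w\<close> that need not add up to one, as the iteration accumulates them.
\<close>

lemma entropic_cost_mix:
  fixes x y a w v c g :: real
  assumes "0 \<le> x" "0 \<le> y" "0 \<le> a" "0 \<le> w" "0 < v" "0 \<le> g" and mix: "(a + w) * v = a * x + w * y"
  shows "(a + w) * (c * v + g * (v * ln v)) \<le> a * (c * x + g * (x * ln x)) + w * (c * y + g * (y * ln y))"
proof -
  have "0 \<le> a * (x * (ln x - ln v) - x + v)" "0 \<le> w * (y * (ln y - ln v) - y + v)"
    using assms by (auto intro!: mult_nonneg_nonneg kl_term_nonneg)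
  then have "(a * x + w * y) * ln v \<le> a * (x * ln x) + w * (y * ln y) + ((a + w) * v - (a * x + w * y))"
    by (simp add: algebra_simps)
  moreover have "(a * x + w * y) * ln v = (a + w) * (v * ln v)" by (simp add: mult.assoc flip: mix)
  moreover have "(a + w) * v - (a * x + w * y) = 0" using mix by simp
  ultimately have "(a + w) * (v * ln v) \<le> a * (x * ln x) + w * (y * ln y)" by linarith
  then have "g * ((a + w) * (v * ln v)) \<le> g * (a * (x * ln x) + w * (y * ln y))"
    using assms by (intro mult_left_mono)
  moreover have "c * ((a + w) * v) = c * (a * x + w * y)" by (simp only: mix)
  moreover have "(a + w) * (c * v + g * (v * ln v)) = c * ((a + w) * v) + g * ((a + w) * (v * ln v))"
    by (simp add: algebra_simps)
  moreover have "a * (c * x + g * (x * ln x)) + w * (c * y + g * (y * ln y)) =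
      c * (a * x + w * y) + g * (a * (x * ln x) + w * (y * ln y))"
    by (simp add: algebra_simps)
  ultimately show ?thesis by linarith
qed

text \<open>
  The step condition says that \<open>sqrt (w + a)\<close> exceeds \<open>sqrt w\<close> by at least \<open>sqrt \<gamma> / 4\<close>:
  with \<open>h = sqrt \<gamma> / 4\<close> and \<open>u = sqrt (w + a)\<close> it gives \<open>w \<le> (u - h)\<^sup>2\<close>.
\<close>

lemma weight_growth:
  fixes w a \<gamma> :: real
  assumes g: "0 < \<gamma>" and a: "0 < a" and w: "\<gamma> * (real k)\<^sup>2 / 16 \<le> w" and step: "\<gamma> / 4 * (w + a) \<le> a\<^sup>2"
  shows "\<gamma> * (real (Suc k))\<^sup>2 / 16 \<le> w + a"
proof -
  define u h where "u = sqrt (w + a)" and "h = sqrt \<gamma> / 4"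
  have "0 \<le> \<gamma> * (real k)\<^sup>2 / 16" using g by simp
  then have w0: "0 \<le> w" using w by linarith
  have u: "u\<^sup>2 = w + a" "0 < u" using w0 a by (simp_all add: u_def)
  have h: "16 * h\<^sup>2 = \<gamma>" "0 < h" using g by (simp_all add: h_def power_divide)
  have "(2 * h * u)\<^sup>2 = \<gamma> / 4 * (w + a)" unfolding u(1)[symmetric] h(1)[symmetric] by (simp add: power_mult_distrib)
  then have "(2 * h * u)\<^sup>2 \<le> a\<^sup>2" using step by linarith
  then have a2: "2 * h * u \<le> a" by (rule power2_le_imp_le) (use a in linarith)
  then have "(2 * h) * u \<le> u * u" using u(1) w0 unfolding power2_eq_square by linarith
  then have hu: "2 * h \<le> u" using u(2) by (rule mult_right_le_imp_le)
  have "(h * k)\<^sup>2 = \<gamma> * (real k)\<^sup>2 / 16" unfolding h(1)[symmetric] power_mult_distrib by linarith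
  then have "(h * k)\<^sup>2 \<le> w" using w by linarith
  also have "w \<le> (u - h)\<^sup>2"
  proof -
    have "2 * u * h \<le> a" using a2 by (simp only: mult_ac)
    then show ?thesis using u(1) zero_le_power2[of h] unfolding power2_diff by linarith
  qed
  finally have "h * k \<le> u - h" by (rule power2_le_imp_le) (use hu h(2) in linarith)
  moreover have "h * real (Suc k) = h * k + h" by (simp add: distrib_left)
  ultimately have "h * real (Suc k) \<le> u" by linarith
  then have "(h * real (Suc k))\<^sup>2 \<le> u\<^sup>2"
    by (rule power_mono) (rule mult_nonneg_nonneg[OF less_imp_le[OF h(2)] of_nat_0_le_iff])
  moreover have "(h * real (Suc k))\<^sup>2 = \<gamma> * (real (Suc k))\<^sup>2 / 16"
    unfolding h(1)[symmetric] power_mult_distrib by linarith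
  ultimately show ?thesis using u(1) by linarith
qed

lemma pair_inner_lin:
  assumes "\<And>i. i < N \<Longrightarrow> fst u $ i = fst v $ i + a * fst g $ i"
    and "\<And>i. i < N \<Longrightarrow> snd u $ i = snd v $ i + a * snd g $ i"
  shows "pair_inner N u x = pair_inner N v x + a * pair_inner N g x"
proof -
  have "(\<Sum>i<N. fst u $ i * fst x $ i) = (\<Sum>i<N. fst v $ i * fst x $ i + a * (fst g $ i * fst x $ i))"
    by (rule sum.cong) (simp_all add: assms distrib_right)
  moreover have "(\<Sum>i<N. snd u $ i * snd x $ i) = (\<Sum>i<N. snd v $ i * snd x $ i + a * (snd g $ i * snd x $ i))"
    by (rule sum.cong) (simp_all add: assms distrib_right)
  ultimately show ?thesis
    by (simp only: pair_inner_def sum.distrib distrib_left sum_distrib_left add_ac)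
qed

text \<open>
  The arithmetic of one step of the invariant. Here \<open>L\<close>, \<open>P\<close>, \<open>P'\<close> are the dual values at \<open>\<lambda>\<close>, \<open>\<eta>\<close> and the
  new \<open>\<eta>\<close>; \<open>E\<close>, \<open>X\<close>, \<open>X'\<close> the primal values of the Gibbs plan and of the old and new average; \<open>ql\<close>, \<open>qz\<close> the
  products of the gradient with \<open>\<lambda>\<close> and \<open>\<zeta>\<close>; \<open>G\<close> and \<open>zz\<close> the squared norms of the gradient and of \<open>\<zeta>\<close>.
\<close>

lemma energy_balance:
  fixes w a :: real
  assumes "w * L \<le> w * P" "a * ql \<le> a * qz" "a * E = a * ql - a * L"
    "(a + w) * X' \<le> a * E + w * X" "w * (P + X) + zz / 2 \<le> 0" "(w + a) * P' = (w + a) * L - a\<^sup>2 * G / 2"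
  shows "(w + a) * (P' + X') + (zz - 2 * a * qz + a\<^sup>2 * G) / 2 \<le> 0"
proof -
  have "(w + a) * (P' + X') + (zz - 2 * a * qz + a\<^sup>2 * G) / 2
      = (w + a) * L + (a + w) * X' + zz / 2 - a * qz"
    using assms(6) by (simp add: algebra_simps diff_divide_distrib add_divide_distrib)
  also have "\<dots> \<le> w * (P + X) + zz / 2"
    using assms(1-4) by (simp add: algebra_simps)
  finally show ?thesis using assms(5) by linarith
qed

lemma pair_inner_commute: "pair_inner N u v = pair_inner N v u"
  by (simp add: pair_inner_def mult.commute)

lemma nonpos_if_scaled_nonpos: "a * b \<le> 0 \<Longrightarrow> 0 < a \<Longrightarrow> b \<le> 0" for a b :: real
  by (simp add: mult_le_0_iff)

section \<open>Entropic duality\<close>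

locale entropic_dual =
  fixes N :: nat and \<gamma> :: real and C :: "real mat" and rt ct :: "real vec"
  assumes N_pos: "0 < N" and gamma_pos: "0 < \<gamma>"
    and C_carrier: "C \<in> carrier_mat N N"
    and rt_carrier: "rt \<in> carrier_vec N" and ct_carrier: "ct \<in> carrier_vec N"
    and rt_pos: "\<And>i. i < N \<Longrightarrow> 0 < rt $ i" and ct_pos: "\<And>i. i < N \<Longrightarrow> 0 < ct $ i"
    and rt_sum: "(\<Sum>i<N. rt $ i) = 1" and ct_sum: "(\<Sum>i<N. ct $ i) = 1"
begin

abbreviation phi :: "point \<Rightarrow> real" where "phi \<equiv> dual_obj \<gamma> C rt ct"
abbreviation plan :: "point \<Rightarrow> real mat" where "plan \<equiv> gibbs \<gamma> C"
abbreviation entr :: "real mat \<Rightarrow> real" where "entr \<equiv> reg_obj \<gamma> C"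

definition Z :: "point \<Rightarrow> real" where
  "Z p = (\<Sum>i<N. \<Sum>j<N. kernel \<gamma> C p i j)"

definition resid :: "real mat \<Rightarrow> point" where
  "resid X = (vec N (\<lambda>i. rt $ i - row_mass N X i), vec N (\<lambda>j. ct $ j - col_mass N X j))"

lemma dims [simp]: "dim_row C = N" "dim_col C = N" "dim_vec rt = N" "dim_vec ct = N"
  using C_carrier rt_carrier ct_carrier by auto

lemma rt_le_1: "i < N \<Longrightarrow> rt $ i \<le> 1"
  using member_le_sum[of i "{..<N}" "\<lambda>i. rt $ i"] rt_pos rt_sum by (force simp: less_imp_le)

lemma Z_pos: "0 < Z p"
  unfolding Z_def kernel_def using N_pos by (intro sum_pos) auto

lemma phi_eq: "phi p = \<gamma> * ln (Z p) + (\<Sum>i<N. fst p $ i * rt $ i) + (\<Sum>j<N. snd p $ j * ct $ j)"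
  by (simp add: dual_obj_def Z_def scalar_prod_def atLeast0LessThan)

lemma plan_entry: "i < N \<Longrightarrow> j < N \<Longrightarrow> plan p $$ (i, j) = kernel \<gamma> C p i j / Z p"
  by (simp add: gibbs_def Z_def)

lemma plan_pos: "i < N \<Longrightarrow> j < N \<Longrightarrow> 0 < plan p $$ (i, j)"
  using Z_pos by (simp add: plan_entry kernel_def)

lemma plan_carrier: "plan p \<in> carrier_mat N N"
  by (simp add: gibbs_def)

lemma plan_plans: "plan p \<in> plans N"
proof -
  have "(\<Sum>i<N. \<Sum>j<N. plan p $$ (i, j)) = Z p / Z p"
    by (simp add: plan_entry Z_def[of p] flip: sum_divide_distrib)
  then show ?thesis using Z_pos[of p] plan_pos plan_carrier by (auto simp: plans_def less_imp_le)
qed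

lemma entr_eq:
  assumes "X \<in> carrier_mat N N"
  shows "entr X = (\<Sum>i<N. \<Sum>j<N. C $$ (i, j) * X $$ (i, j) + \<gamma> * (X $$ (i, j) * ln (X $$ (i, j))))"
  using assms by (simp add: reg_obj_def mat_inner_def sum.distrib sum_distrib_left)

text \<open>
  The logarithm of a Gibbs entry is affine in the dual variables, so the relative entropy with respect to
  \<open>X(\<lambda>)\<close> splits into the primal objective, the dual objective and the pairing with the residual. The terms
  \<open>- X + X(\<lambda>)\<close> add up to zero and make every summand nonnegative.
\<close>

lemma duality_gap:
  assumes X: "X \<in> plans N"
  shows "entr X + phi p - pair_inner N p (resid X) =
    \<gamma> * (\<Sum>i<N. \<Sum>j<N. X $$ (i, j) * (ln (X $$ (i, j)) - ln (plan p $$ (i, j)))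
           - X $$ (i, j) + plan p $$ (i, j))"
proof -
  have Xc: "X \<in> carrier_mat N N" and X1: "(\<Sum>i<N. \<Sum>j<N. X $$ (i, j)) = 1"
    using X by (auto simp: plans_def)
  have P1: "(\<Sum>i<N. \<Sum>j<N. plan p $$ (i, j)) = 1"
    using plan_plans by (simp add: plans_def)
  have lnG: "\<gamma> * ln (plan p $$ (i, j)) = - (fst p $ i + snd p $ j + C $$ (i, j)) - \<gamma> * ln (Z p)"
    if "i < N" "j < N" for i j
    using that Z_pos[of p] gamma_pos by (simp add: plan_entry kernel_def ln_div field_simps)
  have "\<gamma> * (\<Sum>i<N. \<Sum>j<N. X $$ (i, j) * (ln (X $$ (i, j)) - ln (plan p $$ (i, j)))
           - X $$ (i, j) + plan p $$ (i, j))
     = \<gamma> * (\<Sum>i<N. \<Sum>j<N. X $$ (i, j) * (ln (X $$ (i, j)) - ln (plan p $$ (i, j))))"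
    by (simp add: sum.distrib sum_subtractf X1 P1)
  also have "\<dots> = (\<Sum>i<N. \<Sum>j<N. C $$ (i, j) * X $$ (i, j) + \<gamma> * (X $$ (i, j) * ln (X $$ (i, j)))
       + X $$ (i, j) * (fst p $ i) + X $$ (i, j) * (snd p $ j) + X $$ (i, j) * (\<gamma> * ln (Z p)))"
    unfolding sum_distrib_left
  proof (intro sum.cong refl)
    fix i j assume "i \<in> {..<N}" "j \<in> {..<N}"
    then have e1: "\<gamma> * ln (plan p $$ (i, j)) = - (fst p $ i + snd p $ j + C $$ (i, j)) - \<gamma> * ln (Z p)"
      using lnG by simp
    have e2: "\<gamma> * (X $$ (i, j) * (ln (X $$ (i, j)) - ln (plan p $$ (i, j)))) =
      \<gamma> * (X $$ (i, j) * ln (X $$ (i, j))) - X $$ (i, j) * (\<gamma> * ln (plan p $$ (i, j)))"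
      by (simp add: algebra_simps)
    show "\<gamma> * (X $$ (i, j) * (ln (X $$ (i, j)) - ln (plan p $$ (i, j)))) =
       C $$ (i, j) * X $$ (i, j) + \<gamma> * (X $$ (i, j) * ln (X $$ (i, j)))
       + X $$ (i, j) * (fst p $ i) + X $$ (i, j) * (snd p $ j) + X $$ (i, j) * (\<gamma> * ln (Z p))"
      unfolding e2 e1 by (simp add: algebra_simps)
  qed
  also have "\<dots> = entr X + (\<Sum>i<N. \<Sum>j<N. X $$ (i, j) * (fst p $ i))
      + (\<Sum>i<N. \<Sum>j<N. X $$ (i, j) * (snd p $ j)) + \<gamma> * ln (Z p)"
    by (simp add: entr_eq[OF Xc] sum.distrib X1 flip: sum_distrib_right)
  also have "\<dots> = entr X + phi p - pair_inner N p (resid X)"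
    unfolding sum_plan_rows sum_plan_cols
    by (simp add: phi_eq pair_inner_def resid_def algebra_simps sum_subtractf)
  finally show ?thesis by simp
qed

lemma weak_duality:
  assumes X: "X \<in> plans N"
  shows "pair_inner N p (resid X) - phi p \<le> entr X"
proof -
  have "0 \<le> \<gamma> * (\<Sum>i<N. \<Sum>j<N. X $$ (i, j) * (ln (X $$ (i, j)) - ln (plan p $$ (i, j)))
           - X $$ (i, j) + plan p $$ (i, j))"
    using X gamma_pos plan_pos
    by (intro mult_nonneg_nonneg sum_nonneg kl_term_nonneg) (auto simp: plans_def)
  then show ?thesis using duality_gap[OF X, of p] by simp
qed

lemma strong_duality: "entr (plan p) = pair_inner N p (resid (plan p)) - phi p"
  using duality_gap[OF plan_plans, of p p] by simp

lemma phi_convex: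
  "phi p + (pair_inner N p' (resid (plan p)) - pair_inner N p (resid (plan p))) \<le> phi p'"
  using weak_duality[OF plan_plans, of p' p] strong_duality[of p] by simp

text \<open>
  Stated coordinatewise for an arbitrary affine curve, so that it serves both for the partial
  derivatives and for the line search.
\<close>

lemma phi_has_derivative_along_line:
  assumes y: "\<And>t i. i < N \<Longrightarrow> fst (P t) $ i = y i + t * dy i"
    and z: "\<And>t j. j < N \<Longrightarrow> snd (P t) $ j = z j + t * dz j"
  shows "((\<lambda>t. phi (P t)) has_real_derivative
    (\<Sum>i<N. dy i * fst (resid (plan (P t))) $ i) + (\<Sum>j<N. dz j * snd (resid (plan (P t))) $ j)) (at t)"
proof -
  define k where "k t i j = exp (- (y i + t * dy i + (z j + t * dz j) + C $$ (i, j)) / \<gamma>)" for t i j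
  have k: "kernel \<gamma> C (P t) i j = k t i j" if "i < N" "j < N" for t i j
    using that by (simp add: kernel_def k_def y z)
  have Zk: "Z (P t) = (\<Sum>i<N. \<Sum>j<N. k t i j)" for t
    by (simp add: Z_def k)
  have dk: "((\<lambda>t. k t i j) has_real_derivative k t i j * (- (dy i + dz j) / \<gamma>)) (at t)" for i j
    unfolding k_def using gamma_pos by (auto intro!: derivative_eq_intros simp: field_simps)
  have dZ: "((\<lambda>t. Z (P t)) has_real_derivative (\<Sum>i<N. \<Sum>j<N. k t i j * (- (dy i + dz j) / \<gamma>))) (at t)"
    unfolding Zk by (intro DERIV_sum dk)
  have pe: "plan (P t) $$ (i, j) = k t i j / Z (P t)" if "i < N" "j < N" for i j
    using that by (simp add: plan_entry k)
  have "\<gamma> * ((\<Sum>i<N. \<Sum>j<N. k t i j * (- (dy i + dz j) / \<gamma>)) / Z (P t)) =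
     (\<Sum>i<N. \<Sum>j<N. - (plan (P t) $$ (i, j) * dy i) - plan (P t) $$ (i, j) * dz j)"
    unfolding sum_divide_distrib sum_distrib_left using gamma_pos
    by (intro sum.cong refl) (simp add: pe algebra_simps diff_divide_distrib)
  also have "\<dots> = - (\<Sum>i<N. dy i * row_mass N (plan (P t)) i) - (\<Sum>j<N. dz j * col_mass N (plan (P t)) j)"
    by (simp add: sum_subtractf sum_negf sum_plan_rows sum_plan_cols)
  finally have e: "\<gamma> * ((\<Sum>i<N. \<Sum>j<N. k t i j * (- (dy i + dz j) / \<gamma>)) / Z (P t)) =
     - (\<Sum>i<N. dy i * row_mass N (plan (P t)) i) - (\<Sum>j<N. dz j * col_mass N (plan (P t)) j)" .
  have "((\<lambda>t. \<gamma> * ln (Z (P t)) + (\<Sum>i<N. (y i + t * dy i) * rt $ i) + (\<Sum>j<N. (z j + t * dz j) * ct $ j))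
     has_real_derivative \<gamma> * ((\<Sum>i<N. \<Sum>j<N. k t i j * (- (dy i + dz j) / \<gamma>)) / Z (P t))
       + (\<Sum>i<N. dy i * rt $ i) + (\<Sum>j<N. dz j * ct $ j)) (at t)"
    using Z_pos[of "P t"] by (auto intro!: derivative_eq_intros dZ DERIV_sum simp: divide_inverse mult.commute)
  also have "(\<lambda>t. \<gamma> * ln (Z (P t)) + (\<Sum>i<N. (y i + t * dy i) * rt $ i) + (\<Sum>j<N. (z j + t * dz j) * ct $ j))
     = (\<lambda>t. phi (P t))"
    by (simp add: phi_eq y z)
  finally show ?thesis unfolding e
    by (simp add: resid_def algebra_simps sum_subtractf)
qed

lemma grad_phi:
  assumes "p \<in> points N"
  shows "grad_y phi p = fst (resid (plan p))" "grad_z phi p = snd (resid (plan p))"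
proof -
  have d: "dim_vec (fst p) = N" "dim_vec (snd p) = N" using assms by (auto simp: points_def)
  have "deriv (\<lambda>t. phi (fst p + t \<cdot>\<^sub>v unit_vec N i, snd p)) 0 = fst (resid (plan p)) $ i" if "i < N" for i
  proof -
    let ?P = "\<lambda>t. (fst p + t \<cdot>\<^sub>v unit_vec N i, snd p)"
    have P0: "?P 0 = p" using d by (auto intro!: prod_eqI)
    show ?thesis
      using DERIV_imp_deriv[OF phi_has_derivative_along_line[of ?P "\<lambda>k. fst p $ k" "\<lambda>k. if k = i then 1 else 0"
        "\<lambda>k. snd p $ k" "\<lambda>k. 0" 0]] that d
      by (simp add: P0 if_distrib[of "\<lambda>x. x * _"] cong: if_cong)
  qed
  then show "grad_y phi p = fst (resid (plan p))"
    by (auto simp: grad_y_def Let_def d resid_def)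
  have "deriv (\<lambda>t. phi (fst p, snd p + t \<cdot>\<^sub>v unit_vec N i)) 0 = snd (resid (plan p)) $ i" if "i < N" for i
  proof -
    let ?P = "\<lambda>t. (fst p, snd p + t \<cdot>\<^sub>v unit_vec N i)"
    have P0: "?P 0 = p" using d by (auto intro!: prod_eqI)
    show ?thesis
      using DERIV_imp_deriv[OF phi_has_derivative_along_line[of ?P "\<lambda>k. fst p $ k" "\<lambda>k. 0"
        "\<lambda>k. snd p $ k" "\<lambda>k. if k = i then 1 else 0" 0]] that d
      by (simp add: P0 if_distrib[of "\<lambda>x. x * _"] cong: if_cong)
  qed
  then show "grad_z phi p = snd (resid (plan p))"
    by (auto simp: grad_z_def Let_def d resid_def)
qed

lemma segment_points: "p \<in> points N \<Longrightarrow> p' \<in> points N \<Longrightarrow> segment p p' b \<in> points N"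
  by (auto simp: points_def segment_def)

lemma segment_entry:
  assumes "p \<in> points N" "p' \<in> points N" "i < N"
  shows "fst (segment p p' b) $ i = fst p $ i + b * (fst p' $ i - fst p $ i)"
    "snd (segment p p' b) $ i = snd p $ i + b * (snd p' $ i - snd p $ i)"
  using assms by (auto simp: points_def segment_def algebra_simps)

lemma phi_segment_deriv:
  assumes "p \<in> points N" "p' \<in> points N"
  shows "((\<lambda>b. phi (segment p p' b)) has_real_derivative
     pair_inner N p' (resid (plan (segment p p' b))) - pair_inner N p (resid (plan (segment p p' b)))) (at b)"
  using phi_has_derivative_along_line[of "segment p p'", OF segment_entry(1)[OF assms] segment_entry(2)[OF assms], of b]
  by (simp add: pair_inner_def algebra_simps sum_subtractf)

lemma line_min_exists:
  assumes "p \<in> points N" "p' \<in> points N"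
  shows "\<exists>\<beta>. is_line_min phi p p' \<beta>"
proof -
  have "continuous_on {0..1} (\<lambda>b. phi (segment p p' b))"
    using phi_segment_deriv[OF assms] by (intro DERIV_continuous_on) (auto intro: has_field_derivative_at_within)
  then obtain b where "b \<in> {0..1}" "\<forall>x\<in>{0..1}. phi (segment p p' b) \<le> phi (segment p p' x)"
    using continuous_attains_inf[of "{0..1::real}" "\<lambda>b. phi (segment p p' b)"] by auto
  then show ?thesis by (intro exI[of _ b]) (auto simp: is_line_min_def is_arg_min_linorder)
qed

text \<open>
  The first inequality compares with \<open>\<beta> = 0\<close>. For the second, a negative slope of \<open>\<phi>\<close> along
  \<open>p' - p\<close> at the minimizer would allow a further decrease to the right, unless \<open>\<beta> = 1\<close>, in which case both sides
  agree.
\<close>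

lemma line_min_props:
  assumes p: "p \<in> points N" "p' \<in> points N" and min: "is_line_min phi p p' \<beta>"
  defines "lam \<equiv> segment p p' \<beta>"
  shows "phi lam \<le> phi p"
    and "pair_inner N lam (resid (plan lam)) \<le> pair_inner N p' (resid (plan lam))"
proof -
  have b: "0 \<le> \<beta>" "\<beta> \<le> 1" and le: "\<And>x. 0 \<le> x \<Longrightarrow> x \<le> 1 \<Longrightarrow> phi lam \<le> phi (segment p p' x)"
    using min by (auto simp: is_line_min_def is_arg_min_linorder lam_def)
  have "segment p p' 0 = p"
    using p by (auto simp: segment_def points_def intro!: prod_eqI eq_vecI)
  then show "phi lam \<le> phi p" using le[of 0] by simp
  let ?D = "pair_inner N p' (resid (plan lam)) - pair_inner N p (resid (plan lam))"
  have lam: "pair_inner N lam g = pair_inner N p g + \<beta> * (pair_inner N p' g - pair_inner N p g)" for g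
  proof -
    have "pair_inner N lam g = (\<Sum>i<N. fst p $ i * fst g $ i + \<beta> * (fst p' $ i * fst g $ i - fst p $ i * fst g $ i))
       + (\<Sum>i<N. snd p $ i * snd g $ i + \<beta> * (snd p' $ i * snd g $ i - snd p $ i * snd g $ i))"
      unfolding pair_inner_def lam_def
      by (intro arg_cong2[of _ _ _ _ "(+)"] sum.cong refl) (auto simp: segment_entry[OF p] algebra_simps)
    also have "\<dots> = pair_inner N p g + \<beta> * (pair_inner N p' g - pair_inner N p g)"
      by (simp add: pair_inner_def sum.distrib sum_subtractf sum_distrib_left algebra_simps)
    finally show ?thesis .
  qed
  show "pair_inner N lam (resid (plan lam)) \<le> pair_inner N p' (resid (plan lam))"
  proof (cases "\<beta> = 1")
    case True
    then show ?thesis by (simp add: lam)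
  next
    case False
    have "0 \<le> ?D"
    proof (rule ccontr)
      assume "\<not> 0 \<le> ?D"
      then obtain d where d: "d > 0" "\<And>h. 0 < h \<Longrightarrow> h < d \<Longrightarrow> phi (segment p p' (\<beta> + h)) < phi lam"
        using DERIV_neg_dec_right[OF phi_segment_deriv[OF p, of \<beta>]] by (auto simp: lam_def)
      define h where "h = min (d / 2) (1 - \<beta>)"
      have "0 < h" "h < d" "\<beta> + h \<le> 1" using d False b by (auto simp: h_def)
      then show False using d(2)[of h] le[of "\<beta> + h"] b by auto
    qed
    then have "0 \<le> (1 - \<beta>) * ?D" using b by (intro mult_nonneg_nonneg) auto
    then show ?thesis by (simp add: lam algebra_simps)
  qed
qed

section \<open>Exact block minimization\<close>

text \<open>
  The exact block minimizer, normalized so that the kernel has total mass one.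
\<close>

definition min_y :: "point \<Rightarrow> point" where
  "min_y p = (vec N (\<lambda>i. \<gamma> * (ln (\<Sum>j<N. exp (- (snd p $ j + C $$ (i, j)) / \<gamma>)) - ln (rt $ i))), snd p)"

lemma kernel_min_y:
  assumes i: "i < N"
  shows "(\<Sum>j<N. kernel \<gamma> C (min_y p) i j) = rt $ i"
proof -
  let ?T = "\<Sum>j<N. exp (- (snd p $ j + C $$ (i, j)) / \<gamma>)"
  have T: "0 < ?T" using N_pos by (intro sum_pos) auto
  have "kernel \<gamma> C (min_y p) i j = rt $ i / ?T * exp (- (snd p $ j + C $$ (i, j)) / \<gamma>)" for j
  proof -
    have "- (fst (min_y p) $ i + snd (min_y p) $ j + C $$ (i, j)) / \<gamma>
       = ln (rt $ i) - ln ?T + (- (snd p $ j + C $$ (i, j)) / \<gamma>)"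
      using i gamma_pos by (simp add: min_y_def field_simps)
    then show ?thesis using T rt_pos[OF i] by (simp add: kernel_def exp_add exp_diff)
  qed
  then have "(\<Sum>j<N. kernel \<gamma> C (min_y p) i j) = rt $ i / ?T * ?T"
    by (simp only: sum_distrib_left)
  then show ?thesis using T by simp
qed

lemma Z_min_y: "Z (min_y p) = 1"
  by (simp add: Z_def kernel_min_y rt_sum)

lemma row_mass_min_y: "i < N \<Longrightarrow> row_mass N (plan (min_y p)) i = rt $ i"
  by (simp add: row_mass_def plan_entry Z_min_y kernel_min_y)

lemma min_y_points: "p \<in> points N \<Longrightarrow> min_y p \<in> points N"
  by (auto simp: min_y_def points_def)

text \<open>
  The gradient in the \<open>y\<close> block vanishes here, so the tangent inequality of the convex \<open>\<phi>\<close> has no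
  linear term for points with the same \<open>z\<close> block.
\<close>

lemma min_y_is_arg_min:
  assumes "p \<in> points N"
  shows "is_arg_min phi (\<lambda>p'. fst p' \<in> carrier_vec N \<and> snd p' = snd p) (min_y p)"
proof -
  have "phi (min_y p) \<le> phi p'" if "snd p' = snd p" for p'
  proof -
    have "pair_inner N p' (resid (plan (min_y p))) = pair_inner N (min_y p) (resid (plan (min_y p)))"
      using that by (simp add: pair_inner_def resid_def row_mass_min_y) (simp add: min_y_def)
    then show ?thesis using phi_convex[of "min_y p" p'] by simp
  qed
  then show ?thesis by (auto simp: is_arg_min_linorder) (auto simp: min_y_def)
qed

text \<open>
  The decrease is exactly \<open>\<gamma>\<close> times the relative entropy of the prescribed row marginal with respect to
  the current one.
\<close>

lemma min_y_decrease:
  "\<gamma> / 4 * (\<Sum>i<N. (fst (resid (plan p)) $ i)\<^sup>2) \<le> phi p - phi (min_y p)"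
proof -
  define T where "T i = (\<Sum>j<N. exp (- (snd p $ j + C $$ (i, j)) / \<gamma>))" for i
  define rho where "rho i = row_mass N (plan p) i" for i
  have T: "0 < T i" for i unfolding T_def using N_pos by (intro sum_pos) auto
  have rho_pos: "0 < rho i" if "i < N" for i
    unfolding rho_def row_mass_def using that N_pos plan_pos by (intro sum_pos) auto
  have rho_sum: "(\<Sum>i<N. rho i) = 1"
    using plan_plans[of p] by (simp add: rho_def sum_row_mass plans_def)
  have rho_le: "rho i \<le> 1" if "i < N" for i
    using member_le_sum[of i "{..<N}" rho] rho_pos that rho_sum by (force simp: less_imp_le)
  have ln_rho: "\<gamma> * ln (rho i) = - fst p $ i + \<gamma> * ln (T i) - \<gamma> * ln (Z p)" if i: "i < N" for i
  proof -
    have "kernel \<gamma> C p i j = exp (- fst p $ i / \<gamma>) * exp (- (snd p $ j + C $$ (i, j)) / \<gamma>)" for j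
      using gamma_pos by (simp add: kernel_def field_simps flip: exp_add)
    then have "rho i = exp (- fst p $ i / \<gamma>) * T i / Z p"
      using i by (simp add: rho_def row_mass_def plan_entry T_def sum_distrib_left flip: sum_divide_distrib)
    then have "ln (rho i) = - fst p $ i / \<gamma> + ln (T i) - ln (Z p)"
      using T[of i] Z_pos[of p] by (simp add: ln_mult ln_div)
    then show ?thesis using gamma_pos by (simp add: field_simps)
  qed
  have min_yi: "fst (min_y p) $ i = \<gamma> * (ln (T i) - ln (rt $ i))" if "i < N" for i
    using that by (simp add: min_y_def T_def)
  have "\<gamma> * (\<Sum>i<N. rt $ i * (ln (rt $ i) - ln (rho i)) - rt $ i + rho i)
      = (\<Sum>i<N. rt $ i * (\<gamma> * ln (rt $ i) - \<gamma> * ln (rho i)))"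
    by (simp add: sum.distrib sum_subtractf rho_sum rt_sum sum_distrib_left algebra_simps)
  also have "\<dots> = (\<Sum>i<N. rt $ i * (\<gamma> * ln (Z p)) + fst p $ i * rt $ i - fst (min_y p) $ i * rt $ i)"
    by (intro sum.cong) (auto simp: ln_rho min_yi algebra_simps)
  also have "\<dots> = phi p - phi (min_y p)"
    by (simp add: phi_eq Z_min_y sum.distrib sum_subtractf rt_sum flip: sum_distrib_right) (simp add: min_y_def)
  finally have eq: "phi p - phi (min_y p) = \<gamma> * (\<Sum>i<N. rt $ i * (ln (rt $ i) - ln (rho i)) - rt $ i + rho i)"
    by simp
  have "(\<Sum>i<N. (fst (resid (plan p)) $ i)\<^sup>2 / 4) \<le> (\<Sum>i<N. rt $ i * (ln (rt $ i) - ln (rho i)) - rt $ i + rho i)"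
  proof (intro sum_mono)
    fix i assume "i \<in> {..<N}"
    then show "(fst (resid (plan p)) $ i)\<^sup>2 / 4 \<le> rt $ i * (ln (rt $ i) - ln (rho i)) - rt $ i + rho i"
      using kl_term_quadratic[of "rt $ i" "rho i"] rt_pos[of i] rt_le_1 rho_pos rho_le
      by (simp add: resid_def rho_def)
  qed
  then have "\<gamma> * (\<Sum>i<N. (fst (resid (plan p)) $ i)\<^sup>2 / 4) \<le> phi p - phi (min_y p)"
    unfolding eq using gamma_pos by (intro mult_left_mono) auto
  then show ?thesis by (simp flip: sum_divide_distrib)
qed

text \<open>
  Changing the row changes every summand of the log-sum-exp by a factor of at most \<open>exp (M / \<gamma>)\<close>, and the
  marginal contributes at most \<open>- ln m\<close>. The bound does not depend on the \<open>z\<close> block.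
\<close>

lemma min_y_spread:
  assumes C: "\<And>i j. i < N \<Longrightarrow> j < N \<Longrightarrow> 0 \<le> C $$ (i, j) \<and> C $$ (i, j) \<le> M"
    and m: "0 < m" "\<And>i. i < N \<Longrightarrow> m \<le> rt $ i" and ik: "i < N" "k < N"
  shows "fst (min_y p) $ i - fst (min_y p) $ k \<le> M - \<gamma> * ln m"
proof -
  define T where "T i = (\<Sum>j<N. exp (- (snd p $ j + C $$ (i, j)) / \<gamma>))" for i
  have T: "0 < T i" for i unfolding T_def using N_pos by (intro sum_pos) auto
  have "T i \<le> exp (M / \<gamma>) * T k"
    unfolding T_def sum_distrib_left
  proof (intro sum_mono)
    fix j assume "j \<in> {..<N}"
    then have "C $$ (k, j) - C $$ (i, j) \<le> M" using C[of k j] C[of i j] ik by auto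
    then have "(C $$ (k, j) - C $$ (i, j)) / \<gamma> \<le> M / \<gamma>"
      using gamma_pos by (intro divide_right_mono) auto
    then have "- (snd p $ j + C $$ (i, j)) / \<gamma> \<le> M / \<gamma> + (- (snd p $ j + C $$ (k, j)) / \<gamma>)"
      by (simp add: diff_divide_distrib)
    then show "exp (- (snd p $ j + C $$ (i, j)) / \<gamma>) \<le> exp (M / \<gamma>) * exp (- (snd p $ j + C $$ (k, j)) / \<gamma>)"
      by (simp flip: exp_add)
  qed
  then have "ln (T i) \<le> ln (exp (M / \<gamma>) * T k)" using T by (subst ln_le_cancel_iff) auto
  then have "ln (T i) \<le> M / \<gamma> + ln (T k)" using T[of k] by (simp add: ln_mult)
  moreover have "ln m \<le> ln (rt $ i)" using m ik by (subst ln_le_cancel_iff) (auto intro: less_le_trans)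
  moreover have "ln (rt $ k) \<le> 0" using rt_le_1 rt_pos ik by simp
  ultimately have "ln (T i) - ln (rt $ i) - (ln (T k) - ln (rt $ k)) \<le> M / \<gamma> - ln m" by linarith
  then have "\<gamma> * (ln (T i) - ln (rt $ i) - (ln (T k) - ln (rt $ k))) \<le> \<gamma> * (M / \<gamma> - ln m)"
    using gamma_pos by (intro mult_left_mono) auto
  then show ?thesis using ik gamma_pos by (simp add: min_y_def T_def algebra_simps)
qed

text \<open>
  Adding constants to the blocks is compensated by the normalization, as both marginals have mass one.
\<close>

lemma phi_shift:
  assumes y: "\<And>i. i < N \<Longrightarrow> fst p' $ i = fst p $ i + s" and z: "\<And>j. j < N \<Longrightarrow> snd p' $ j = snd p $ j + t"
  shows "phi p' = phi p"
proof -
  have "kernel \<gamma> C p' i j = exp (- (s + t) / \<gamma>) * kernel \<gamma> C p i j" if "i < N" "j < N" for i j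
    using that gamma_pos y z by (simp add: kernel_def field_simps flip: exp_add)
  then have "Z p' = exp (- (s + t) / \<gamma>) * Z p"
    by (simp add: Z_def sum_distrib_left)
  then have "\<gamma> * ln (Z p') = - (s + t) + \<gamma> * ln (Z p)"
    using Z_pos[of p] gamma_pos by (simp add: ln_mult field_simps)
  moreover have "(\<Sum>i<N. fst p' $ i * rt $ i) = (\<Sum>i<N. fst p $ i * rt $ i) + s"
    by (simp add: y algebra_simps sum.distrib rt_sum flip: sum_distrib_left)
  moreover have "(\<Sum>i<N. snd p' $ i * ct $ i) = (\<Sum>i<N. snd p $ i * ct $ i) + t"
    by (simp add: z algebra_simps sum.distrib ct_sum flip: sum_distrib_left)
  ultimately show ?thesis by (simp add: phi_eq)
qed

text \<open>
  Transposing the cost matrix exchanges the two blocks; all facts about \<open>min_z\<close> are obtained in this way.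
\<close>

definition min_z :: "point \<Rightarrow> point" where
  "min_z p = prod.swap (entropic_dual.min_y N \<gamma> (transpose_mat C) ct (prod.swap p))"

lemma transposed: "entropic_dual N \<gamma> (transpose_mat C) ct rt"
  using N_pos gamma_pos C_carrier rt_carrier ct_carrier rt_pos ct_pos rt_sum ct_sum
  by unfold_locales auto

interpretation T: entropic_dual N \<gamma> "transpose_mat C" ct rt
  by (rule transposed)

lemma Z_swap: "T.Z (prod.swap p) = Z p"
  unfolding T.Z_def Z_def by (subst sum.swap) (auto simp: kernel_def add.commute intro!: sum.cong)

lemma phi_swap: "T.phi (prod.swap p) = phi p"
  by (simp add: phi_eq T.phi_eq Z_swap)

lemma plan_swap: "T.plan (prod.swap p) = transpose_mat (plan p)"
  by (rule eq_matI) (simp_all add: plan_entry T.plan_entry Z_swap T.plan_carrier plan_carrier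
      kernel_def add.commute carrier_matD[OF T.plan_carrier] carrier_matD[OF plan_carrier])

lemma resid_swap: "X \<in> carrier_mat N N \<Longrightarrow> T.resid (transpose_mat X) = prod.swap (resid X)"
  by (auto simp: T.resid_def resid_def mass_transpose)

lemma min_z_eq: "min_z p =
   (fst p, vec N (\<lambda>j. \<gamma> * (ln (\<Sum>i<N. exp (- (fst p $ i + C $$ (i, j)) / \<gamma>)) - ln (ct $ j))))"
  by (auto simp: min_z_def T.min_y_def)

lemma min_z_is_arg_min:
  assumes "p \<in> points N"
  shows "is_arg_min phi (\<lambda>p'. fst p' = fst p \<and> snd p' \<in> carrier_vec N) (min_z p)"
proof -
  have "T.phi (T.min_y (prod.swap p)) \<le> T.phi (prod.swap p')"
    if "fst p' = fst p" "snd p' \<in> carrier_vec N" for p'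
  proof -
    have "prod.swap p \<in> points N" using assms by (auto simp: points_def)
    from T.min_y_is_arg_min[OF this]
    have "\<forall>x. fst x \<in> carrier_vec N \<and> snd x = snd (prod.swap p) \<longrightarrow>
        T.phi (T.min_y (prod.swap p)) \<le> T.phi x"
      unfolding is_arg_min_linorder by blast
    from spec[OF this, of "prod.swap p'"] show ?thesis using that by simp
  qed
  then have "phi (min_z p) \<le> phi p'" if "fst p' = fst p" "snd p' \<in> carrier_vec N" for p'
    using that by (simp add: min_z_def flip: phi_swap)
  then show ?thesis by (auto simp: is_arg_min_linorder) (auto simp: min_z_eq)
qed

lemma min_z_decrease:
  "\<gamma> / 4 * (\<Sum>j<N. (snd (resid (plan p)) $ j)\<^sup>2) \<le> phi p - phi (min_z p)"
  using T.min_y_decrease[of "prod.swap p"] phi_swap[of p] phi_swap[of "min_z p"]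
  by (simp add: plan_swap resid_swap plan_carrier min_z_def)

lemma min_z_spread:
  assumes C: "\<And>i j. i < N \<Longrightarrow> j < N \<Longrightarrow> 0 \<le> C $$ (i, j) \<and> C $$ (i, j) \<le> M"
    and m: "0 < m" "\<And>i. i < N \<Longrightarrow> m \<le> ct $ i" and ik: "i < N" "k < N"
  shows "snd (min_z p) $ i - snd (min_z p) $ k \<le> M - \<gamma> * ln m"
  using T.min_y_spread[of M m i k "prod.swap p"] assms by (simp add: min_z_def)

text \<open>
  Two block minimizations do not raise \<open>\<phi>\<close> and leave both blocks with bounded spread; a shift of each
  block turns bounded spread into bounded coordinates. This takes the place of a bound on the norm of an
  optimal dual solution.
\<close>

lemma bounded_point_below:
  assumes p: "p \<in> points N"
    and C: "\<And>i j. i < N \<Longrightarrow> j < N \<Longrightarrow> 0 \<le> C $$ (i, j) \<and> C $$ (i, j) \<le> M"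
    and m: "0 < m" "\<And>i. i < N \<Longrightarrow> m \<le> rt $ i" "\<And>i. i < N \<Longrightarrow> m \<le> ct $ i"
  obtains p' where "phi p' \<le> phi p"
    "\<And>i. i < N \<Longrightarrow> \<bar>fst p' $ i\<bar> \<le> M - \<gamma> * ln m" "\<And>i. i < N \<Longrightarrow> \<bar>snd p' $ i\<bar> \<le> M - \<gamma> * ln m"
proof -
  define p1 where "p1 = min_z (min_y p)"
  define p2 where "p2 = (vec N (\<lambda>i. fst p1 $ i - fst p1 $ 0), vec N (\<lambda>i. snd p1 $ i - snd p1 $ 0))"
  have "phi (min_y p) \<le> phi p"
    using min_y_is_arg_min[OF p] p by (auto simp: is_arg_min_linorder points_def)
  moreover have "phi p1 \<le> phi (min_y p)"
    using min_z_is_arg_min[OF min_y_points[OF p]] min_y_points[OF p]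
    by (auto simp: is_arg_min_linorder p1_def points_def)
  moreover have "phi p2 = phi p1"
    by (rule phi_shift[of _ _ "- fst p1 $ 0" "- snd p1 $ 0"]) (auto simp: p2_def)
  ultimately have "phi p2 \<le> phi p" by simp
  moreover have "\<bar>fst p2 $ i\<bar> \<le> M - \<gamma> * ln m" if "i < N" for i
    using min_y_spread[OF C m(1,2) that N_pos, of p] min_y_spread[OF C m(1,2) N_pos that, of p] that
    by (auto simp: p2_def p1_def min_z_eq)
  moreover have "\<bar>snd p2 $ i\<bar> \<le> M - \<gamma> * ln m" if "i < N" for i
    using min_z_spread[OF C m(1,3) that N_pos, of "min_y p"] min_z_spread[OF C m(1,3) N_pos that, of "min_y p"] that
    by (auto simp: p2_def p1_def)
  ultimately show ?thesis using that by blast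
qed

section \<open>The invariant of the accelerated iteration\<close>

text \<open>
  The total mass is required only when the weight is positive, because the iteration starts from the zero
  matrix with weight zero.
\<close>

definition accel_inv :: "nat \<Rightarrow> acc_state \<Rightarrow> bool" where
  "accel_inv k s \<longleftrightarrow> eta s \<in> points N \<and> zeta s \<in> points N \<and> Xhat s \<in> carrier_mat N N \<and>
     (\<forall>i<N. \<forall>j<N. 0 \<le> Xhat s $$ (i, j)) \<and>
     (0 < weight s \<longrightarrow> (\<Sum>i<N. \<Sum>j<N. Xhat s $$ (i, j)) = 1) \<and>
     \<gamma> * (real k)\<^sup>2 / 16 \<le> weight s \<and>
     (\<forall>i<N. fst (zeta s) $ i = - weight s * fst (resid (Xhat s)) $ i) \<and>
     (\<forall>j<N. snd (zeta s) $ j = - weight s * snd (resid (Xhat s)) $ j) \<and>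
     weight s * (phi (eta s) + entr (Xhat s)) + pair_inner N (zeta s) (zeta s) / 2 \<le> 0"

lemma accel_invD:
  assumes "accel_inv k s"
  shows "eta s \<in> points N" "zeta s \<in> points N" "Xhat s \<in> carrier_mat N N"
    "\<And>i j. i < N \<Longrightarrow> j < N \<Longrightarrow> 0 \<le> Xhat s $$ (i, j)"
    "0 < weight s \<Longrightarrow> (\<Sum>i<N. \<Sum>j<N. Xhat s $$ (i, j)) = 1"
    "\<gamma> * (real k)\<^sup>2 / 16 \<le> weight s"
    "\<And>i. i < N \<Longrightarrow> fst (zeta s) $ i = - weight s * fst (resid (Xhat s)) $ i"
    "\<And>i. i < N \<Longrightarrow> snd (zeta s) $ i = - weight s * snd (resid (Xhat s)) $ i"
    "weight s * (phi (eta s) + entr (Xhat s)) + pair_inner N (zeta s) (zeta s) / 2 \<le> 0"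
  using assms unfolding accel_inv_def by blast+

lemma accel_inv_init: "accel_inv 0 (acc_init N)"
  by (simp add: accel_inv_def acc_init_def points_def resid_def pair_inner_def)

lemma entr_mix:
  assumes X: "X \<in> carrier_mat N N" "\<And>i j. i < N \<Longrightarrow> j < N \<Longrightarrow> 0 < X $$ (i, j)"
    and Y: "Y \<in> carrier_mat N N" "\<And>i j. i < N \<Longrightarrow> j < N \<Longrightarrow> 0 \<le> Y $$ (i, j)"
    and aw: "0 < a" "0 \<le> w"
    and V: "V \<in> carrier_mat N N"
      "\<And>i j. i < N \<Longrightarrow> j < N \<Longrightarrow> (a + w) * V $$ (i, j) = a * X $$ (i, j) + w * Y $$ (i, j)"
  shows "(a + w) * entr V \<le> a * entr X + w * entr Y"
proof -
  define e where "e M i j = C $$ (i, j) * M $$ (i, j) + \<gamma> * (M $$ (i, j) * ln (M $$ (i, j)))"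
    for M :: "real mat" and i j
  have entr_e: "entr M = (\<Sum>i<N. \<Sum>j<N. e M i j)" if "M \<in> carrier_mat N N" for M
    using entr_eq[OF that] by (simp add: e_def)
  have pt: "(a + w) * e V i j \<le> a * e X i j + w * e Y i j"
    if ij: "i < N" "j < N" for i j
  proof -
    have "0 < a * X $$ (i, j) + w * Y $$ (i, j)"
      by (rule add_pos_nonneg[OF mult_pos_pos[OF aw(1) X(2)[OF ij]] mult_nonneg_nonneg[OF aw(2) Y(2)[OF ij]]])
    then have "0 < (a + w) * V $$ (i, j)" unfolding V(2)[OF ij] .
    then have Vp: "0 < V $$ (i, j)" using zero_less_mult_pos[OF _ add_pos_nonneg[OF aw]] by blast
    show ?thesis unfolding e_def
      by (rule entropic_cost_mix[OF less_imp_le[OF X(2)[OF ij]] Y(2)[OF ij] less_imp_le[OF aw(1)] aw(2) Vp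
            less_imp_le[OF gamma_pos] V(2)[OF ij]])
  qed
  have "(\<Sum>i<N. \<Sum>j<N. (a + w) * e V i j) \<le> (\<Sum>i<N. \<Sum>j<N. a * e X i j + w * e Y i j)"
    by (intro sum_mono pt) auto
  then show ?thesis
    unfolding entr_e[OF X(1)] entr_e[OF Y(1)] entr_e[OF V(1)] by (simp only: sum.distrib sum_distrib_left)
qed

text \<open>
  The hypothesis \<open>root\<close> is the equation for the increment \<open>a\<close>, which cancels the term
  \<open>a\<^sup>2 |g|\<^sup>2 / 2\<close> that the update of \<open>\<zeta>\<close> produces; \<open>decr\<close> is the decrease by block minimization, which
  forces \<open>a\<close> to be large.
\<close>

lemma accel_inv_step:
  assumes inv: "accel_inv k s" and lmin: "is_line_min phi (eta s) (zeta s) \<beta>"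
    and lam: "lam = segment (eta s) (zeta s) \<beta>" and g: "g = resid (plan lam)" and g_pos: "0 < pair_inner N g g"
    and a: "0 < a" and eta': "eta s' \<in> points N"
    and weight': "weight s' = weight s + a"
    and root: "phi lam - a\<^sup>2 / (2 * weight s') * pair_inner N g g = phi (eta s')"
    and decr: "phi (eta s') \<le> phi lam - \<gamma> / 8 * pair_inner N g g"
    and zeta': "zeta s' = (fst (zeta s) - a \<cdot>\<^sub>v fst g, snd (zeta s) - a \<cdot>\<^sub>v snd g)"
    and Xhat': "Xhat s' = (1 / weight s') \<cdot>\<^sub>m (a \<cdot>\<^sub>m plan lam + weight s \<cdot>\<^sub>m Xhat s)"
  shows "accel_inv (Suc k) s'"
proof -
  note e = accel_invD(1)[OF inv] and z = accel_invD(2)[OF inv] and Xc = accel_invD(3)[OF inv]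
    and X0 = accel_invD(4)[OF inv] and X1 = accel_invD(5)[OF inv] and w = accel_invD(6)[OF inv]
    and zy = accel_invD(7)[OF inv] and zz = accel_invD(8)[OF inv] and energy = accel_invD(9)[OF inv]
  have "0 \<le> \<gamma> * (real k)\<^sup>2 / 16" using gamma_pos by simp
  then have w0: "0 \<le> weight s" using w by linarith
  have w'0: "0 < weight s'" using w0 a weight' by simp
  have gd: "fst g \<in> carrier_vec N" "snd g \<in> carrier_vec N" by (auto simp: g resid_def)
  have z': "zeta s' \<in> points N" using z gd by (auto simp: zeta' points_def)
  have z'e: "fst (zeta s') $ i = fst (zeta s) $ i + (- a) * fst g $ i"
     "snd (zeta s') $ i = snd (zeta s) $ i + (- a) * snd g $ i" if "i < N" for i
    using that z gd by (auto simp: zeta' points_def)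
  have X'c: "Xhat s' \<in> carrier_mat N N" using Xc by (simp add: Xhat' plan_carrier)
  have X'e: "(a + weight s) * Xhat s' $$ (i, j) = a * plan lam $$ (i, j) + weight s * Xhat s $$ (i, j)"
    if "i < N" "j < N" for i j
  proof -
    have "Xhat s' $$ (i, j) = (a * plan lam $$ (i, j) + weight s * Xhat s $$ (i, j)) / weight s'"
      using that Xc plan_carrier[of lam] by (simp add: Xhat')
    moreover have "a + weight s = weight s'" by (simp add: weight')
    ultimately show ?thesis using w'0 by simp
  qed
  have X'0: "0 \<le> Xhat s' $$ (i, j)" if "i < N" "j < N" for i j
  proof -
    have "0 \<le> (a + weight s) * Xhat s' $$ (i, j)"
      unfolding X'e[OF that] using a w0 X0[OF that] plan_pos[OF that, of lam] by (simp add: less_imp_le)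
    then show ?thesis using a w0 by (simp add: zero_le_mult_iff)
  qed
  have X'1: "(\<Sum>i<N. \<Sum>j<N. Xhat s' $$ (i, j)) = 1"
  proof -
    have "(a + weight s) * (\<Sum>i<N. \<Sum>j<N. Xhat s' $$ (i, j))
        = (\<Sum>i<N. \<Sum>j<N. a * plan lam $$ (i, j) + weight s * Xhat s $$ (i, j))"
      unfolding sum_distrib_left by (intro sum.cong refl X'e) auto
    also have "\<dots> = a * (\<Sum>i<N. \<Sum>j<N. plan lam $$ (i, j)) + weight s * (\<Sum>i<N. \<Sum>j<N. Xhat s $$ (i, j))"
      by (simp add: sum.distrib sum_distrib_left)
    also have "\<dots> = a + weight s"
      using plan_plans[of lam] X1 w0 by (cases "weight s = 0") (auto simp: plans_def)
    finally show ?thesis using a w0 by simp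
  qed
  have row': "(a + weight s) * row_mass N (Xhat s') i = a * row_mass N (plan lam) i + weight s * row_mass N (Xhat s) i"
    if "i < N" for i
    using that by (simp add: row_mass_def sum_distrib_left X'e flip: sum.distrib)
  have col': "(a + weight s) * col_mass N (Xhat s') i = a * col_mass N (plan lam) i + weight s * col_mass N (Xhat s) i"
    if "i < N" for i
    using that by (simp add: col_mass_def sum_distrib_left X'e flip: sum.distrib)
  have zy': "fst (zeta s') $ i = - weight s' * fst (resid (Xhat s')) $ i" if "i < N" for i
    unfolding z'e(1)[OF that] zy[OF that] weight' using row'[OF that] that
    by (simp add: g resid_def algebra_simps)
  have zz': "snd (zeta s') $ i = - weight s' * snd (resid (Xhat s')) $ i" if "i < N" for i
    unfolding z'e(2)[OF that] zz[OF that] weight' using col'[OF that] that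
    by (simp add: g resid_def algebra_simps)
  have "\<gamma> / 8 * pair_inner N g g \<le> a\<^sup>2 / (2 * weight s') * pair_inner N g g" using root decr by linarith
  then have "\<gamma> / 8 \<le> a\<^sup>2 / (2 * weight s')" using g_pos by (simp only: mult_le_cancel_right_pos)
  then have "\<gamma> / 4 * (weight s + a) \<le> a\<^sup>2" using w'0 weight' by (simp add: field_simps)
  then have growth: "\<gamma> * (real (Suc k))\<^sup>2 / 16 \<le> weight s'"
    unfolding weight' using w gamma_pos a by (intro weight_growth) auto
  have mix: "(a + weight s) * entr (Xhat s') \<le> a * entr (plan lam) + weight s * entr (Xhat s)"
    by (rule entr_mix[OF plan_carrier plan_pos Xc X0 a w0 X'c X'e])
  have lin: "pair_inner N (zeta s') x = pair_inner N (zeta s) x + (- a) * pair_inner N g x" for x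
    by (rule pair_inner_lin) (rule z'e, assumption)+
  have lin': "pair_inner N x (zeta s') = pair_inner N x (zeta s) + (- a) * pair_inner N x g" for x
    using lin[of x] by (simp only: pair_inner_commute[of N x])
  have zz2: "pair_inner N (zeta s') (zeta s') =
     pair_inner N (zeta s) (zeta s) - 2 * a * pair_inner N (zeta s) g + a\<^sup>2 * pair_inner N g g"
    unfolding lin[of "zeta s'"] lin'[of "zeta s"] lin'[of g] pair_inner_commute[of N g "zeta s"] power2_eq_square
    by (simp add: algebra_simps)
  have "weight s' * (a\<^sup>2 / (2 * weight s') * pair_inner N g g) = a\<^sup>2 * pair_inner N g g / 2"
    using w'0 by simp
  then have phi': "weight s' * phi (eta s') = weight s' * phi lam - a\<^sup>2 * pair_inner N g g / 2"
    unfolding root[symmetric] by (simp only: right_diff_distrib)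
  have lm: "phi lam \<le> phi (eta s)" "pair_inner N lam g \<le> pair_inner N (zeta s) g"
    using line_min_props[OF e z lmin] by (simp_all add: lam g)
  have "weight s * phi lam \<le> weight s * phi (eta s)" using lm(1) w0 by (intro mult_left_mono) auto
  moreover have "a * pair_inner N lam g \<le> a * pair_inner N (zeta s) g"
    using lm(2) a by (intro mult_left_mono) auto
  moreover have "a * entr (plan lam) = a * pair_inner N lam g - a * phi lam"
    by (simp add: strong_duality g right_diff_distrib)
  ultimately have "weight s' * (phi (eta s') + entr (Xhat s')) + pair_inner N (zeta s') (zeta s') / 2 \<le> 0"
    using mix energy phi' unfolding weight' zz2 by (intro energy_balance)
  then show ?thesis
    unfolding accel_inv_def using eta' z' X'c X'0 X'1 growth zy' zz' by blast
qed

lemma accel_inv_gap: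
  assumes "accel_inv k s" "0 < k"
  shows "Xhat s \<in> plans N" "phi (eta s) + entr (Xhat s) \<le> 0" "0 < weight s"
proof -
  have "0 < \<gamma> * (real k)\<^sup>2 / 16" using gamma_pos assms by simp
  then show w: "0 < weight s" using accel_invD(6)[OF assms(1)] by linarith
  have "0 \<le> pair_inner N (zeta s) (zeta s)"
    by (auto simp: pair_inner_def intro!: add_nonneg_nonneg sum_nonneg)
  then have "weight s * (phi (eta s) + entr (Xhat s)) \<le> 0"
    using accel_invD(9)[OF assms(1)] by linarith
  then show "phi (eta s) + entr (Xhat s) \<le> 0" using w by (rule nonpos_if_scaled_nonpos)
  have "\<forall>i<N. \<forall>j<N. 0 \<le> Xhat s $$ (i, j)" using accel_invD(4)[OF assms(1)] by simp
  then show "Xhat s \<in> plans N"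
    unfolding plans_def mem_Collect_eq
    by (intro conjI accel_invD(3)[OF assms(1)] accel_invD(5)[OF assms(1) w])
qed

text \<open>
  Weak duality at a point \<open>p\<close> below \<open>\<eta>\<close> with coordinates bounded by \<open>D\<close> turns the energy inequality into
  \<open>|\<zeta>|\<^sup>2 / 2 \<le> \<langle>p, \<zeta>\<rangle>\<close>. Each coordinate satisfies \<open>t\<^sup>2 / 2 - q t \<ge> D |t| - 2 D\<^sup>2\<close> for \<open>|q| \<le> D\<close>, so summing over the
  \<open>2 N\<close> coordinates gives the \<open>l\<^sub>1\<close> bound without passing through the Euclidean norm.
\<close>

lemma accel_inv_infeasibility:
  assumes inv: "accel_inv k s" "0 < k"
    and C: "\<And>i j. i < N \<Longrightarrow> j < N \<Longrightarrow> 0 \<le> C $$ (i, j) \<and> C $$ (i, j) \<le> M"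
    and m: "0 < m" "\<And>i. i < N \<Longrightarrow> m \<le> rt $ i" "\<And>i. i < N \<Longrightarrow> m \<le> ct $ i"
    and D: "D = M - \<gamma> * ln m" "0 < D"
  shows "weight s * ((\<Sum>i<N. \<bar>row_mass N (Xhat s) i - rt $ i\<bar>) + (\<Sum>j<N. \<bar>col_mass N (Xhat s) j - ct $ j\<bar>))
    \<le> 4 * real N * D"
proof -
  note e = accel_invD(1)[OF inv(1)] and X = accel_inv_gap(1)[OF inv] and w = accel_inv_gap(3)[OF inv]
    and zy = accel_invD(7)[OF inv(1)] and zz = accel_invD(8)[OF inv(1)] and energy = accel_invD(9)[OF inv(1)]
  obtain p where p: "phi p \<le> phi (eta s)"
    and py: "\<And>i. i < N \<Longrightarrow> \<bar>fst p $ i\<bar> \<le> D" and pz: "\<And>i. i < N \<Longrightarrow> \<bar>snd p $ i\<bar> \<le> D"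
    using bounded_point_below[OF e C m, folded D(1)] by metis
  \<comment> \<open>Weak duality bounds the gap from below.\<close>
  have "pair_inner N p (resid (Xhat s)) \<le> phi (eta s) + entr (Xhat s)"
    using weak_duality[OF X, of p] p by linarith
  then have "weight s * pair_inner N p (resid (Xhat s)) \<le> weight s * (phi (eta s) + entr (Xhat s))"
    using w by (intro mult_left_mono) auto
  moreover have "weight s * pair_inner N p (resid (Xhat s)) = - pair_inner N p (zeta s)"
    by (simp add: pair_inner_def zy zz sum_distrib_left distrib_left algebra_simps sum_negf)
  ultimately have "pair_inner N (zeta s) (zeta s) / 2 - pair_inner N p (zeta s) \<le> 0"
    using energy by linarith
  then have *: "(\<Sum>i<N. fst (zeta s) $ i * fst (zeta s) $ i / 2 - fst p $ i * fst (zeta s) $ i) +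
      (\<Sum>i<N. snd (zeta s) $ i * snd (zeta s) $ i / 2 - snd p $ i * snd (zeta s) $ i) \<le> 0"
    by (simp add: pair_inner_def sum_subtractf add_divide_distrib sum_divide_distrib)
  have pt: "D * \<bar>t\<bar> - 2 * D\<^sup>2 \<le> t * t / 2 - q * t" if "\<bar>q\<bar> \<le> D" for q t :: real
  proof -
    have "q * t \<le> D * \<bar>t\<bar>"
      using mult_right_mono[OF that, of "\<bar>t\<bar>"] abs_ge_self[of "q * t"] by (simp add: abs_mult)
    moreover have "0 \<le> (\<bar>t\<bar> - 2 * D)\<^sup>2" by simp
    then have "4 * (D * \<bar>t\<bar>) \<le> t * t + 4 * D\<^sup>2"
      unfolding power2_diff power_mult_distrib by (simp add: power2_eq_square mult.commute)
    ultimately show ?thesis by linarith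
  qed
  define Sy Sz where "Sy = (\<Sum>i<N. \<bar>fst (zeta s) $ i\<bar>)" and "Sz = (\<Sum>i<N. \<bar>snd (zeta s) $ i\<bar>)"
  have "D * Sy - real N * (2 * D\<^sup>2) = (\<Sum>i<N. D * \<bar>fst (zeta s) $ i\<bar> - 2 * D\<^sup>2)"
    by (simp add: sum_subtractf sum_distrib_left Sy_def)
  also have "\<dots> \<le> (\<Sum>i<N. fst (zeta s) $ i * fst (zeta s) $ i / 2 - fst p $ i * fst (zeta s) $ i)"
    by (rule sum_mono, rule pt, rule py) simp
  finally have s1: "D * Sy - real N * (2 * D\<^sup>2) \<le>
      (\<Sum>i<N. fst (zeta s) $ i * fst (zeta s) $ i / 2 - fst p $ i * fst (zeta s) $ i)" .
  have "D * Sz - real N * (2 * D\<^sup>2) = (\<Sum>i<N. D * \<bar>snd (zeta s) $ i\<bar> - 2 * D\<^sup>2)"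
    by (simp add: sum_subtractf sum_distrib_left Sz_def)
  also have "\<dots> \<le> (\<Sum>i<N. snd (zeta s) $ i * snd (zeta s) $ i / 2 - snd p $ i * snd (zeta s) $ i)"
    by (rule sum_mono, rule pt, rule pz) simp
  finally have s2: "D * Sz - real N * (2 * D\<^sup>2) \<le>
      (\<Sum>i<N. snd (zeta s) $ i * snd (zeta s) $ i / 2 - snd p $ i * snd (zeta s) $ i)" .
  have "D * Sy - real N * (2 * D\<^sup>2) + (D * Sz - real N * (2 * D\<^sup>2)) \<le> 0"
    by (rule order_trans[OF add_mono[OF s1 s2] *])
  moreover have "D * Sy - real N * (2 * D\<^sup>2) + (D * Sz - real N * (2 * D\<^sup>2)) =
      D * (Sy + Sz) - D * (4 * real N * D)"
    by (simp add: power2_eq_square algebra_simps)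
  ultimately have "D * (Sy + Sz) \<le> D * (4 * real N * D)" by simp
  then have "Sy + Sz \<le> 4 * real N * D" using D(2) by (rule mult_left_le_imp_le)
  moreover have "Sy = weight s * (\<Sum>i<N. \<bar>row_mass N (Xhat s) i - rt $ i\<bar>)"
    using w by (simp add: Sy_def zy resid_def abs_mult abs_minus_commute sum_distrib_left)
  moreover have "Sz = weight s * (\<Sum>j<N. \<bar>col_mass N (Xhat s) j - ct $ j\<bar>)"
    using w by (simp add: Sz_def zz resid_def abs_mult abs_minus_commute sum_distrib_left)
  ultimately show ?thesis by (simp add: distrib_left)
qed

end

section \<open>The perturbed marginals\<close>

lemma smooth_marginal_entry:
  assumes "v \<in> carrier_vec N" "i < N" "e < 8"
  shows "smooth_marginal N e v $ i = (1 - e / 8) * v $ i + e / (8 * real N)"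
proof -
  have "smooth_marginal N e v $ i = (1 - e / 8) * (v $ i + e / (real N * (8 - e)))"
    using assms by (simp add: smooth_marginal_def ones_def)
  also have "\<dots> = (1 - e / 8) * v $ i + (8 - e) / 8 * (e / (real N * (8 - e)))"
    by (simp add: distrib_left diff_divide_distrib)
  also have "(8 - e) / 8 * (e / (real N * (8 - e))) = e / (8 * real N)"
    using assms by simp
  finally show ?thesis .
qed

lemma vnorm_square: "v \<in> carrier_vec N \<Longrightarrow> (vnorm v)\<^sup>2 = (\<Sum>i<N. (v $ i)\<^sup>2)"
  by (simp add: vnorm_def scalar_prod_def atLeast0LessThan sum_nonneg flip: power2_eq_square)

lemma vnorm_nonneg: "0 \<le> vnorm v"
  by (simp add: vnorm_def scalar_prod_def sum_nonneg)

locale sinkhorn =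
  fixes N :: nat and r c :: "real vec" and C :: "real mat" and \<epsilon> :: real
  assumes N_ge_2: "2 \<le> N" and r: "r \<in> prob_simplex N" and c: "c \<in> prob_simplex N"
    and cost_carrier: "C \<in> carrier_mat N N"
    and cost_nonneg: "\<And>i j. i < N \<Longrightarrow> j < N \<Longrightarrow> 0 \<le> C $$ (i, j)"
    and max_norm_pos: "0 < max_norm C" and eps_pos: "0 < \<epsilon>" and eps_prime_small: "eps_prime C \<epsilon> < 8"
begin

abbreviation "M \<equiv> max_norm C"
abbreviation "e' \<equiv> eps_prime C \<epsilon>"

lemma rc_props:
  "r \<in> carrier_vec N" "c \<in> carrier_vec N" "\<And>i. i < N \<Longrightarrow> 0 \<le> r $ i" "\<And>i. i < N \<Longrightarrow> 0 \<le> c $ i"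
  "(\<Sum>i<N. r $ i) = 1" "(\<Sum>i<N. c $ i) = 1"
  using r c by (simp_all add: prob_simplex_iff)

lemma e'_pos: "0 < e'"
  using max_norm_pos eps_pos by (simp add: eps_prime_def)

lemma M_e': "M * e' = \<epsilon> / 8"
  using max_norm_pos by (simp add: eps_prime_def)

lemma smooth_props:
  assumes v: "v \<in> carrier_vec N" "\<And>i. i < N \<Longrightarrow> 0 \<le> v $ i" "(\<Sum>i<N. v $ i) = 1"
  shows "smooth_marginal N e' v \<in> carrier_vec N"
    "\<And>i. i < N \<Longrightarrow> e' / (8 * real N) \<le> smooth_marginal N e' v $ i"
    "(\<Sum>i<N. smooth_marginal N e' v $ i) = 1"
    "(\<Sum>i<N. \<bar>smooth_marginal N e' v $ i - v $ i\<bar>) \<le> e' / 4"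
proof -
  show "smooth_marginal N e' v \<in> carrier_vec N" using v by (simp add: smooth_marginal_def ones_def)
  note entry = smooth_marginal_entry[OF v(1) _ eps_prime_small]
  show "e' / (8 * real N) \<le> smooth_marginal N e' v $ i" if "i < N" for i
    using v(2)[OF that] eps_prime_small by (simp add: entry[OF that])
  have N0: "real N * (e' / (8 * real N)) = e' / 8" using N_ge_2 by simp
  have "(\<Sum>i<N. smooth_marginal N e' v $ i) = (1 - e' / 8) * (\<Sum>i<N. v $ i) + real N * (e' / (8 * real N))"
    by (simp add: entry sum.distrib sum_distrib_left)
  then show "(\<Sum>i<N. smooth_marginal N e' v $ i) = 1" using N0 v(3) by simp
  have "\<bar>smooth_marginal N e' v $ i - v $ i\<bar> \<le> e' / (8 * real N) + e' / 8 * v $ i" if "i < N" for i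
  proof -
    have "0 \<le> e' / 8 * v $ i" "0 \<le> e' / (8 * real N)" using v(2)[OF that] e'_pos by simp_all
    moreover have "smooth_marginal N e' v $ i - v $ i = e' / (8 * real N) - e' / 8 * v $ i"
      by (simp add: entry[OF that] left_diff_distrib)
    ultimately show ?thesis by linarith
  qed
  then have "(\<Sum>i<N. \<bar>smooth_marginal N e' v $ i - v $ i\<bar>) \<le> (\<Sum>i<N. e' / (8 * real N) + e' / 8 * v $ i)"
    by (intro sum_mono) simp
  also have "\<dots> = real N * (e' / (8 * real N)) + e' / 8 * (\<Sum>i<N. v $ i)"
    by (simp add: sum.distrib sum_distrib_left)
  also have "\<dots> = e' / 4" using N0 v(3) by simp
  finally show "(\<Sum>i<N. \<bar>smooth_marginal N e' v $ i - v $ i\<bar>) \<le> e' / 4" .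
qed

lemma min_marginal_pos: "0 < e' / (8 * real N)"
  using e'_pos N_ge_2 by simp

lemma ln_N_ge: "1 / 2 \<le> ln (real N)"
proof -
  have "ln 2 \<le> ln (real N)" using N_ge_2 by simp
  moreover have "ln (1 / 2 :: real) \<le> 1 / 2 - 1" by (rule ln_le_minus_one) simp
  ultimately show ?thesis by (simp add: ln_div)
qed

lemma reg_gamma_pos: "0 < reg_gamma N \<epsilon>"
  using ln_N_ge eps_pos by (simp add: reg_gamma_def)

sublocale entropic_dual N "reg_gamma N \<epsilon>" C "smooth_marginal N e' r" "smooth_marginal N e' c"
proof
  show "0 < N" using N_ge_2 by simp
  show "0 < smooth_marginal N e' r $ i" if "i < N" for i
    by (rule less_le_trans[OF min_marginal_pos smooth_props(2)[OF rc_props(1,3,5) that]])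
  show "0 < smooth_marginal N e' c $ i" if "i < N" for i
    by (rule less_le_trans[OF min_marginal_pos smooth_props(2)[OF rc_props(2,4,6) that]])
  show "smooth_marginal N e' r \<in> carrier_vec N" "(\<Sum>i<N. smooth_marginal N e' r $ i) = 1"
    using smooth_props(1,3)[OF rc_props(1,3,5)] by blast+
  show "smooth_marginal N e' c \<in> carrier_vec N" "(\<Sum>i<N. smooth_marginal N e' c $ i) = 1"
    using smooth_props(1,3)[OF rc_props(2,4,6)] by blast+
qed (rule reg_gamma_pos cost_carrier)+

abbreviation "rt \<equiv> smooth_marginal N e' r"
abbreviation "ct \<equiv> smooth_marginal N e' c"

lemma ot_phi_eq: "ot_phi N r c C \<epsilon> = phi"
  by (simp add: ot_phi_def)

lemma cost_le: "i < N \<Longrightarrow> j < N \<Longrightarrow> C $$ (i, j) \<le> M"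
proof -
  assume "i < N" "j < N"
  have "{\<bar>C $$ (i, j)\<bar> | i j. i < dim_row C \<and> j < dim_col C} = (\<lambda>(i, j). \<bar>C $$ (i, j)\<bar>) ` ({..<N} \<times> {..<N})"
    by auto
  then have "\<bar>C $$ (i, j)\<bar> \<le> M"
    unfolding max_norm_def using \<open>i < N\<close> \<open>j < N\<close> by (intro Max_ge) auto
  then show ?thesis by linarith
qed

lemma mat_inner_eq: "mat_inner C X = (\<Sum>i<N. \<Sum>j<N. C $$ (i, j) * X $$ (i, j))"
  by (simp add: mat_inner_def)

definition infeas :: "real mat \<Rightarrow> real" where
  "infeas X = (\<Sum>i<N. \<bar>row_mass N X i - rt $ i\<bar>) + (\<Sum>j<N. \<bar>col_mass N X j - ct $ j\<bar>)"

lemma awr_round_carrier: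
  assumes "X \<in> plans N"
  shows "awr_round N r c X \<in> carrier_mat N N"
  using awr_round_correct(1)[OF r c assms] by (simp add: transport_polytope_def)

lemma mat_inner_diff:
  assumes "X \<in> carrier_mat N N" "Y \<in> carrier_mat N N"
  shows "mat_inner C (Y - X) = mat_inner C Y - mat_inner C X"
  using assms by (simp add: mat_inner_eq right_diff_distrib sum_subtractf)

text \<open>
  The perturbation moves the two marginals by at most \<open>\<epsilon>' / 4\<close> each, which costs \<open>|C| \<epsilon>' / 2 = \<epsilon> / 16\<close>.
\<close>

lemma rounding_cost:
  assumes X: "X \<in> plans N"
  shows "mat_inner C (awr_round N r c X - X) \<le> M * infeas X + \<epsilon> / 16"
proof -
  let ?G = "awr_round N r c X"
  have Xc: "X \<in> carrier_mat N N" using X by (simp add: plans_def)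
  have "mat_inner C (?G - X) = (\<Sum>i<N. \<Sum>j<N. C $$ (i, j) * (?G $$ (i, j) - X $$ (i, j)))"
    unfolding mat_inner_eq using Xc awr_round_carrier[OF X] by simp
  also have "\<dots> \<le> (\<Sum>i<N. \<Sum>j<N. M * \<bar>?G $$ (i, j) - X $$ (i, j)\<bar>)"
  proof (rule sum_mono, rule sum_mono)
    fix i j assume "i \<in> {..<N}" "j \<in> {..<N}"
    then have ij: "i < N" "j < N" by simp_all
    have "C $$ (i, j) * (?G $$ (i, j) - X $$ (i, j)) \<le> C $$ (i, j) * \<bar>?G $$ (i, j) - X $$ (i, j)\<bar>"
      using cost_nonneg[OF ij] by (rule mult_left_mono[OF abs_ge_self])
    also have "\<dots> \<le> M * \<bar>?G $$ (i, j) - X $$ (i, j)\<bar>"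
      using cost_le[OF ij] by (rule mult_right_mono) simp
    finally show "C $$ (i, j) * (?G $$ (i, j) - X $$ (i, j)) \<le> M * \<bar>?G $$ (i, j) - X $$ (i, j)\<bar>" .
  qed
  also have "\<dots> = M * (\<Sum>i<N. \<Sum>j<N. \<bar>?G $$ (i, j) - X $$ (i, j)\<bar>)"
    by (simp add: sum_distrib_left)
  also have "\<dots> \<le> M * (infeas X + e' / 2)"
  proof (rule mult_left_mono)
    have "(\<Sum>i<N. \<bar>row_mass N X i - r $ i\<bar>) \<le> (\<Sum>i<N. \<bar>row_mass N X i - rt $ i\<bar> + \<bar>rt $ i - r $ i\<bar>)"
      by (rule sum_mono) linarith
    moreover have "(\<Sum>i<N. \<bar>col_mass N X i - c $ i\<bar>) \<le> (\<Sum>i<N. \<bar>col_mass N X i - ct $ i\<bar> + \<bar>ct $ i - c $ i\<bar>)"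
      by (rule sum_mono) linarith
    ultimately show "(\<Sum>i<N. \<Sum>j<N. \<bar>?G $$ (i, j) - X $$ (i, j)\<bar>) \<le> infeas X + e' / 2"
      using awr_round_correct(2)[OF r c X] smooth_props(4)[OF rc_props(1,3,5)] smooth_props(4)[OF rc_props(2,4,6)]
      unfolding infeas_def sum.distrib by linarith
  qed (use max_norm_pos in simp)
  also have "\<dots> = M * infeas X + \<epsilon> / 16"
    using M_e' by (simp add: distrib_left)
  finally show ?thesis .
qed

section \<open>Iteration bound\<close>

abbreviation "rate \<equiv> sqrt (real N) * sqrt (ln (real N)) * M / \<epsilon>"

lemma eps_lt: "\<epsilon> < 64 * M"
  using eps_prime_small max_norm_pos by (simp add: eps_prime_def field_simps)

lemma rate_ge: "1 / 64 \<le> rate"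
proof -
  have "1 \<le> real N * ln (real N)"
    using mult_mono[of 2 "real N" "1 / 2" "ln (real N)"] N_ge_2 ln_N_ge by simp
  then have "1 \<le> sqrt (real N) * sqrt (ln (real N))"
    by (metis real_sqrt_ge_1_iff real_sqrt_mult)
  then have "M * 1 \<le> M * (sqrt (real N) * sqrt (ln (real N)))"
    using max_norm_pos by (intro mult_left_mono) simp_all
  then have "M / \<epsilon> \<le> M * (sqrt (real N) * sqrt (ln (real N))) / \<epsilon>"
    using eps_pos by (intro divide_right_mono) simp_all
  moreover have "1 / 64 \<le> M / \<epsilon>" using eps_lt eps_pos by (simp add: field_simps)
  ultimately have "1 / 64 \<le> M * (sqrt (real N) * sqrt (ln (real N))) / \<epsilon>" by linarith
  then show ?thesis by (simp only: mult_ac)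
qed

text \<open>
  The smallest perturbed marginal is at least \<open>\<epsilon>' / (8 N) = \<epsilon> / (64 M N)\<close>. In \<open>\<gamma> ln (64 M N / \<epsilon>)\<close> the part
  \<open>\<gamma> ln N\<close> equals \<open>\<epsilon> / 3\<close>, and the rest is absorbed by \<open>\<epsilon> ln (64 M / \<epsilon>) \<le> 64 M\<close>. So the radius carries no
  logarithm.
\<close>

lemma dual_radius:
  defines "D \<equiv> M - reg_gamma N \<epsilon> * ln (e' / (8 * real N))"
  shows "0 < D" "D \<le> 66 * M"
proof -
  define L where "L = ln (real N)"
  define t where "t = ln (64 * M / \<epsilon>)"
  have L: "1 / 2 \<le> L" using ln_N_ge by (simp add: L_def)
  have pos: "0 < 64 * M / \<epsilon>" using max_norm_pos eps_pos by simp
  have "e' / (8 * real N) = inverse (64 * M / \<epsilon> * real N)"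
    using max_norm_pos by (simp add: eps_prime_def)
  then have lnm: "ln (e' / (8 * real N)) = - (t + L)"
    using pos N_ge_2 by (simp only: ln_inverse ln_mult_pos t_def L_def)
  have D: "D = M + \<epsilon> / (3 * L) * (t + L)"
    unfolding D_def reg_gamma_def L_def[symmetric] lnm mult_minus_right by simp
  have t0: "0 \<le> t" using eps_lt eps_pos by (simp add: t_def)
  have "t \<le> 64 * M / \<epsilon>" using ln_le_minus_one[OF pos] by (simp add: t_def)
  then have t: "\<epsilon> * t \<le> 64 * M" using eps_pos by (simp add: field_simps)
  have "0 \<le> \<epsilon> / (3 * L) * (t + L)" using t0 L eps_pos by simp
  then show "0 < D" using D max_norm_pos by linarith
  have "\<epsilon> / (3 * L) * (t + L) = \<epsilon> * t / (3 * L) + \<epsilon> / 3"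
    using L by (simp add: field_simps)
  moreover have "\<epsilon> * t / (3 * L) \<le> 64 * M / (3 * (1 / 2))"
    using t L t0 eps_pos max_norm_pos by (intro frac_le) simp_all
  ultimately show "D \<le> 66 * M" using D eps_lt max_norm_pos by simp
qed

text \<open>
  The gap test holds by the invariant, so an unfinished iterate has infeasibility at least
  \<open>5 \<epsilon> / (48 M)\<close>. This bounds its weight from above, and the growth of the weight bounds \<open>k\<close>.
\<close>

lemma unfinished_iterations:
  assumes inv: "accel_inv k s" and k: "0 < k" and rounded: "rounded s = awr_round N r c (Xhat s)"
    and unfinished: "\<not> acc_stops N r c C \<epsilon> s"
  shows "real k \<le> 350 * rate"
proof -
  let ?g = "reg_gamma N \<epsilon>" and ?m = "e' / (8 * real N)" and ?w = "weight s"
  note gap = accel_inv_gap[OF inv k]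
  have "reg_obj ?g C (Xhat s) + ot_phi N r c C \<epsilon> (eta s) \<le> \<epsilon> / 6"
    unfolding ot_phi_eq using gap(2) eps_pos by linarith
  then have "\<epsilon> / 6 < mat_inner C (rounded s - Xhat s)"
    using unfinished unfolding acc_stops_def by linarith
  then have I: "5 / 48 * \<epsilon> < M * infeas (Xhat s)"
    using rounding_cost[OF gap(1)] unfolding rounded by linarith
  have "?w * infeas (Xhat s) \<le> 4 * real N * (M - ?g * ln ?m)"
    unfolding infeas_def
    by (rule accel_inv_infeasibility[OF inv k _ min_marginal_pos smooth_props(2)[OF rc_props(1,3,5)]
          smooth_props(2)[OF rc_props(2,4,6)] refl dual_radius(1)]) (simp add: cost_nonneg cost_le)
  also have "\<dots> \<le> 4 * real N * (66 * M)" using dual_radius(2) by (intro mult_left_mono) simp_all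
  finally have "M * (?w * infeas (Xhat s)) \<le> M * (4 * real N * (66 * M))"
    using max_norm_pos by (intro mult_left_mono) simp_all
  moreover have "?w * (5 / 48 * \<epsilon>) \<le> ?w * (M * infeas (Xhat s))"
    using I gap(3) by (intro mult_left_mono) simp_all
  ultimately have w: "?w * (5 / 48 * \<epsilon>) \<le> M * (4 * real N * (66 * M))" by (simp only: mult_ac)
  define L where "L = ln (real N)"
  have L: "0 < L" using ln_N_ge by (simp add: L_def)
  have g: "?g = \<epsilon> / (3 * L)" by (simp add: reg_gamma_def L_def)
  have "\<epsilon> / (3 * L) * (real k)\<^sup>2 / 16 * (5 / 48 * \<epsilon>) \<le> ?w * (5 / 48 * \<epsilon>)"
    using accel_invD(6)[OF inv] eps_pos unfolding g by (intro mult_right_mono) simp_all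
  then have "\<epsilon> / (3 * L) * (real k)\<^sup>2 / 16 * (5 / 48 * \<epsilon>) \<le> M * (4 * real N * (66 * M))"
    using w by linarith
  then have "\<epsilon>\<^sup>2 * (real k)\<^sup>2 * 5 \<le> M\<^sup>2 * (4 * real N * 66) * (3 * L * 16 * 48)"
    using L by (simp add: field_simps power2_eq_square)
  then have "(\<epsilon> * real k)\<^sup>2 \<le> 122500 * (real N * L * M\<^sup>2)"
    using L by (simp add: power_mult_distrib) (smt (verit) mult_nonneg_nonneg zero_le_power2 of_nat_0_le_iff mult.commute mult.left_commute)
  \<comment> \<open>The constants above multiply to \<open>4 * 66 * 3 * 16 * 48 / 5\<close>, which is less than \<open>350\<^sup>2\<close>.\<close>
  also have "\<dots> = (350 * (sqrt (real N) * sqrt L * M))\<^sup>2"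
    using L by (simp add: power_mult_distrib)
  finally have "\<epsilon> * real k \<le> 350 * (sqrt (real N) * sqrt L * M)"
    by (rule power2_le_imp_le) (use L max_norm_pos in simp)
  then show ?thesis using eps_pos by (simp add: L_def field_simps)
qed

text \<open>
  The state reached when the gradient vanishes: the Gibbs plan then satisfies the perturbed constraints
  and has no duality gap, so the next test stops the run.
\<close>

definition exact_state :: "acc_state \<Rightarrow> bool" where
  "exact_state s \<longleftrightarrow> Xhat s \<in> plans N \<and> infeas (Xhat s) = 0 \<and> phi (eta s) + entr (Xhat s) \<le> 0"

lemma exact_state_stops:
  assumes "exact_state s" "rounded s = awr_round N r c (Xhat s)"
  shows "acc_stops N r c C \<epsilon> s"
proof -
  have "mat_inner C (awr_round N r c (Xhat s) - Xhat s) \<le> \<epsilon> / 16"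
    using rounding_cost[of "Xhat s"] assms(1) by (simp add: exact_state_def)
  then show ?thesis
    using assms eps_pos by (simp add: acc_stops_def ot_phi_eq exact_state_def)
qed

lemma sq_resid: "pair_inner N g g = (\<Sum>i<N. (fst g $ i)\<^sup>2) + (\<Sum>i<N. (snd g $ i)\<^sup>2)"
  by (simp add: pair_inner_def power2_eq_square)

lemma resid_norms:
  assumes "g = resid X"
  shows "(vnorm (fst g))\<^sup>2 = (\<Sum>i<N. (fst g $ i)\<^sup>2)" "(vnorm (snd g))\<^sup>2 = (\<Sum>i<N. (snd g $ i)\<^sup>2)"
  using assms by (simp_all add: vnorm_square resid_def)

lemma resid_norm: "g = resid X \<Longrightarrow> pair_inner N g g = (vnorm (fst g))\<^sup>2 + (vnorm (snd g))\<^sup>2"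
  unfolding resid_norms by (rule sq_resid)

lemma resid_zero_iff:
  assumes g: "g = resid X"
  shows "pair_inner N g g \<le> 0 \<longleftrightarrow> fst g = 0\<^sub>v N \<and> snd g = 0\<^sub>v N"
proof
  assume le: "pair_inner N g g \<le> 0"
  have "(vnorm (fst g))\<^sup>2 = 0" "(vnorm (snd g))\<^sup>2 = 0"
    using le zero_le_power2[of "vnorm (fst g)"] zero_le_power2[of "vnorm (snd g)"]
    unfolding resid_norm[OF g] by linarith+
  then have "\<forall>i<N. fst g $ i = 0" "\<forall>i<N. snd g $ i = 0"
    unfolding resid_norms[OF g] by (simp_all add: sum_nonneg_eq_0_iff)
  moreover have "fst g \<in> carrier_vec N" "snd g \<in> carrier_vec N" by (simp_all add: g resid_def)
  ultimately show "fst g = 0\<^sub>v N \<and> snd g = 0\<^sub>v N" by (auto intro!: eq_vecI)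
next
  assume "fst g = 0\<^sub>v N \<and> snd g = 0\<^sub>v N"
  then show "pair_inner N g g \<le> 0" by (simp add: pair_inner_def)
qed

text \<open>
  The block with the larger gradient carries at least half of the squared norm, which turns the factor
  \<open>\<gamma> / 4\<close> of a single block into \<open>\<gamma> / 8\<close>. An arbitrary block minimizer does as well as the explicit one.
\<close>

lemma block_descent:
  assumes lp: "lam \<in> points N" and g: "g = resid (plan lam)"
    and blk: "vnorm (snd g) \<le> vnorm (fst g) \<and> is_arg_min phi (\<lambda>p. fst p \<in> carrier_vec N \<and> snd p = snd lam) p' \<or>
        vnorm (fst g) \<le> vnorm (snd g) \<and> is_arg_min phi (\<lambda>p. fst p = fst lam \<and> snd p \<in> carrier_vec N) p'"
  shows "p' \<in> points N \<and> phi p' \<le> phi lam - reg_gamma N \<epsilon> / 8 * pair_inner N g g"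
  using blk
proof
  assume b: "vnorm (snd g) \<le> vnorm (fst g) \<and> is_arg_min phi (\<lambda>p. fst p \<in> carrier_vec N \<and> snd p = snd lam) p'"
  then have "(vnorm (snd g))\<^sup>2 \<le> (vnorm (fst g))\<^sup>2" using vnorm_nonneg by (intro power_mono) blast+
  then have "reg_gamma N \<epsilon> / 8 * pair_inner N g g \<le> reg_gamma N \<epsilon> / 8 * (2 * (vnorm (fst g))\<^sup>2)"
    unfolding resid_norm[OF g] using reg_gamma_pos by (intro mult_left_mono) simp_all
  also have "\<dots> \<le> phi lam - phi (min_y lam)"
    using min_y_decrease[of lam, folded g, folded resid_norms[OF g]] by simp
  finally have "phi (min_y lam) \<le> phi lam - reg_gamma N \<epsilon> / 8 * pair_inner N g g" by linarith
  moreover have "phi p' \<le> phi (min_y lam)"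
    using b min_y_is_arg_min[OF lp] unfolding is_arg_min_linorder by blast
  moreover have "p' \<in> points N"
    using b lp unfolding is_arg_min_linorder points_def mem_Times_iff by metis
  ultimately show ?thesis by linarith
next
  assume b: "vnorm (fst g) \<le> vnorm (snd g) \<and> is_arg_min phi (\<lambda>p. fst p = fst lam \<and> snd p \<in> carrier_vec N) p'"
  then have "(vnorm (fst g))\<^sup>2 \<le> (vnorm (snd g))\<^sup>2" using vnorm_nonneg by (intro power_mono) blast+
  then have "reg_gamma N \<epsilon> / 8 * pair_inner N g g \<le> reg_gamma N \<epsilon> / 8 * (2 * (vnorm (snd g))\<^sup>2)"
    unfolding resid_norm[OF g] using reg_gamma_pos by (intro mult_left_mono) simp_all
  also have "\<dots> \<le> phi lam - phi (min_z lam)"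
    using min_z_decrease[of lam, folded g, folded resid_norms[OF g]] by simp
  finally have "phi (min_z lam) \<le> phi lam - reg_gamma N \<epsilon> / 8 * pair_inner N g g" by linarith
  moreover have "phi p' \<le> phi (min_z lam)"
    using b min_z_is_arg_min[OF lp] unfolding is_arg_min_linorder by blast
  moreover have "p' \<in> points N"
    using b lp unfolding is_arg_min_linorder points_def mem_Times_iff by metis
  ultimately show ?thesis by linarith
qed

lemma acc_step_cases:
  assumes inv: "accel_inv k s" and step: "acc_step N r c C \<epsilon> s s'"
  shows "accel_inv (Suc k) s' \<or> exact_state s'" "rounded s' = awr_round N r c (Xhat s')"
proof -
  note es = accel_invD(1)[OF inv] and zs = accel_invD(2)[OF inv]
  obtain \<beta> lam gy gz a where
      lmin: "is_line_min phi (eta s) (zeta s) \<beta>" and lam: "lam = segment (eta s) (zeta s) \<beta>"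
    and gy': "gy = grad_y phi lam" and gz': "gz = grad_z phi lam"
    and blk: "vnorm gz \<le> vnorm gy \<and> is_arg_min phi (\<lambda>p. fst p \<in> carrier_vec N \<and> snd p = snd lam) (eta s') \<or>
        vnorm gy \<le> vnorm gz \<and> is_arg_min phi (\<lambda>p. fst p = fst lam \<and> snd p \<in> carrier_vec N) (eta s')"
    and a: "0 < a" and weight': "weight s' = weight s + a"
    and root: "phi lam - a\<^sup>2 / (2 * weight s') * ((vnorm gy)\<^sup>2 + (vnorm gz)\<^sup>2) = phi (eta s')"
    and zeta': "zeta s' = (fst (zeta s) - a \<cdot>\<^sub>v gy, snd (zeta s) - a \<cdot>\<^sub>v gz)"
    and Xhat': "Xhat s' = (if gy = 0\<^sub>v N \<and> gz = 0\<^sub>v N then plan lam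
          else (1 / weight s') \<cdot>\<^sub>m (a \<cdot>\<^sub>m plan lam + weight s \<cdot>\<^sub>m Xhat s))"
    and rd: "rounded s' = awr_round N r c (Xhat s')"
    using step unfolding acc_step_def Let_def ot_phi_eq by blast
  show "rounded s' = awr_round N r c (Xhat s')" by (rule rd)
  have lp: "lam \<in> points N" unfolding lam by (rule segment_points[OF es zs])
  define g where "g = resid (plan lam)"
  have gy: "gy = fst g" and gz: "gz = snd g" unfolding gy' gz' g_def using grad_phi[OF lp] by blast+
  have gc: "fst g \<in> carrier_vec N" "snd g \<in> carrier_vec N" by (simp_all add: g_def resid_def)
  have norms: "(vnorm gy)\<^sup>2 = (\<Sum>i<N. (fst g $ i)\<^sup>2)" "(vnorm gz)\<^sup>2 = (\<Sum>i<N. (snd g $ i)\<^sup>2)"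
    unfolding gy gz using gc by (simp_all add: vnorm_square)
  have gg: "pair_inner N g g = (vnorm gy)\<^sup>2 + (vnorm gz)\<^sup>2" unfolding gy gz by (rule resid_norm[OF g_def])
  show "accel_inv (Suc k) s' \<or> exact_state s'"
  proof (cases "gy = 0\<^sub>v N \<and> gz = 0\<^sub>v N")
    case True
    have "infeas (plan lam) = (\<Sum>i<N. \<bar>fst g $ i\<bar>) + (\<Sum>i<N. \<bar>snd g $ i\<bar>)"
      by (simp add: infeas_def g_def resid_def abs_minus_commute)
    moreover have z: "fst g $ i = 0" "snd g $ i = 0" if "i < N" for i
      using True that unfolding gy gz by simp_all
    ultimately have "infeas (plan lam) = 0" by simp
    moreover have "pair_inner N lam g = 0" using z by (simp add: pair_inner_def)
    then have "phi lam + entr (plan lam) = 0" by (simp add: strong_duality g_def)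
    moreover have "(vnorm gy)\<^sup>2 + (vnorm gz)\<^sup>2 = 0" unfolding norms using z by simp
    then have "phi lam = phi (eta s')" using root by simp
    ultimately have "exact_state s'" using True plan_plans by (simp add: exact_state_def Xhat')
    then show ?thesis ..
  next
    case False
    then have g_pos: "0 < pair_inner N g g" using resid_zero_iff[OF g_def] unfolding gy gz by linarith
    have descent: "eta s' \<in> points N \<and> phi (eta s') \<le> phi lam - reg_gamma N \<epsilon> / 8 * pair_inner N g g"
      by (rule block_descent[OF lp g_def blk[unfolded gy gz]])
    have Xf: "Xhat s' = (1 / weight s') \<cdot>\<^sub>m (a \<cdot>\<^sub>m plan lam + weight s \<cdot>\<^sub>m Xhat s)"
      using Xhat' False by simp
    have "accel_inv (Suc k) s'"
      by (rule accel_inv_step[OF inv lmin lam g_def g_pos a conjunct1[OF descent] weight'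
            root[folded gg] conjunct2[OF descent] zeta'[unfolded gy gz] Xf])
    then show ?thesis ..
  qed
qed

text \<open>
  Every state before the last one is unfinished or initial, so it satisfies the invariant and its index is
  bounded; the last step adds one.
\<close>

lemma acc_run_inv:
  assumes "acc_run N r c C \<epsilon> k s"
  shows "(accel_inv k s \<or> 0 < k \<and> exact_state s) \<and>
    (0 < k \<longrightarrow> rounded s = awr_round N r c (Xhat s)) \<and> real k \<le> 350 * rate + 1"
  using assms
proof (induction rule: acc_run.induct)
  case start
  then show ?case using accel_inv_init rate_ge by simp
next
  case (iterate k s s')
  have inv: "accel_inv k s"
    using iterate exact_state_stops[of s] by blast
  have "real k \<le> 350 * rate"
    using unfinished_iterations[OF inv] iterate rate_ge by (cases "k = 0") auto
  then show ?case using acc_step_cases[OF inv iterate(3)] by simp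
qed

lemma acc_run_bound:
  assumes "acc_run N r c C \<epsilon> k s"
  shows "real k \<le> 500 * rate"
  using acc_run_inv[OF assms] rate_ge by linarith

lemma unfinished_run_inv:
  assumes "acc_run N r c C \<epsilon> k s" "k = 0 \<or> \<not> acc_stops N r c C \<epsilon> s"
  shows "accel_inv k s"
  using acc_run_inv[OF assms(1)] assms(2) exact_state_stops[of s] by blast

section \<open>Accuracy of the returned plan\<close>

lemma plans_entry_le_1:
  assumes "X \<in> plans N" "i < N" "j < N"
  shows "X $$ (i, j) \<le> 1"
proof -
  have pos: "\<And>i j. i < N \<Longrightarrow> j < N \<Longrightarrow> 0 \<le> X $$ (i, j)" and one: "(\<Sum>i<N. \<Sum>j<N. X $$ (i, j)) = 1"
    using assms(1) by (simp_all add: plans_def)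
  have "X $$ (i, j) \<le> (\<Sum>j<N. X $$ (i, j))"
    using assms pos by (intro member_le_sum) simp_all
  also have "\<dots> \<le> (\<Sum>i<N. \<Sum>j<N. X $$ (i, j))"
    using assms pos by (intro member_le_sum[of i "{..<N}" "\<lambda>i. \<Sum>j<N. X $$ (i, j)"] sum_nonneg) simp_all
  finally show ?thesis using one by simp
qed

lemma entr_le_cost:
  assumes "X \<in> plans N"
  shows "entr X \<le> mat_inner C X"
proof -
  have Xc: "X \<in> carrier_mat N N" using assms by (simp add: plans_def)
  show ?thesis
    unfolding entr_eq[OF Xc] mat_inner_eq
  proof (rule sum_mono, rule sum_mono)
    fix i j assume "i \<in> {..<N}" "j \<in> {..<N}"
    then have "0 \<le> X $$ (i, j)" "X $$ (i, j) \<le> 1"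
      using assms plans_entry_le_1 by (simp_all add: plans_def)
    then have "X $$ (i, j) * ln (X $$ (i, j)) \<le> 0"
      by (cases "X $$ (i, j) = 0") (simp_all add: mult_nonneg_nonpos)
    then have "reg_gamma N \<epsilon> * (X $$ (i, j) * ln (X $$ (i, j))) \<le> 0"
      using reg_gamma_pos by (simp add: mult_nonneg_nonpos)
    then show "C $$ (i, j) * X $$ (i, j) + reg_gamma N \<epsilon> * (X $$ (i, j) * ln (X $$ (i, j))) \<le> C $$ (i, j) * X $$ (i, j)"
      by simp
  qed
qed

text \<open>
  The entropy of a plan on \<open>N\<^sup>2\<close> entries is at most \<open>2 ln N\<close>: relative entropy with respect to the uniform
  plan is nonnegative.
\<close>

lemma cost_le_entr:
  assumes "X \<in> plans N"
  shows "mat_inner C X \<le> entr X + 2 / 3 * \<epsilon>"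
proof -
  have Xc: "X \<in> carrier_mat N N" and one: "(\<Sum>i<N. \<Sum>j<N. X $$ (i, j)) = 1" using assms by (simp_all add: plans_def)
  define L where "L = ln (real N)"
  have L: "0 < L" using ln_N_ge by (simp add: L_def)
  have n: "(\<Sum>i<N. \<Sum>j<N. 1 / (real N)\<^sup>2) = 1" using N_ge_2 by (simp add: power2_eq_square)
  have lnn: "ln (1 / (real N)\<^sup>2) = - 2 * L" using N_ge_2 by (simp add: ln_div ln_realpow L_def)
  have "0 \<le> (\<Sum>i<N. \<Sum>j<N. X $$ (i, j) * (ln (X $$ (i, j)) - ln (1 / (real N)\<^sup>2)) - X $$ (i, j) + 1 / (real N)\<^sup>2)"
    using assms N_ge_2 by (intro sum_nonneg kl_term_nonneg) (simp_all add: plans_def)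
  also have "\<dots> = (\<Sum>i<N. \<Sum>j<N. X $$ (i, j) * ln (X $$ (i, j)) + X $$ (i, j) * (2 * L) - X $$ (i, j) + 1 / (real N)\<^sup>2)"
    unfolding lnn by (simp add: distrib_left)
  also have "\<dots> = (\<Sum>i<N. \<Sum>j<N. X $$ (i, j) * ln (X $$ (i, j))) + 2 * L"
    by (simp only: sum.distrib sum_subtractf n one sum_distrib_right[symmetric] mult_1_left diff_add_cancel)
  finally have "0 \<le> reg_gamma N \<epsilon> * ((\<Sum>i<N. \<Sum>j<N. X $$ (i, j) * ln (X $$ (i, j))) + 2 * L)"
    using reg_gamma_pos by simp
  moreover have "reg_gamma N \<epsilon> * (2 * L) = 2 / 3 * \<epsilon>" using L by (simp add: reg_gamma_def L_def)
  ultimately show ?thesis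
    unfolding entr_eq[OF Xc] mat_inner_eq by (simp add: sum.distrib distrib_left sum_distrib_left)
qed

text \<open>
  The perturbed marginals are the mixtures \<open>(1 - d) r + d 1 / N\<close> and \<open>(1 - d) c + d 1 / N\<close> with
  \<open>d = \<epsilon>' / 8\<close>, so mixing a plan with the uniform plan in the same proportion gives exactly these marginals.
\<close>

lemma smoothed_plan:
  assumes X: "X \<in> transport_polytope N r c"
  obtains Y where "Y \<in> plans N" "infeas Y = 0" "mat_inner C Y \<le> mat_inner C X + \<epsilon> / 64"
proof -
  have Xc: "X \<in> carrier_mat N N" and pos: "\<And>i j. i < N \<Longrightarrow> j < N \<Longrightarrow> 0 \<le> X $$ (i, j)"
    and row: "\<And>i. i < N \<Longrightarrow> row_mass N X i = r $ i" and col: "\<And>j. j < N \<Longrightarrow> col_mass N X j = c $ j"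
    using X unfolding transport_polytope_iff[OF rc_props(1,2)] by blast+
  define d where "d = e' / 8"
  have d: "0 < d" "d < 1" using e'_pos eps_prime_small by (simp_all add: d_def)
  define Y where "Y = mat N N (\<lambda>(i, j). (1 - d) * X $$ (i, j) + d / (real N)\<^sup>2)"
  have Ye: "Y $$ (i, j) = (1 - d) * X $$ (i, j) + d / (real N)\<^sup>2" if "i < N" "j < N" for i j
    using that by (simp add: Y_def)
  have Nd: "real N * (d / (real N)\<^sup>2) = e' / (8 * real N)" using N_ge_2 by (simp add: d_def power2_eq_square)
  have rowY: "row_mass N Y i = rt $ i" if "i < N" for i
  proof -
    have "row_mass N Y i = (1 - d) * row_mass N X i + real N * (d / (real N)\<^sup>2)"
      using that by (simp add: row_mass_def Ye sum.distrib sum_distrib_left)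
    then show ?thesis
      unfolding Nd smooth_marginal_entry[OF rc_props(1) that eps_prime_small] using row[OF that] by (simp add: d_def)
  qed
  have colY: "col_mass N Y j = ct $ j" if "j < N" for j
  proof -
    have "col_mass N Y j = (1 - d) * col_mass N X j + real N * (d / (real N)\<^sup>2)"
      using that by (simp add: col_mass_def Ye sum.distrib sum_distrib_left)
    then show ?thesis
      unfolding Nd smooth_marginal_entry[OF rc_props(2) that eps_prime_small] using col[OF that] by (simp add: d_def)
  qed
  have "(\<Sum>i<N. \<Sum>j<N. Y $$ (i, j)) = (\<Sum>i<N. rt $ i)" by (simp add: rowY flip: sum_row_mass)
  moreover have "0 \<le> Y $$ (i, j)" if "i < N" "j < N" for i j
    unfolding Ye[OF that] using pos[OF that] d by simp
  ultimately have YP: "Y \<in> plans N" by (simp add: plans_def rt_sum) (simp add: Y_def)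
  have "infeas Y = 0" by (simp add: infeas_def rowY colY)
  moreover have "mat_inner C Y \<le> mat_inner C X + \<epsilon> / 64"
  proof -
    have "mat_inner C Y \<le> (\<Sum>i<N. \<Sum>j<N. C $$ (i, j) * X $$ (i, j) + M * (d / (real N)\<^sup>2))"
      unfolding mat_inner_eq
    proof (rule sum_mono, rule sum_mono)
      fix i j assume "i \<in> {..<N}" "j \<in> {..<N}"
      then have ij: "i < N" "j < N" by simp_all
      have "0 \<le> d * (C $$ (i, j) * X $$ (i, j))" using d cost_nonneg[OF ij] pos[OF ij] by simp
      moreover have "C $$ (i, j) * (d / (real N)\<^sup>2) \<le> M * (d / (real N)\<^sup>2)"
        using cost_le[OF ij] d by (intro mult_right_mono) simp_all
      moreover have "C $$ (i, j) * Y $$ (i, j) =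
          C $$ (i, j) * X $$ (i, j) - d * (C $$ (i, j) * X $$ (i, j)) + C $$ (i, j) * (d / (real N)\<^sup>2)"
        unfolding Ye[OF ij] distrib_left left_diff_distrib right_diff_distrib by (simp only: mult_ac mult_1_left)
      ultimately show "C $$ (i, j) * Y $$ (i, j) \<le> C $$ (i, j) * X $$ (i, j) + M * (d / (real N)\<^sup>2)" by linarith
    qed
    also have "\<dots> = mat_inner C X + M * d"
      using N_ge_2 by (simp add: sum.distrib mat_inner_eq power2_eq_square)
    also have "M * d = \<epsilon> / 64" using M_e' by (simp add: d_def)
    finally show ?thesis .
  qed
  ultimately show ?thesis using YP that by blast
qed

text \<open>
  The errors are \<open>\<epsilon> / 6\<close> for rounding, \<open>2 \<epsilon> / 3\<close> for the entropy and \<open>\<epsilon> / 64\<close> for the perturbed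
  marginals. Their sum stays below \<open>\<epsilon>\<close> because the duality gap contributes nothing.
\<close>

lemma acc_returns_accurate:
  assumes ret: "acc_returns N r c C \<epsilon> k G"
    and opt: "is_arg_min (mat_inner C) (\<lambda>X. X \<in> transport_polytope N r c) Xs"
  shows "G \<in> transport_polytope N r c" "mat_inner C G - mat_inner C Xs \<le> \<epsilon>"
proof -
  obtain s where run: "acc_run N r c C \<epsilon> k s" and k: "0 < k" and stop: "acc_stops N r c C \<epsilon> s"
    and G: "G = rounded s"
    using ret unfolding acc_returns_def by blast
  have rd: "rounded s = awr_round N r c (Xhat s)" using acc_run_inv[OF run] k by blast
  have X: "Xhat s \<in> plans N" and gap: "phi (eta s) + entr (Xhat s) \<le> 0"
    using acc_run_inv[OF run] accel_inv_gap[OF _ k] unfolding exact_state_def by blast+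
  show "G \<in> transport_polytope N r c"
    unfolding G rd by (rule awr_round_correct(1)[OF r c X])
  have "Xs \<in> transport_polytope N r c" using opt by (simp add: is_arg_min_def)
  then obtain Y where Y: "Y \<in> plans N" "infeas Y = 0" "mat_inner C Y \<le> mat_inner C Xs + \<epsilon> / 64"
    by (rule smoothed_plan)
  have nn: "0 \<le> (\<Sum>i<N. \<bar>row_mass N Y i - rt $ i\<bar>)" "0 \<le> (\<Sum>j<N. \<bar>col_mass N Y j - ct $ j\<bar>)"
    by (simp_all add: sum_nonneg)
  then have "(\<Sum>i<N. \<bar>row_mass N Y i - rt $ i\<bar>) = 0" "(\<Sum>j<N. \<bar>col_mass N Y j - ct $ j\<bar>) = 0"
    using Y(2) unfolding infeas_def by linarith+
  then have "\<forall>i<N. row_mass N Y i = rt $ i" "\<forall>j<N. col_mass N Y j = ct $ j"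
    by (simp_all add: sum_nonneg_eq_0_iff)
  then have "pair_inner N (eta s) (resid Y) = 0" by (simp add: pair_inner_def resid_def)
  then have "- phi (eta s) \<le> entr Y" using weak_duality[OF Y(1), of "eta s"] by simp
  then have "entr (Xhat s) \<le> mat_inner C Xs + \<epsilon> / 64"
    using gap entr_le_cost[OF Y(1)] Y(3) by linarith
  then have "mat_inner C (Xhat s) \<le> mat_inner C Xs + \<epsilon> / 64 + 2 / 3 * \<epsilon>"
    using cost_le_entr[OF X] by linarith
  moreover have "mat_inner C G - mat_inner C (Xhat s) \<le> \<epsilon> / 6"
    using stop X awr_round_carrier[OF X] unfolding acc_stops_def G
    by (simp add: mat_inner_diff rd plans_def)
  ultimately show "mat_inner C G - mat_inner C Xs \<le> \<epsilon>" using eps_pos by linarith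
qed

end

section \<open>The program performs the iteration\<close>

lemma counted_simps:
  "fst (counted_bind m f) = fst (f (fst m))" "snd (counted_bind m f) = snd m + snd (f (fst m))"
  "fst (ret x) = x" "snd (ret x) = 0" "fst (cscal e) = aval e" "snd (cscal e) = aops e"
  "fst (cvec n g) = vec n (\<lambda>i. aval (g i))" "snd (cvec n g) = (\<Sum>i<n. aops (g i))"
  "fst (cmat n h) = mat n n (\<lambda>(i, j). aval (h i j))" "snd (cmat n h) = (\<Sum>i<n. \<Sum>j<n. aops (h i j))"
  "fst (cle a b) \<longleftrightarrow> aval a \<le> aval b" "snd (cle a b) = aops a + aops b + 1"
  by (simp_all add: counted_bind_def ret_def cscal_def cvec_def cmat_def cle_def)

lemma mat_cong: "(\<And>i j. i < n \<Longrightarrow> j < n \<Longrightarrow> f i j = g i j) \<Longrightarrow> mat n n (\<lambda>(i, j). f i j) = mat n n (\<lambda>(i, j). g i j)"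
  by (rule eq_matI) simp_all

lemma Max_Max:
  fixes f :: "nat \<Rightarrow> nat \<Rightarrow> real"
  assumes "0 < n"
  shows "Max ((\<lambda>i. Max ((\<lambda>j. f i j) ` {..<n})) ` {..<n}) = Max {f i j | i j. i < n \<and> j < n}"
proof (rule sym, rule Max_eqI)
  have eq: "{f i j | i j. i < n \<and> j < n} = (\<lambda>(i, j). f i j) ` ({..<n} \<times> {..<n})" by auto
  show "finite {f i j | i j. i < n \<and> j < n}" unfolding eq by simp
  show "y \<le> Max ((\<lambda>i. Max ((\<lambda>j. f i j) ` {..<n})) ` {..<n})" if y: "y \<in> {f i j | i j. i < n \<and> j < n}" for y
  proof -
    obtain i j where ij: "i < n" "j < n" "y = f i j" using y by blast
    have "y \<le> Max ((\<lambda>j. f i j) ` {..<n})" using ij by (intro Max_ge) simp_all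
    also have "\<dots> \<le> Max ((\<lambda>i. Max ((\<lambda>j. f i j) ` {..<n})) ` {..<n})" using ij by (intro Max_ge) simp_all
    finally show ?thesis .
  qed
  have "Max ((\<lambda>i. Max ((\<lambda>j. f i j) ` {..<n})) ` {..<n}) \<in> (\<lambda>i. Max ((\<lambda>j. f i j) ` {..<n})) ` {..<n}"
    using assms by (intro Max_in) (simp_all add: lessThan_empty_iff)
  then obtain i where i: "i < n" "Max ((\<lambda>i. Max ((\<lambda>j. f i j) ` {..<n})) ` {..<n}) = Max ((\<lambda>j. f i j) ` {..<n})"
    by blast
  have "Max ((\<lambda>j. f i j) ` {..<n}) \<in> (\<lambda>j. f i j) ` {..<n}"
    using assms by (intro Max_in) (simp_all add: lessThan_empty_iff)
  then show "Max ((\<lambda>i. Max ((\<lambda>j. f i j) ` {..<n})) ` {..<n}) \<in> {f i j | i j. i < n \<and> j < n}"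
    unfolding i(2) using i(1) by blast
qed

lemma segment_prog_correct:
  assumes "p \<in> points N" "p' \<in> points N"
  shows "fst (segment_prog N p p' \<beta>) = segment p p' \<beta>"
  using assms by (auto simp: segment_prog_def counted_simps segment_def points_def intro!: eq_vecI)

lemma (in entropic_dual) kernel_prog_correct:
  "fst (kernel_prog N C \<gamma> p) = mat N N (\<lambda>(i, j). kernel \<gamma> C p i j)"
  by (simp add: kernel_prog_def counted_simps kernel_def)

lemma sum_mat: "(\<Sum>i<N. \<Sum>j<N. mat N N (\<lambda>(i, j). f i j) $$ (i, j)) = (\<Sum>i<N. \<Sum>j<N. f i j)"
  by simp

context entropic_dual
begin

lemma gibbs_prog_correct: "fst (gibbs_prog N C \<gamma> p) = plan p"
  unfolding gibbs_prog_def counted_simps aval.simps kernel_prog_correct sum_mat gibbs_def dims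
  by (rule mat_cong) simp

lemma dual_prog_correct: "fst (dual_prog N C (\<gamma>, rt, ct) p) = phi p"
  unfolding dual_prog_def prod.case counted_simps aval.simps kernel_prog_correct sum_mat phi_eq Z_def ..

lemma block_y_prog_correct: "fst (block_y_prog N C (\<gamma>, rt, ct) p) = min_y p"
  unfolding block_y_prog_def prod.case counted_simps aval.simps min_y_def by simp

lemma block_z_prog_correct: "fst (block_z_prog N C (\<gamma>, rt, ct) p) = min_z p"
  unfolding block_z_prog_def prod.case counted_simps aval.simps min_z_eq by simp

end

lemma round_prog_correct:
  assumes F: "F \<in> carrier_mat N N" and rc: "r \<in> carrier_vec N" "c \<in> carrier_vec N"
  shows "fst (round_prog N r c F) = awr_round N r c F"
proof -
  define x where "x = vec N (\<lambda>i. min (r $ i / row_mass N F i) 1)"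
  define F1 where "F1 = mat N N (\<lambda>(i, j). x $ i * F $$ (i, j))"
  define y where "y = vec N (\<lambda>j. min (c $ j / col_mass N F1 j) 1)"
  define F2 where "F2 = mat N N (\<lambda>(i, j). F1 $$ (i, j) * y $ j)"
  define er where "er = vec N (\<lambda>i. r $ i - row_mass N F2 i)"
  define ec where "ec = vec N (\<lambda>j. c $ j - col_mass N F2 j)"
  have prog: "fst (round_prog N r c F) =
      mat N N (\<lambda>(i, j). F2 $$ (i, j) + er $ i * ec $ j / (\<Sum>i<N. \<bar>er $ i\<bar>))"
    unfolding round_prog_def counted_simps aval.simps
    by (simp only: row_mass_def[symmetric] col_mass_def[symmetric] x_def[symmetric] F1_def[symmetric]
        y_def[symmetric] F2_def[symmetric] er_def[symmetric] ec_def[symmetric])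
  have F1: "mat_diag N (\<lambda>i. min (r $ i / (F *\<^sub>v ones N) $ i) 1) * F = F1" "F1 \<in> carrier_mat N N"
    unfolding mat_diag_mult_left[OF F] mult_ones[OF F] F1_def x_def by (auto intro!: eq_matI)
  have F2: "F1 * mat_diag N (\<lambda>j. min (c $ j / (transpose_mat F1 *\<^sub>v ones N) $ j) 1) = F2" "F2 \<in> carrier_mat N N"
    unfolding mat_diag_mult_right[OF F1(2)] mult_ones[OF F1(2)] F2_def y_def by (auto intro!: eq_matI)
  have er: "r - F2 *\<^sub>v ones N = er" and ec: "c - transpose_mat F2 *\<^sub>v ones N = ec"
    unfolding mult_ones[OF F2(2)] er_def ec_def using rc by (auto intro!: eq_vecI)
  have norm: "vnorm1 er = (\<Sum>i<N. \<bar>er $ i\<bar>)" by (simp add: vnorm1_def er_def)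
  show ?thesis
    unfolding prog awr_round_def Let_def F1(1) F2(1) er ec norm
    using F2(2) by (intro eq_matI) simp_all
qed

context sinkhorn
begin

lemma setup_prog_correct: "fst (setup_prog N r c C \<epsilon>) = (reg_gamma N \<epsilon>, rt, ct)"
proof -
  have mx: "Max ((\<lambda>i. Max ((\<lambda>j. \<bar>C $$ (i, j)\<bar>) ` {..<N})) ` {..<N}) = M"
    using Max_Max[of N "\<lambda>i j. \<bar>C $$ (i, j)\<bar>"] N_pos by (simp add: max_norm_def)
  have v: "vec N (\<lambda>i. (1 - e' / 8) * (v $ i + e' / (real N * (8 - e')))) = smooth_marginal N e' v"
    if "v \<in> carrier_vec N" for v
    using that by (intro eq_vecI) (simp_all add: smooth_marginal_def ones_def)
  show ?thesis
    unfolding setup_prog_def counted_simps aval.simps mx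
    unfolding eps_prime_def[symmetric] v[OF rc_props(1)] v[OF rc_props(2)] reg_gamma_def ..
qed

lemma stop_prog_correct:
  assumes "X \<in> carrier_mat N N" "G \<in> carrier_mat N N" "h = phi (eta s)" "X = Xhat s" "G = rounded s"
  shows "fst (stop_prog N C \<epsilon> (reg_gamma N \<epsilon>, rt, ct) X G h) = acc_stops N r c C \<epsilon> s"
proof -
  have "mat_inner C (rounded s - Xhat s) = (\<Sum>i<N. \<Sum>j<N. C $$ (i, j) * (G $$ (i, j) - X $$ (i, j)))"
    unfolding mat_inner_eq using assms by simp
  moreover have "reg_obj (reg_gamma N \<epsilon>) C (Xhat s) = (\<Sum>i<N. \<Sum>j<N. C $$ (i, j) * X $$ (i, j))
      + reg_gamma N \<epsilon> * (\<Sum>i<N. \<Sum>j<N. X $$ (i, j) * ln (X $$ (i, j)))"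
    using assms by (simp add: reg_obj_def mat_inner_def)
  ultimately show ?thesis
    unfolding stop_prog_def prod.case counted_simps aval.simps acc_stops_def ot_phi_eq by (simp add: assms(3))
qed

end

text \<open>
  The closed form of the increment in the program is the positive root of \<open>g a\<^sup>2 = 2 d (w + a)\<close>.
\<close>

lemma positive_root:
  fixes d w g :: real
  assumes "0 < d" "0 \<le> w" "0 < g"
  defines "a \<equiv> (d + sqrt (d * d + 2 * d * w * g)) / g"
  shows "0 < a" "a\<^sup>2 / (2 * (w + a)) * g = d"
proof -
  define R where "R = sqrt (d * d + 2 * d * w * g)"
  have rad: "0 \<le> d * d + 2 * d * w * g" using assms(1-3) by simp
  have R: "0 \<le> R" "R * R = d * d + 2 * d * w * g" using rad by (simp_all add: R_def)
  have ag: "a * g = d + R" using assms(3) by (simp add: a_def R_def)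
  show a: "0 < a" using assms(1,3) R(1) unfolding a_def R_def[symmetric] by simp
  have "(a * g) * (a * g) = d * d + 2 * (d * R) + R * R"
    unfolding ag by (simp add: distrib_left distrib_right)
  also have "\<dots> = 2 * d * (d + R) + 2 * d * w * g" unfolding R(2) by (simp add: distrib_left)
  also have "\<dots> = (2 * d * (w + a)) * g" unfolding ag[symmetric] by (simp add: distrib_left distrib_right)
  finally have "(a * a * g) * g = (2 * d * (w + a)) * g" by (simp only: mult_ac)
  then have "a * a * g = 2 * d * (w + a)" using assms(3) by simp
  then show "a\<^sup>2 / (2 * (w + a)) * g = d" using a assms(2) by (simp add: power2_eq_square field_simps)
qed

text \<open>
  Used one binding at a time, so that each stored value is replaced by its mathematical meaning before it is
  duplicated. Unfolding the whole program at once would copy it exponentially often.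
\<close>

lemma fst_bindI: "fst m = x \<Longrightarrow> fst (f x) = y \<Longrightarrow> fst (counted_bind m f) = y"
  by (simp add: counted_simps)

lemma fst_if: "fst (if b then m else m') = (if b then fst m else fst m')"
  by simp

context sinkhorn
begin

definition block_choice :: "point \<Rightarrow> point" where
  "block_choice lam = (if (\<Sum>j<N. snd (resid (plan lam)) $ j * snd (resid (plan lam)) $ j)
      \<le> (\<Sum>i<N. fst (resid (plan lam)) $ i * fst (resid (plan lam)) $ i)
    then min_y lam else min_z lam)"

definition step_size :: "real \<Rightarrow> point \<Rightarrow> real" where
  "step_size w lam =
    (let g = pair_inner N (resid (plan lam)) (resid (plan lam)); d = phi lam - phi (block_choice lam)
     in if g \<le> 0 then 1 else (d + sqrt (d * d + 2 * d * w * g)) / g)"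

definition next_plan :: "acc_state \<Rightarrow> point \<Rightarrow> real mat" where
  "next_plan s lam = (let a = step_size (weight s) lam in
     if pair_inner N (resid (plan lam)) (resid (plan lam)) \<le> 0 then plan lam
     else mat N N (\<lambda>(i, j). (a * plan lam $$ (i, j) + weight s * Xhat s $$ (i, j)) / (weight s + a)))"

definition next_state :: "acc_state \<Rightarrow> point \<Rightarrow> acc_state" where
  "next_state s lam = (let a = step_size (weight s) lam; g = resid (plan lam) in
     \<lparr> eta = block_choice lam,
       zeta = (vec N (\<lambda>i. fst (zeta s) $ i - a * fst g $ i), vec N (\<lambda>i. snd (zeta s) $ i - a * snd g $ i)),
       weight = weight s + a, Xhat = next_plan s lam, rounded = awr_round N r c (next_plan s lam) \<rparr>)"

lemma next_plan_carrier: "next_plan s lam \<in> carrier_mat N N"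
  by (simp add: next_plan_def Let_def plan_carrier)

lemma block_choice_is_arg_min:
  assumes lp: "lam \<in> points N"
  defines "g \<equiv> resid (plan lam)"
  shows "vnorm (snd g) \<le> vnorm (fst g) \<and>
      is_arg_min phi (\<lambda>p. fst p \<in> carrier_vec N \<and> snd p = snd lam) (block_choice lam) \<or>
    vnorm (fst g) \<le> vnorm (snd g) \<and>
      is_arg_min phi (\<lambda>p. fst p = fst lam \<and> snd p \<in> carrier_vec N) (block_choice lam)"
proof -
  have v: "vnorm (fst g) = sqrt (\<Sum>i<N. fst g $ i * fst g $ i)" "vnorm (snd g) = sqrt (\<Sum>i<N. snd g $ i * snd g $ i)"
    by (simp_all add: vnorm_def scalar_prod_def atLeast0LessThan g_def resid_def)
  show ?thesis
    using min_y_is_arg_min[OF lp] min_z_is_arg_min[OF lp]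
    unfolding block_choice_def v g_def[symmetric] real_sqrt_le_iff by (auto simp only: if_True if_False split: if_split)
qed

text \<open>
  If the gradient vanishes, \<open>\<lambda>\<close> already minimizes \<open>\<phi>\<close> and the equation for the increment holds with
  \<open>a = 1\<close>; otherwise the decrease of \<open>\<phi>\<close> is positive and the quadratic formula applies.
\<close>

lemma acc_step_next_state:
  assumes inv: "accel_inv k s" and lmin: "is_line_min phi (eta s) (zeta s) \<beta>"
  shows "acc_step N r c C \<epsilon> s (next_state s (segment (eta s) (zeta s) \<beta>))"
proof -
  note es = accel_invD(1)[OF inv] and zs = accel_invD(2)[OF inv] and Xc = accel_invD(3)[OF inv]
  define lam where "lam = segment (eta s) (zeta s) \<beta>"
  have lp: "lam \<in> points N" unfolding lam_def by (rule segment_points[OF es zs])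
  define g where "g = resid (plan lam)"
  define a where "a = step_size (weight s) lam"
  define d where "d = phi lam - phi (block_choice lam)"
  have "0 \<le> reg_gamma N \<epsilon> * (real k)\<^sup>2 / 16" using reg_gamma_pos by simp
  then have w: "0 \<le> weight s" using accel_invD(6)[OF inv] by linarith
  have grads: "fst g = grad_y phi lam" "snd g = grad_z phi lam"
    unfolding g_def by (rule grad_phi[OF lp, symmetric])+
  have gc: "fst g \<in> carrier_vec N" "snd g \<in> carrier_vec N" by (simp_all add: g_def resid_def)
  note blk = block_choice_is_arg_min[OF lp, folded g_def]
  have desc: "reg_gamma N \<epsilon> / 8 * pair_inner N g g \<le> d"
    using block_descent[OF lp g_def blk] unfolding d_def by linarith
  have root: "0 < a \<and> phi lam - a\<^sup>2 / (2 * (weight s + a)) * pair_inner N g g = phi (block_choice lam)"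
  proof (cases "pair_inner N g g \<le> 0")
    case True
    have z: "fst g = 0\<^sub>v N" "snd g = 0\<^sub>v N" using resid_zero_iff[OF g_def] True by blast+
    then have gz: "pair_inner N x g = 0" for x by (simp add: pair_inner_def)
    have "phi lam \<le> phi (block_choice lam)"
      using phi_convex[of lam "block_choice lam"] unfolding g_def[symmetric] gz by simp
    moreover have "0 \<le> d" using desc unfolding gz by simp
    moreover have "a = 1" using True by (simp add: a_def step_size_def g_def[symmetric])
    ultimately show ?thesis unfolding gz d_def by simp
  next
    case False
    then have g0: "0 < pair_inner N g g" by simp
    then have "0 < reg_gamma N \<epsilon> / 8 * pair_inner N g g" using reg_gamma_pos by simp
    then have d0: "0 < d" using desc by linarith
    have a: "a = (d + sqrt (d * d + 2 * d * weight s * pair_inner N g g)) / pair_inner N g g"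
      using False unfolding a_def step_size_def g_def[symmetric] d_def[symmetric] Let_def by simp
    show ?thesis using positive_root[OF d0 w g0, folded a] unfolding d_def by linarith
  qed
  have zeta: "zeta (next_state s lam) = (fst (zeta s) - a \<cdot>\<^sub>v fst g, snd (zeta s) - a \<cdot>\<^sub>v snd g)"
    using zs gc unfolding next_state_def Let_def a_def[symmetric] g_def[symmetric] points_def
    by (auto intro!: eq_vecI)
  have weight: "weight (next_state s lam) = weight s + a" and eta: "eta (next_state s lam) = block_choice lam"
    and rd: "rounded (next_state s lam) = awr_round N r c (Xhat (next_state s lam))"
    unfolding next_state_def Let_def a_def by simp_all
  have X: "Xhat (next_state s lam) = (if fst g = 0\<^sub>v N \<and> snd g = 0\<^sub>v N then plan lam
     else (1 / weight (next_state s lam)) \<cdot>\<^sub>m (a \<cdot>\<^sub>m plan lam + weight s \<cdot>\<^sub>m Xhat s))"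
  proof -
    have "Xhat (next_state s lam) = next_plan s lam" by (simp add: next_state_def Let_def)
    also have "\<dots> = (if fst g = 0\<^sub>v N \<and> snd g = 0\<^sub>v N then plan lam else
       mat N N (\<lambda>(i, j). (a * plan lam $$ (i, j) + weight s * Xhat s $$ (i, j)) / (weight s + a)))"
      unfolding next_plan_def Let_def g_def[symmetric] a_def[symmetric] resid_zero_iff[OF g_def] ..
    also have "mat N N (\<lambda>(i, j). (a * plan lam $$ (i, j) + weight s * Xhat s $$ (i, j)) / (weight s + a)) =
       (1 / weight (next_state s lam)) \<cdot>\<^sub>m (a \<cdot>\<^sub>m plan lam + weight s \<cdot>\<^sub>m Xhat s)"
      unfolding weight using Xc plan_carrier[of lam] by (intro eq_matI) simp_all
    finally show ?thesis .
  qed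
  show ?thesis
    unfolding acc_step_def Let_def ot_phi_eq lam_def[symmetric]
    apply (rule exI[of _ \<beta>], rule exI[of _ lam], rule exI[of _ "fst g"], rule exI[of _ "snd g"], rule exI[of _ a])
    unfolding eta weight
    using lmin lam_def grads blk root zeta X rd unfolding resid_norm[OF g_def] weight by blast
qed

lemma acc_step_exists:
  assumes "accel_inv k s"
  shows "\<exists>s'. acc_step N r c C \<epsilon> s s'"
  using line_min_exists[OF accel_invD(1,2)[OF assms]] acc_step_next_state[OF assms] by blast

lemma iter_prog_correct:
  fixes ls :: "point \<Rightarrow> point \<Rightarrow> real"
  assumes s: "eta s \<in> points N" "zeta s \<in> points N"
  defines "s' \<equiv> next_state s (segment (eta s) (zeta s) (ls (eta s) (zeta s)))"
  shows "fst (iter_prog q ls N r c C \<epsilon> (reg_gamma N \<epsilon>, rt, ct) s) = (s', acc_stops N r c C \<epsilon> s')"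
proof -
  define lam where "lam = segment (eta s) (zeta s) (ls (eta s) (zeta s))"
  define g where "g = resid (plan lam)"
  have gy: "vec N (\<lambda>i. rt $ i - (\<Sum>j<N. plan lam $$ (i, j))) = fst g"
    and gz: "vec N (\<lambda>j. ct $ j - (\<Sum>i<N. plan lam $$ (i, j))) = snd g"
    by (simp_all add: g_def resid_def row_mass_def col_mass_def)
  define a where "a = step_size (weight s) lam"
  define X where "X = next_plan s lam"
  have gg: "(\<Sum>i<N. fst g $ i * fst g $ i) + (\<Sum>i<N. snd g $ i * snd g $ i) = pair_inner N g g"
    by (simp add: pair_inner_def)
  have blk: "(if (\<Sum>i<N. snd g $ i * snd g $ i) \<le> (\<Sum>i<N. fst g $ i * fst g $ i) then min_y lam else min_z lam)
      = block_choice lam"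
    by (simp add: block_choice_def g_def)
  have a: "(if pair_inner N g g \<le> 0 then 1 else
     (phi lam - phi (block_choice lam) + sqrt ((phi lam - phi (block_choice lam)) * (phi lam - phi (block_choice lam)) +
        2 * (phi lam - phi (block_choice lam)) * weight s * pair_inner N g g)) / pair_inner N g g) = a"
    by (simp add: a_def step_size_def Let_def g_def)
  have X: "(if pair_inner N g g \<le> 0 then plan lam else
     mat N N (\<lambda>(i, j). (a * plan lam $$ (i, j) + weight s * Xhat s $$ (i, j)) / (weight s + a))) = X"
    by (simp add: X_def next_plan_def Let_def g_def a_def)
  have s': "s' = \<lparr> eta = block_choice lam,
       zeta = (vec N (\<lambda>i. fst (zeta s) $ i - a * fst g $ i), vec N (\<lambda>i. snd (zeta s) $ i - a * snd g $ i)),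
       weight = weight s + a, Xhat = X, rounded = awr_round N r c X \<rparr>"
    by (simp add: s'_def next_state_def Let_def a_def g_def X_def lam_def)
  have Xc: "X \<in> carrier_mat N N" unfolding X_def by (rule next_plan_carrier)
  have Rc: "awr_round N r c X \<in> carrier_mat N N"
    unfolding awr_round_def Let_def by (rule add_carrier_mat) (rule mat_carrier)
  note stop = stop_prog_correct[OF Xc Rc, of "phi (block_choice lam)" s']
  have stop': "fst (stop_prog N C \<epsilon> (reg_gamma N \<epsilon>, rt, ct) X (awr_round N r c X) (phi (block_choice lam)))
     = acc_stops N r c C \<epsilon> s'"
    by (rule stop) (simp_all add: s')
  have ls: "fst (line_search_prog q ls N C (reg_gamma N \<epsilon>, rt, ct) (eta s) (zeta s)) = ls (eta s) (zeta s)"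
    by (simp add: line_search_prog_def)
  show ?thesis
    unfolding iter_prog_def prod.case
    apply (rule fst_bindI[OF ls])
    apply (rule fst_bindI[OF segment_prog_correct[OF s, of "ls (eta s) (zeta s)", folded lam_def]])
    apply (rule fst_bindI[OF gibbs_prog_correct])
    apply (rule fst_bindI[where x = "fst g"], simp only: counted_simps aval.simps gy)
    apply (rule fst_bindI[where x = "snd g"], simp only: counted_simps aval.simps gz)
    apply (rule fst_bindI[where x = "\<Sum>i<N. fst g $ i * fst g $ i"], simp only: counted_simps aval.simps)
    apply (rule fst_bindI[where x = "\<Sum>i<N. snd g $ i * snd g $ i"], simp only: counted_simps aval.simps)
    apply (rule fst_bindI[where x = "(\<Sum>i<N. snd g $ i * snd g $ i) \<le> (\<Sum>i<N. fst g $ i * fst g $ i)"],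
        simp only: counted_simps aval.simps)
    apply (rule fst_bindI[where x = "block_choice lam"],
        simp only: fst_if block_y_prog_correct block_z_prog_correct blk)
    apply (rule fst_bindI[where x = "pair_inner N g g"], simp only: counted_simps aval.simps gg)
    apply (rule fst_bindI[OF dual_prog_correct])
    apply (rule fst_bindI[OF dual_prog_correct])
    apply (rule fst_bindI[where x = "phi lam - phi (block_choice lam)"], simp only: counted_simps aval.simps)
    apply (rule fst_bindI[where x = "pair_inner N g g \<le> 0"], simp only: counted_simps aval.simps)
    apply (rule fst_bindI[where x = a], simp only: fst_if counted_simps aval.simps a)
    apply (rule fst_bindI[where x = "weight s + a"], simp only: counted_simps aval.simps)
    apply (rule fst_bindI[where x = "vec N (\<lambda>i. fst (zeta s) $ i - a * fst g $ i)"],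
        simp only: counted_simps aval.simps)
    apply (rule fst_bindI[where x = "vec N (\<lambda>i. snd (zeta s) $ i - a * snd g $ i)"],
        simp only: counted_simps aval.simps)
    apply (rule fst_bindI[where x = X], simp only: fst_if counted_simps aval.simps X)
    apply (rule fst_bindI[OF round_prog_correct[OF Xc rc_props(1,2)]])
    apply (rule fst_bindI[OF stop'])
    apply (simp only: counted_simps s')
    done
qed

end

section \<open>Operation counts\<close>

lemma snd_if: "snd (if b then m else m') = (if b then snd m else snd m')"
  by simp

lemma ops_kernel: "snd (kernel_prog N C \<gamma> p) = 5 * N\<^sup>2"
  by (simp add: kernel_prog_def counted_simps power2_eq_square)

lemma ops_gibbs: "snd (gibbs_prog N C \<gamma> p) = 7 * N\<^sup>2 + N"
  by (simp add: gibbs_prog_def counted_simps ops_kernel power2_eq_square)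

lemma ops_dual: "snd (dual_prog N C prm p) = 6 * N\<^sup>2 + 5 * N + 4"
  by (cases prm) (simp add: dual_prog_def counted_simps ops_kernel power2_eq_square)

lemma ops_segment: "snd (segment_prog N p p' \<beta>) = 8 * N"
  by (simp add: segment_prog_def counted_simps)

lemma ops_line_search: "snd (line_search_prog q ls N C prm p p') = q * (6 * N\<^sup>2 + 13 * N + 4)"
  by (simp add: line_search_prog_def counted_simps ops_segment ops_dual)

lemma ops_block_y: "snd (block_y_prog N C prm p) = 5 * N\<^sup>2 + 4 * N"
  by (cases prm) (simp add: block_y_prog_def counted_simps power2_eq_square algebra_simps)

lemma ops_block_z: "snd (block_z_prog N C prm p) = 5 * N\<^sup>2 + 4 * N"
  by (cases prm) (simp add: block_z_prog_def counted_simps power2_eq_square algebra_simps)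

text \<open>
  Operation counts do not depend on the stored values, so the count of the continuation is the same
  for all of them.
\<close>

lemma snd_bind_eq: "snd m = a \<Longrightarrow> (\<And>x. snd (f x) = b) \<Longrightarrow> snd (counted_bind m f) = a + b"
  by (simp add: counted_simps)

lemma snd_bind_le: "snd m \<le> a \<Longrightarrow> (\<And>x. snd (f x) \<le> b) \<Longrightarrow> snd (counted_bind m f) \<le> a + b"
  by (simp add: counted_simps add_mono)

lemma ops_round: "snd (round_prog N r c F) = 9 * N\<^sup>2 + 8 * N"
proof -
  have "snd (round_prog N r c F) = N * (N + 2) + (N * N + (N * (N + 2) + (N * N + (N * (N + 1)
      + (N * (N + 1) + (2 * N + 3 * N * N))))))"
    unfolding round_prog_def
    by (intro snd_bind_eq) (simp_all add: counted_simps)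
  then show ?thesis by (simp add: power2_eq_square algebra_simps)
qed

lemma ops_stop: "snd (stop_prog N C \<epsilon> prm X G h) = 8 * N\<^sup>2 + 3 * N + 7"
  by (cases prm) (simp add: stop_prog_def counted_simps power2_eq_square algebra_simps)

lemma ops_setup: "snd (setup_prog N r c C \<epsilon>) = 2 * N\<^sup>2 + 5 * N + 10"
  by (simp add: setup_prog_def counted_simps power2_eq_square algebra_simps)

lemma ops_setup_le:
  assumes "1 \<le> N"
  shows "snd (setup_prog N r c C \<epsilon>) \<le> 17 * N\<^sup>2"
proof -
  have "N \<le> N\<^sup>2" "1 \<le> N\<^sup>2" using assms by (simp_all add: power2_eq_square)
  then show ?thesis unfolding ops_setup by linarith
qed

lemma ops_iter_le:
  assumes "1 \<le> N"
  shows "snd (iter_prog q ls N r c C \<epsilon> prm s) \<le> (120 + 23 * q) * N\<^sup>2"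
proof -
  obtain \<gamma> rt ct where prm: "prm = (\<gamma>, rt, ct)" by (cases prm)
  have N: "N \<le> N\<^sup>2" "1 \<le> N\<^sup>2" using assms by (simp_all add: power2_eq_square)
  have "snd (iter_prog q ls N r c C \<epsilon> prm s) \<le> q * (6 * N\<^sup>2 + 13 * N + 4) + (8 * N + ((7 * N\<^sup>2 + N)
      + ((N\<^sup>2 + N) + ((N\<^sup>2 + N) + (2 * N + (2 * N + (1 + ((5 * N\<^sup>2 + 4 * N) + (1 + ((6 * N\<^sup>2 + 5 * N + 4)
      + ((6 * N\<^sup>2 + 5 * N + 4) + (1 + (1 + (8 + (1 + (2 * N + (2 * N + (4 * N\<^sup>2 + ((9 * N\<^sup>2 + 8 * N)
      + ((8 * N\<^sup>2 + 3 * N + 7) + 0))))))))))))))))))))"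
    unfolding iter_prog_def prm prod.case
    by (intro snd_bind_le) (simp_all add: counted_simps snd_if ops_line_search ops_segment ops_gibbs ops_block_y
        ops_block_z ops_dual ops_round ops_stop power2_eq_square)
  also have "\<dots> \<le> q * (23 * N\<^sup>2) + 120 * N\<^sup>2"
    by (intro order_trans[OF _ add_mono[OF mult_left_mono[of "6 * N\<^sup>2 + 13 * N + 4" "23 * N\<^sup>2" q] order_refl]])
      (use N in linarith)+
  finally show ?thesis by (simp add: algebra_simps)
qed

section \<open>The complexity theorem\<close>

lemma exec_prog_Suc:
  assumes "fst (exec_prog q ls N r c C \<epsilon> k) = (prm, s, b)"
  shows "fst (exec_prog q ls N r c C \<epsilon> (Suc k)) = (prm, fst (iter_prog q ls N r c C \<epsilon> prm s))"
    and "snd (exec_prog q ls N r c C \<epsilon> (Suc k)) =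
      snd (exec_prog q ls N r c C \<epsilon> k) + snd (iter_prog q ls N r c C \<epsilon> prm s)"
proof -
  obtain s' b' where it: "fst (iter_prog q ls N r c C \<epsilon> prm s) = (s', b')" by fastforce
  show "fst (exec_prog q ls N r c C \<epsilon> (Suc k)) = (prm, fst (iter_prog q ls N r c C \<epsilon> prm s))"
    unfolding exec_prog.simps counted_simps assms prod.case it ..
  show "snd (exec_prog q ls N r c C \<epsilon> (Suc k)) =
      snd (exec_prog q ls N r c C \<epsilon> k) + snd (iter_prog q ls N r c C \<epsilon> prm s)"
    unfolding exec_prog.simps counted_simps assms prod.case it by simp
qed

context sinkhorn
begin

context
  fixes q :: nat and ls :: "point \<Rightarrow> point \<Rightarrow> real"
  assumes ls: "\<forall>p\<in>carrier_vec N \<times> carrier_vec N. \<forall>p'\<in>carrier_vec N \<times> carrier_vec N.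
    is_line_min (ot_phi N r c C \<epsilon>) p p' (ls p p')"
begin

abbreviation "exec k \<equiv> exec_prog q ls N r c C \<epsilon> k"
abbreviation "st k \<equiv> exec_state q ls N r c C \<epsilon> k"
abbreviation "halted k \<equiv> exec_stop q ls N r c C \<epsilon> k"

lemma exec_params: "fst (exec k) = ((reg_gamma N \<epsilon>, rt, ct), st k, halted k)"
proof -
  have "fst (fst (exec k)) = (reg_gamma N \<epsilon>, rt, ct)"
  proof (induction k)
    case 0
    show ?case unfolding exec_prog.simps counted_simps setup_prog_correct by simp
  next
    case (Suc k)
    then have "fst (exec k) = ((reg_gamma N \<epsilon>, rt, ct), fst (snd (fst (exec k))), snd (snd (fst (exec k))))"
      by (simp add: prod_eq_iff)
    from exec_prog_Suc(1)[OF this] show ?case by simp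
  qed
  then show ?thesis by (simp add: prod_eq_iff exec_state_def exec_stop_def)
qed

lemma exec_zero: "st 0 = acc_init N" "halted 0 \<longleftrightarrow> False"
  unfolding exec_state_def exec_stop_def exec_prog.simps counted_simps by simp_all

lemma exec_step:
  assumes run: "acc_run N r c C \<epsilon> k (st k)" and go: "k = 0 \<or> \<not> acc_stops N r c C \<epsilon> (st k)"
  shows "acc_run N r c C \<epsilon> (Suc k) (st (Suc k))" "halted (Suc k) = acc_stops N r c C \<epsilon> (st (Suc k))"
proof -
  have inv: "accel_inv k (st k)" by (rule unfinished_run_inv[OF run go])
  note pts = accel_invD(1,2)[OF inv]
  let ?s' = "next_state (st k) (segment (eta (st k)) (zeta (st k)) (ls (eta (st k)) (zeta (st k))))"
  have "fst (exec (Suc k)) = ((reg_gamma N \<epsilon>, rt, ct), ?s', acc_stops N r c C \<epsilon> ?s')"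
    unfolding exec_prog_Suc(1)[OF exec_params] iter_prog_correct[OF pts] ..
  then have st: "st (Suc k) = ?s'" "halted (Suc k) = acc_stops N r c C \<epsilon> ?s'"
    unfolding exec_params[of "Suc k"] by simp_all
  have "is_line_min phi (eta (st k)) (zeta (st k)) (ls (eta (st k)) (zeta (st k)))"
    using pts unfolding points_def by (rule ls[unfolded ot_phi_eq, rule_format])
  then have "acc_step N r c C \<epsilon> (st k) ?s'" by (rule acc_step_next_state[OF inv])
  then show "acc_run N r c C \<epsilon> (Suc k) (st (Suc k))"
    unfolding st by (rule acc_run.iterate[OF run go])
  show "halted (Suc k) = acc_stops N r c C \<epsilon> (st (Suc k))" unfolding st ..
qed

text \<open>
  As long as the program has not halted, its states form a run of the algorithm.
\<close>

lemma exec_run: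
  assumes "\<forall>j<k. \<not> halted j"
  shows "acc_run N r c C \<epsilon> k (st k) \<and> (0 < k \<longrightarrow> halted k = acc_stops N r c C \<epsilon> (st k))"
  using assms
proof (induction k)
  case 0
  show ?case unfolding exec_zero using acc_run.start by simp
next
  case (Suc k)
  then have IH: "acc_run N r c C \<epsilon> k (st k)" "0 < k \<longrightarrow> halted k = acc_stops N r c C \<epsilon> (st k)" by simp_all
  then have "k = 0 \<or> \<not> acc_stops N r c C \<epsilon> (st k)" using Suc.prems by auto
  from exec_step[OF IH(1) this] show ?case by blast
qed

lemma exec_halts: "\<exists>k. halted k"
proof (rule ccontr)
  assume "\<nexists>k. halted k"
  then have "real k \<le> 500 * rate" for k
    using exec_run[of k] acc_run_bound by blast
  then show False using reals_Archimedean2[of "500 * rate"] by (meson not_le)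
qed

lemma exec_ops_Suc:
  "exec_ops q ls N r c C \<epsilon> (Suc k) \<le> exec_ops q ls N r c C \<epsilon> k + (120 + 23 * q) * N\<^sup>2"
  unfolding exec_ops_def exec_prog_Suc(2)[OF exec_params]
  using ops_iter_le[of N q ls r c C \<epsilon> "(reg_gamma N \<epsilon>, rt, ct)" "st k"] N_pos by simp

lemma exec_ops_bound: "exec_ops q ls N r c C \<epsilon> k \<le> 17 * N\<^sup>2 + k * ((120 + 23 * q) * N\<^sup>2)"
proof (induction k)
  case 0
  show ?case unfolding exec_ops_def exec_prog.simps counted_simps using ops_setup_le[of N r c C \<epsilon>] N_pos by simp
next
  case (Suc k)
  then show ?case using exec_ops_Suc[of k] by simp
qed

lemma exec_correct:
  assumes K: "500 * (120 + 23 * real q) + 64 * 17 \<le> K"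
  shows "\<exists>T. (\<forall>k<T. \<not> halted k) \<and> halted T \<and>
    (\<forall>k\<le>T. acc_run N r c C \<epsilon> k (st k)) \<and>
    acc_returns N r c C \<epsilon> T (rounded (st T)) \<and>
    (\<forall>k<T. real (exec_ops q ls N r c C \<epsilon> (Suc k)) - real (exec_ops q ls N r c C \<epsilon> k) \<le> K * (real N)\<^sup>2) \<and>
    real (exec_ops q ls N r c C \<epsilon> T) \<le> K * ((real N)\<^sup>2 * rate)"
proof -
  define T where "T = (LEAST k. halted k)"
  have hT: "halted T" unfolding T_def using exec_halts by (rule LeastI_ex)
  have nT: "\<forall>k<T. \<not> halted k" unfolding T_def using not_less_Least by blast
  have run: "\<forall>k\<le>T. acc_run N r c C \<epsilon> k (st k)" using exec_run nT by (meson less_le_trans)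
  have T0: "0 < T" using hT exec_zero(2) by (cases T) auto
  have "acc_returns N r c C \<epsilon> T (rounded (st T))"
    unfolding acc_returns_def using run T0 hT exec_run[OF nT] by blast
  moreover have "real (exec_ops q ls N r c C \<epsilon> (Suc k)) - real (exec_ops q ls N r c C \<epsilon> k) \<le> K * (real N)\<^sup>2" for k
  proof -
    have "real (exec_ops q ls N r c C \<epsilon> (Suc k)) \<le> real (exec_ops q ls N r c C \<epsilon> k + (120 + 23 * q) * N\<^sup>2)"
      using exec_ops_Suc[of k] by (rule of_nat_mono)
    moreover have "(120 + 23 * real q) * (real N)\<^sup>2 \<le> K * (real N)\<^sup>2"
      using K by (intro mult_right_mono) simp_all
    ultimately show ?thesis by simp
  qed
  moreover have "real (exec_ops q ls N r c C \<epsilon> T) \<le> K * ((real N)\<^sup>2 * rate)"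
  proof -
    define Q where "Q = 120 + 23 * real q"
    define n where "n = (real N)\<^sup>2"
    have n: "0 \<le> n" and Q: "0 \<le> Q" by (simp_all add: n_def Q_def)
    have alg: "17 * 64 * R * n + 500 * R * (Q * n) = (500 * Q + 64 * 17) * (n * R)" for R
      by (simp add: algebra_simps)
    have "real (exec_ops q ls N r c C \<epsilon> T) \<le> real (17 * N\<^sup>2 + T * ((120 + 23 * q) * N\<^sup>2))"
      using exec_ops_bound[of T] by (rule of_nat_mono)
    also have "\<dots> = 17 * n + real T * (Q * n)" by (simp add: n_def Q_def)
    also have "\<dots> \<le> 17 * 64 * rate * n + 500 * rate * (Q * n)"
    proof (rule add_mono)
      \<comment> \<open>The setup cost is charged to the iterations, as the rate is at least \<open>1 / 64\<close>.\<close>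
      show "17 * n \<le> 17 * 64 * rate * n" using rate_ge n by (intro mult_right_mono) linarith+
      show "real T * (Q * n) \<le> 500 * rate * (Q * n)"
        using acc_run_bound run n Q by (intro mult_right_mono mult_nonneg_nonneg) blast+
    qed
    also have "\<dots> = (500 * Q + 64 * 17) * (n * rate)" by (rule alg)
    also have "\<dots> \<le> K * (n * rate)"
      using K n rate_ge unfolding Q_def by (intro mult_right_mono mult_nonneg_nonneg) linarith+
    finally show ?thesis unfolding n_def .
  qed
  ultimately show ?thesis using nT hT run by blast
qed

end

end

theorem mainTheorem3:
  fixes q :: nat
  shows "\<exists>K::real. 0 < K \<and>
    (\<forall>N r c C Xs \<epsilon>.
       2 \<le> N \<longrightarrow> r \<in> prob_simplex N \<longrightarrow> c \<in> prob_simplex N \<longrightarrow>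
       C \<in> carrier_mat N N \<longrightarrow> (\<forall>i<N. \<forall>j<N. 0 \<le> C $$ (i, j)) \<longrightarrow> 0 < max_norm C \<longrightarrow>
       is_arg_min (mat_inner C) (\<lambda>X. X \<in> transport_polytope N r c) Xs \<longrightarrow>
       0 < \<epsilon> \<longrightarrow> eps_prime C \<epsilon> < 8 \<longrightarrow>
         (\<forall>k s. acc_run N r c C \<epsilon> k s \<longrightarrow>
            real k \<le> K * (real N powr (1/2) * sqrt (ln (real N)) * max_norm C / \<epsilon>)) \<and>
         (\<forall>k s. acc_run N r c C \<epsilon> k s \<longrightarrow> k = 0 \<or> \<not> acc_stops N r c C \<epsilon> s \<longrightarrow>
            (\<exists>s'. acc_step N r c C \<epsilon> s s')) \<and>
         (\<forall>k G. acc_returns N r c C \<epsilon> k G \<longrightarrow>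
            G \<in> transport_polytope N r c \<and> mat_inner C G - mat_inner C Xs \<le> \<epsilon>) \<and>
         (\<forall>ls. (\<forall>p\<in>carrier_vec N \<times> carrier_vec N. \<forall>p'\<in>carrier_vec N \<times> carrier_vec N.
                  is_line_min (ot_phi N r c C \<epsilon>) p p' (ls p p')) \<longrightarrow>
            (\<exists>T. (\<forall>k<T. \<not> exec_stop q ls N r c C \<epsilon> k) \<and> exec_stop q ls N r c C \<epsilon> T \<and>
               (\<forall>k\<le>T. acc_run N r c C \<epsilon> k (exec_state q ls N r c C \<epsilon> k)) \<and>
               acc_returns N r c C \<epsilon> T (rounded (exec_state q ls N r c C \<epsilon> T)) \<and>
               (\<forall>k<T. real (exec_ops q ls N r c C \<epsilon> (Suc k)) - real (exec_ops q ls N r c C \<epsilon> k)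
                        \<le> K * (real N)\<^sup>2) \<and>
               real (exec_ops q ls N r c C \<epsilon> T)
                 \<le> K * (real N powr (5/2) * sqrt (ln (real N)) * max_norm C / \<epsilon>))))"
proof -
  define K where "K = 500 * (120 + 23 * real q) + 64 * 17"
  have K0: "0 < K" and K500: "500 \<le> K" by (simp_all add: K_def)
  show ?thesis
  proof (rule exI[of _ K], intro conjI[OF K0] allI impI)
    fix N :: nat and r c :: "real vec" and C Xs :: "real mat" and \<epsilon> :: real
    assume asm: "2 \<le> N" "r \<in> prob_simplex N" "c \<in> prob_simplex N" "C \<in> carrier_mat N N"
      "\<forall>i<N. \<forall>j<N. 0 \<le> C $$ (i, j)" "0 < max_norm C"
      and opt: "is_arg_min (mat_inner C) (\<lambda>X. X \<in> transport_polytope N r c) Xs"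
      and asm': "0 < \<epsilon>" "eps_prime C \<epsilon> < 8"
    interpret sinkhorn N r c C \<epsilon>
      using asm asm' by unfold_locales simp_all
    have rate: "real N powr (1/2) * sqrt (ln (real N)) * max_norm C / \<epsilon> = rate"
      by (simp add: powr_half_sqrt)
    have "real N powr (5/2) = real N powr (2 + 1/2)" by simp
    also have "\<dots> = (real N)\<^sup>2 * sqrt (real N)"
      unfolding powr_add using asm(1) by (simp add: powr_half_sqrt powr_numeral)
    finally have rate2: "real N powr (5/2) * sqrt (ln (real N)) * max_norm C / \<epsilon> = (real N)\<^sup>2 * rate"
      by simp
    have iters: "real k \<le> K * rate" if "acc_run N r c C \<epsilon> k s" for k s
    proof -
      have "500 * rate \<le> K * rate" using K500 rate_ge by (intro mult_right_mono) linarith+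
      then show ?thesis using acc_run_bound[OF that] by linarith
    qed
    show "(\<forall>k s. acc_run N r c C \<epsilon> k s \<longrightarrow>
            real k \<le> K * (real N powr (1/2) * sqrt (ln (real N)) * max_norm C / \<epsilon>)) \<and>
         (\<forall>k s. acc_run N r c C \<epsilon> k s \<longrightarrow> k = 0 \<or> \<not> acc_stops N r c C \<epsilon> s \<longrightarrow>
            (\<exists>s'. acc_step N r c C \<epsilon> s s')) \<and>
         (\<forall>k G. acc_returns N r c C \<epsilon> k G \<longrightarrow>
            G \<in> transport_polytope N r c \<and> mat_inner C G - mat_inner C Xs \<le> \<epsilon>) \<and>
         (\<forall>ls. (\<forall>p\<in>carrier_vec N \<times> carrier_vec N. \<forall>p'\<in>carrier_vec N \<times> carrier_vec N.
                  is_line_min (ot_phi N r c C \<epsilon>) p p' (ls p p')) \<longrightarrow>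
            (\<exists>T. (\<forall>k<T. \<not> exec_stop q ls N r c C \<epsilon> k) \<and> exec_stop q ls N r c C \<epsilon> T \<and>
               (\<forall>k\<le>T. acc_run N r c C \<epsilon> k (exec_state q ls N r c C \<epsilon> k)) \<and>
               acc_returns N r c C \<epsilon> T (rounded (exec_state q ls N r c C \<epsilon> T)) \<and>
               (\<forall>k<T. real (exec_ops q ls N r c C \<epsilon> (Suc k)) - real (exec_ops q ls N r c C \<epsilon> k)
                        \<le> K * (real N)\<^sup>2) \<and>
               real (exec_ops q ls N r c C \<epsilon> T)
                 \<le> K * (real N powr (5/2) * sqrt (ln (real N)) * max_norm C / \<epsilon>)))"
      unfolding rate rate2
    proof (intro conjI)
      show "\<forall>k s. acc_run N r c C \<epsilon> k s \<longrightarrow> real k \<le> K * rate" using iters by blast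
      show "\<forall>k s. acc_run N r c C \<epsilon> k s \<longrightarrow> k = 0 \<or> \<not> acc_stops N r c C \<epsilon> s \<longrightarrow>
          (\<exists>s'. acc_step N r c C \<epsilon> s s')"
        using acc_step_exists[OF unfinished_run_inv] by blast
      show "\<forall>k G. acc_returns N r c C \<epsilon> k G \<longrightarrow>
          G \<in> transport_polytope N r c \<and> mat_inner C G - mat_inner C Xs \<le> \<epsilon>"
        using acc_returns_accurate[OF _ opt] by blast
    qed (intro allI impI, rule exec_correct, assumption, simp add: K_def)
  qed
qed

end
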